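(* Let $\varphi_n$, $n=1,2,\dots$, be the $L^2$-normalized eigenfunctions of $H=\left(-\frac{d^2}{dx^2}\right)^{1/2}+x^2$ on $L^2(\mathbb{R})$, ordered by increasing eigenvalue. For every $k=1,2,\dots$ and $N=2,3,\dots$ we have $$\varphi_{2k-1}(z)=\sqrt{\frac{2}{-a_k'}}\left(\frac{p_3(a_k')}{z^4}-\frac{p_5(a_k')}{z^6}+\dots+(-1)^N\frac{p_{2N-1}(a_k')}{z^{2N}}\right)+O\left(\frac{1}{z^{2N+2}}\right)\quad\text{as }|z|\to\infty.$$ For every $k=1,2,\dots$ and $N=2,3,\dots$ we have $$\varphi_{2k}(z)=\sqrt2\left(\frac{q_4(a_k)}{z^5}-\frac{q_6(a_k)}{z^7}+\dots+(-1)^N\frac{q_{2N}(a_k)}{z^{2N+1}}\right)+O\left(\frac{1}{z^{2N+3}}\right)\quad\text{as }|z|\to\infty.$$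
   Context: $\left(-\frac{d^2}{dx^2}\right)^{1/2}$ is the Fourier multiplier operator with symbol $|k|$. $\mathrm{Ai}$ is the standard Airy function, the solution of $y''=xy$ decaying at $+\infty$. $a_k$ and $a_k'$, $k=1,2,\dots$, denote the zeroes of $\mathrm{Ai}$ and $\mathrm{Ai}'$, respectively, each listed in decreasing order. The operator $H$ has purely discrete simple spectrum with eigenvalues $\lambda_{2k-1}=-a_k'$ and $\lambda_{2k}=-a_k$, and the eigenfunctions $\varphi_n$ form an orthonormal basis of $L^2(\mathbb{R})$. The Fourier transforms $\widehat{\varphi_n}(x)=\frac{1}{\sqrt{2\pi}}\int_{\mathbb{R}}e^{ixz}\varphi_n(z)\,dz$ of the $L^2$-normalized eigenfunctions are given by $\widehat{\varphi_n}(x)=\frac{\mathrm{Ai}(|x|-\lambda_n)}{\sqrt{2\lambda_n}\,\mathrm{Ai}(-\lambda_n)}$ for odd $n$ and $\widehat{\varphi_n}(x)=\frac{\mathrm{sgn}(x)\,\mathrm{Ai}(|x|-\lambda_n)}{\sqrt2\,\mathrm{Ai}'(-\lambda_n)}$ for even $n$. The polynomials $p_n,q_n$ are those for which $\mathrm{Ai}^{(n)}(x)=p_n(x)\mathrm{Ai}(x)+q_n(x)\mathrm{Ai}'(x)$, defined by $p_0\equiv1$, $q_0\equiv0$ and $$p_{n+1}(x)=p_n'(x)+xq_n(x),\qquad q_{n+1}(x)=p_n(x)+q_n'(x).$$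
   Formalization: Both expansions are multiplied by 1/√(2π), which the printed formulas lack for L²-normalized eigenfunctions, and by a unimodular constant c (depending on k, not on N or z), since normalized eigenfunctions are fixed only up to phase; φ_n is taken as its continuous representative. *)

theory Defs
  imports
    "HOL-Analysis.Analysis"
    "HOL-Library.Landau_Symbols"
    "HOL-Computational_Algebra.Polynomial"
begin

(* The elements of L^2(R) are represented by Borel functions; equality in L^2 is
   equality almost everywhere and is written out where it is meant. *)
definition square_integrable :: "(real \<Rightarrow> complex) \<Rightarrow> bool" where
  "square_integrable f \<longleftrightarrow>
     f \<in> borel_measurable lborel \<and> integrable lborel (\<lambda>x. (cmod (f x))\<^sup>2)"

definition L2_normalized :: "(real \<Rightarrow> complex) \<Rightarrow> bool" where
  "L2_normalized f \<longleftrightarrow> square_integrable f \<and> (LINT x|lborel. (cmod (f x))\<^sup>2) = 1"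

(* "g is the Fourier transform of f" on L^2(R), in the sense of Plancherel: g is the limit
   in L^2 of the transforms (2 pi)^(-1/2) \<integral> exp(i x z) f(z) dz taken over -R \<le> z \<le> R.
   The distance is a nonnegative extended integral, so that no integrability
   convention is involved. *)
definition L2_fourier :: "(real \<Rightarrow> complex) \<Rightarrow> (real \<Rightarrow> complex) \<Rightarrow> bool" where
  "L2_fourier f g \<longleftrightarrow>
     square_integrable f \<and> square_integrable g \<and>
     ((\<lambda>R::real. \<integral>\<^sup>+x. ennreal ((cmod (g x - complex_of_real (1 / sqrt (2 * pi)) *
          (LINT z:{-R..R}|lborel. exp (\<i> * complex_of_real (x * z)) * f z)))\<^sup>2) \<partial>lborel)
        \<longlongrightarrow> 0) at_top"

(* The Fourier multiplier operator with symbol m, as a relation: f lies in its domain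
   and u represents its value at f. The domain condition, that m times the transform
   of f is in L^2, is part of L2_fourier u _. *)
definition fourier_multiplier ::
  "(real \<Rightarrow> complex) \<Rightarrow> (real \<Rightarrow> complex) \<Rightarrow> (real \<Rightarrow> complex) \<Rightarrow> bool" where
  "fourier_multiplier m f u \<longleftrightarrow>
     (\<exists>g. L2_fourier f g \<and> L2_fourier u (\<lambda>k. m k * g k))"

(* H = (-d^2/dx^2)^(1/2) + x^2 as an operator sum, with domain the intersection of the
   domains of the two summands; "H_op f h" reads "f is in the domain and h = H f". *)
definition H_op :: "(real \<Rightarrow> complex) \<Rightarrow> (real \<Rightarrow> complex) \<Rightarrow> bool" where
  "H_op f h \<longleftrightarrow>
     (\<exists>u. fourier_multiplier (\<lambda>k. complex_of_real \<bar>k\<bar>) f u \<and>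
          square_integrable (\<lambda>x. complex_of_real (x\<^sup>2) * f x) \<and>
          square_integrable h \<and>
          (AE x in lborel. h x = u x + complex_of_real (x\<^sup>2) * f x))"

definition H_eigenfunction :: "real \<Rightarrow> (real \<Rightarrow> complex) \<Rightarrow> bool" where
  "H_eigenfunction \<mu> f \<longleftrightarrow>
     H_op f (\<lambda>x. complex_of_real \<mu> * f x) \<and> \<not> (AE x in lborel. f x = 0)"

definition H_eigenvalues :: "real set" where
  "H_eigenvalues = {\<mu>. \<exists>f. H_eigenfunction \<mu> f}"

(* The decaying solutions of y'' = x y form a line; the value at 0 selects the standard
   normalization Ai(0) = 1 / (3^(2/3) Gamma(2/3)). *)
definition airy :: "real \<Rightarrow> real" where
  "airy = (THE y. (\<exists>y'. \<forall>x. (y has_real_derivative y' x) (at x) \<and>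
                            (y' has_real_derivative x * y x) (at x)) \<and>
                  (y \<longlongrightarrow> 0) at_top \<and>
                  y 0 = 1 / (3 powr (2/3) * Gamma (2/3)))"

(* Meaningful for k \<ge> 1, provided Z has at least k elements and is finite above each of
   its points: card is 0 on infinite sets, so card = k > 0 includes finiteness. *)
definition kth_largest :: "real set \<Rightarrow> nat \<Rightarrow> real" where
  "kth_largest Z k = (THE x. x \<in> Z \<and> card {y \<in> Z. x \<le> y} = k)"

definition airy_zero :: "nat \<Rightarrow> real" where
  "airy_zero = kth_largest {x. airy x = 0}"

definition airy_deriv_zero :: "nat \<Rightarrow> real" where
  "airy_deriv_zero = kth_largest {x. deriv airy x = 0}"

fun airy_p :: "nat \<Rightarrow> real poly" and airy_q :: "nat \<Rightarrow> real poly" where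
  "airy_p 0 = 1"
| "airy_q 0 = 0"
| "airy_p (Suc n) = pderiv (airy_p n) + [:0, 1:] * airy_q n"
| "airy_q (Suc n) = airy_p n + pderiv (airy_q n)"

end

theory Submission
  imports Defs "HOL-Probability.Levy" "HOL-Real_Asymp.Real_Asymp"
begin

text \<open>
  On the Fourier side the eigenvalue equation \<open>H \<phi> = \<mu> \<phi>\<close> is an ordinary
  differential equation: multiplication by \<open>x\<^sup>2\<close> becomes \<open>- d\<^sup>2/dk\<^sup>2\<close>, so the transform \<open>g\<close> of \<open>\<phi>\<close>
  satisfies \<open>g'' = (\<bar>k\<bar> - \<mu>) g\<close> (\<open>eigenfunction_ft_ode\<close>). On each half-line this is Airy's equation
  in the variable \<open>\<bar>k\<bar> - \<mu>\<close>, and square integrability leaves only multiples of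
  \<open>Ai (\<bar>k\<bar> - \<mu>)\<close> (\<open>solves_airy_on_square_integrable\<close>). Matching values and slopes at \<open>k = 0\<close> makes \<open>g\<close>
  either even, and then \<open>Ai' (- \<mu>) = 0\<close>, or odd, and then \<open>Ai (- \<mu>) = 0\<close>
  (\<open>eigenfunction_ft_profile\<close>). Conversely every such \<open>\<mu>\<close> is an eigenvalue
  (\<open>eigenfunction_of_parity\<close>). So the eigenvalues are the negated zeros of \<open>Ai\<close> and of \<open>Ai'\<close>. By
  Rolle's theorem these two sets interlace, starting with a zero of \<open>Ai'\<close>, so an increasing
  enumeration of all eigenvalues alternates between them (\<open>eigenvalues_are_airy_zeros\<close>).

  The asymptotics come from Fourier inversion. The eigenfunction is a constant times the
  transform of the even or odd extension of \<open>Ai (k - \<mu>)\<close>, a rapidly decaying function that is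
  smooth except at \<open>k = 0\<close>. Repeated integration by parts on the two half-lines produces the term
  \<open>(\<i>/z)\<^bsup>m+1\<^esup>\<close> times the jump of the \<open>m\<close>-th derivative at \<open>0\<close>, with a remainder that is again a
  bounded transform (\<open>ft_profile_remainder\<close>). The jumps of one parity cancel; the others are twice
  \<open>Ai\<^bsup>(m)\<^esup> (- \<mu>) = p\<^sub>m (- \<mu>) Ai (- \<mu>) + q\<^sub>m (- \<mu>) Ai' (- \<mu>)\<close>, where one of the two summands vanishes.
  That gives the polynomials in the statement. The modulus of the constant follows from
  Plancherel's identity, because \<open>x Ai\<^sup>2 - Ai'\<^sup>2\<close> is an antiderivative of \<open>Ai\<^sup>2\<close>; its phase is the
  \<open>c\<close> of the theorem.

  Two bodies of theory are built for this. Airy's function is obtained from power series: of two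
  independent series solutions a suitable combination is recessive, and Wronskians give its decay
  and uniqueness. The Fourier analysis (inversion, Bessel's inequality, Plancherel) rests on one
  identity, \<open>ft_gauss_smoothing\<close>, which says that damping a transform by a Gaussian amounts to
  averaging the function against a normal density; injectivity of the transform comes from Levy's
  uniqueness theorem for characteristic functions.
\<close>

section \<open>Solutions of the Airy equation\<close>

text \<open>
  The derivative is a separate argument because Wronskians and matching conditions refer to it. The
  set \<open>S\<close> is needed because the transform of an eigenfunction solves the equation on half-lines
  only, and the values may be complex because that transform is.
\<close>

definition solves_airy_on ::
    "real set \<Rightarrow> (real \<Rightarrow> 'a::real_normed_field) \<Rightarrow> (real \<Rightarrow> 'a) \<Rightarrow> bool" where
  "solves_airy_on S y y' \<longleftrightarrow>
     (\<forall>x\<in>S. (y has_vector_derivative y' x) (at x within S) \<and>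
            (y' has_vector_derivative of_real x * y x) (at x within S))"

text \<open>
  The equation has no first order term, so \<open>u v'' - u'' v = 0\<close>.
\<close>

lemma wronskian_constant:
  assumes "convex S" "solves_airy_on S u u'" "solves_airy_on S v v'" "x \<in> S" "y \<in> S"
  shows "u x * v' x - u' x * v x = u y * v' y - u' y * v y"
proof -
  obtain c where "\<And>x. x \<in> S \<Longrightarrow> u x * v' x - u' x * v x = c"
  proof (rule has_vector_derivative_zero_constant[OF assms(1), of "\<lambda>x. u x * v' x - u' x * v x"])
    fix t assume "t \<in> S"
    with assms have "(u has_vector_derivative u' t) (at t within S)"
      "(u' has_vector_derivative of_real t * u t) (at t within S)"
      "(v has_vector_derivative v' t) (at t within S)"
      "(v' has_vector_derivative of_real t * v t) (at t within S)"
      by (auto simp: solves_airy_on_def)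
    note d = this
    show "((\<lambda>x. u x * v' x - u' x * v x) has_vector_derivative 0) (at t within S)"
      by (rule has_vector_derivative_eq_rhs,
          rule has_vector_derivative_diff[OF has_vector_derivative_mult[OF d(1,4)]
            has_vector_derivative_mult[OF d(2,3)]])
        (simp add: algebra_simps)
  qed blast
  then show ?thesis using assms by auto
qed

text \<open>
  Comparing coefficients in \<open>y'' = x y\<close> for \<open>y = \<Sum> a\<^sub>n x\<^sup>n\<close> gives \<open>a\<^sub>2 = 0\<close> and this three-step
  recursion; \<open>c0\<close> and \<open>c1\<close> are the value and the slope at \<open>0\<close>.
\<close>

fun airy_coeff :: "real \<Rightarrow> real \<Rightarrow> nat \<Rightarrow> real" where
  "airy_coeff c0 c1 0 = c0"
| "airy_coeff c0 c1 (Suc 0) = c1"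
| "airy_coeff c0 c1 (Suc (Suc 0)) = 0"
| "airy_coeff c0 c1 (Suc (Suc (Suc n))) = airy_coeff c0 c1 n / (real (Suc (Suc (Suc n))) * real (Suc (Suc n)))"

lemma airy_coeff_nonneg: "c0 \<ge> 0 \<Longrightarrow> c1 \<ge> 0 \<Longrightarrow> airy_coeff c0 c1 n \<ge> 0"
  by (induction c0 c1 n rule: airy_coeff.induct) auto

text \<open>
  For any radius \<open>r\<close> the weights \<open>\<bar>a\<^sub>n\<bar> r\<^sup>n\<close> stop growing once the denominators of the recursion
  exceed \<open>r\<^sup>3\<close>. They are therefore bounded, and a radius of at least \<open>2 \<bar>x\<bar>\<close> gives a geometric
  majorant.
\<close>

lemma summable_airy_coeff: "summable (\<lambda>n. airy_coeff c0 c1 n * x ^ n)"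
proof -
  \<comment> \<open>the added \<open>1\<close> only keeps \<open>r\<close> positive when \<open>x = 0\<close>\<close>
  define r where "r = 2 * \<bar>x\<bar> + 1"
  have r: "r > 0" "\<bar>x\<bar> / r \<le> 1/2" by (auto simp: r_def field_simps)
  obtain m :: nat where m: "real m \<ge> r ^ 3" using real_arch_simple by blast
  define C where "C = Max ((\<lambda>n. \<bar>airy_coeff c0 c1 n\<bar> * r ^ n) ` {..m + 3})"
  have C: "\<bar>airy_coeff c0 c1 n\<bar> * r ^ n \<le> C" if "n \<le> m + 3" for n
    unfolding C_def using that by (intro Max_ge) auto
  have bound: "\<bar>airy_coeff c0 c1 n\<bar> * r ^ n \<le> C" for n
  proof (induction n rule: less_induct)
    case (less n)
    show ?case
    proof (cases "n \<le> m + 3")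
      case False
      then have k: "n = Suc (Suc (Suc (n - 3)))" "n - 3 \<ge> m" by auto
      define k where "k = n - 3"
      note k = k[folded k_def]
      define d where "d = real (Suc (Suc (Suc k))) * real (Suc (Suc k))"
      have "r ^ 3 \<le> real k" using m k by linarith
      also have "\<dots> \<le> d"
        by (simp add: d_def algebra_simps)
      finally have "r ^ 3 / d \<le> 1" by (simp add: d_def divide_le_eq_1)
      moreover have "\<bar>airy_coeff c0 c1 n\<bar> * r ^ n =
          (\<bar>airy_coeff c0 c1 k\<bar> * r ^ k) * (r ^ 3 / d)"
        by (subst (1 2) k) (simp add: d_def abs_mult abs_divide power3_eq_cube)
      ultimately have "\<bar>airy_coeff c0 c1 n\<bar> * r ^ n \<le> \<bar>airy_coeff c0 c1 k\<bar> * r ^ k"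
        using r mult_left_le[of "r ^ 3 / d" "\<bar>airy_coeff c0 c1 k\<bar> * r ^ k"]
        by (metis abs_ge_zero mult_nonneg_nonneg zero_le_power less_imp_le)
      also have "\<dots> \<le> C" using less k by simp
      finally show ?thesis .
    qed (use C in auto)
  qed
  show ?thesis
  proof (rule summable_comparison_test')
    show "summable (\<lambda>n. C * (1/2) ^ n :: real)" by (intro summable_mult summable_geometric) auto
    show "norm (airy_coeff c0 c1 n * x ^ n) \<le> C * (1/2) ^ n" for n
    proof -
      have "norm (airy_coeff c0 c1 n * x ^ n) = (\<bar>airy_coeff c0 c1 n\<bar> * r ^ n) * (\<bar>x\<bar> / r) ^ n"
        using r by (simp add: abs_mult power_abs power_divide)
      also have "\<dots> \<le> C * (1/2) ^ n"
        using r bound by (intro mult_mono power_mono) (auto intro: order_trans[OF _ bound[of 0]])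
      finally show ?thesis .
    qed
  qed
qed

definition airy_series :: "real \<Rightarrow> real \<Rightarrow> real \<Rightarrow> real" where
  "airy_series c0 c1 x = (\<Sum>n. airy_coeff c0 c1 n * x ^ n)"

definition airy_series' :: "real \<Rightarrow> real \<Rightarrow> real \<Rightarrow> real" where
  "airy_series' c0 c1 x = (\<Sum>n. diffs (airy_coeff c0 c1) n * x ^ n)"

lemma summable_diffs_airy_coeff: "summable (\<lambda>n. diffs (airy_coeff c0 c1) n * x ^ n)"
  by (rule termdiff_converges_all) (rule summable_airy_coeff)

lemma airy_series_solves: "solves_airy_on UNIV (airy_series c0 c1) (airy_series' c0 c1)"
proof -
  have 1: "(airy_series c0 c1 has_real_derivative airy_series' c0 c1 x) (at x)" for x
    unfolding airy_series_def[abs_def] airy_series'_def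
    by (rule termdiffs_strong_converges_everywhere) (rule summable_airy_coeff)
  have 2: "(airy_series' c0 c1 has_real_derivative (\<Sum>n. diffs (diffs (airy_coeff c0 c1)) n * x ^ n)) (at x)" for x
    unfolding airy_series'_def[abs_def]
    by (rule termdiffs_strong_converges_everywhere) (rule summable_diffs_airy_coeff)
  have 3: "(\<Sum>n. diffs (diffs (airy_coeff c0 c1)) n * x ^ n) = x * airy_series c0 c1 x" for x
  proof -
    have "summable (\<lambda>n. diffs (diffs (airy_coeff c0 c1)) n * x ^ n)"
      by (rule termdiff_converges_all) (rule summable_diffs_airy_coeff)
    then have "(\<Sum>n. diffs (diffs (airy_coeff c0 c1)) n * x ^ n) =
        (\<Sum>n. diffs (diffs (airy_coeff c0 c1)) (Suc n) * x ^ Suc n) + diffs (diffs (airy_coeff c0 c1)) 0 * x ^ 0"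
      by (subst suminf_split_head) auto
    also have "diffs (diffs (airy_coeff c0 c1)) 0 * x ^ 0 = 0"
      by (simp add: diffs_def)
    also have "(\<lambda>n. diffs (diffs (airy_coeff c0 c1)) (Suc n) * x ^ Suc n) = (\<lambda>n. x * (airy_coeff c0 c1 n * x ^ n))"
    proof
      fix n
      show "diffs (diffs (airy_coeff c0 c1)) (Suc n) * x ^ Suc n = x * (airy_coeff c0 c1 n * x ^ n)"
        by (simp add: diffs_def del: of_nat_Suc)
    qed
    finally show ?thesis
      by (simp add: airy_series_def suminf_mult summable_airy_coeff)
  qed
  show ?thesis
    using 1 2 unfolding 3 solves_airy_on_def by (simp add: has_real_derivative_iff_has_vector_derivative)
qed

lemma airy_series_0: "airy_series c0 c1 0 = c0" "airy_series' c0 c1 0 = c1"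
  by (simp_all add: airy_series_def airy_series'_def diffs_def)

text \<open>
  All terms are nonnegative, so each one is a lower bound. This yields growth faster than any
  power, hence the decay of the recessive solution below.
\<close>

lemma airy_series_ge:
  assumes "c0 \<ge> 0" "c1 \<ge> 0" "x \<ge> 0"
  shows "airy_coeff c0 c1 n * x ^ n \<le> airy_series c0 c1 x"
    and "real (Suc n) * airy_coeff c0 c1 (Suc n) * x ^ n \<le> airy_series' c0 c1 x"
proof -
  show "airy_coeff c0 c1 n * x ^ n \<le> airy_series c0 c1 x"
    unfolding airy_series_def
    using sum_le_suminf[OF summable_airy_coeff, of "{n}" c0 c1 x] assms airy_coeff_nonneg by simp
  show "real (Suc n) * airy_coeff c0 c1 (Suc n) * x ^ n \<le> airy_series' c0 c1 x"
    unfolding airy_series'_def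
    using sum_le_suminf[OF summable_diffs_airy_coeff, of "{n}" c0 c1 x] assms airy_coeff_nonneg
    by (simp add: diffs_def)
qed

lemma airy_coeff_01_pos: "airy_coeff 0 1 (Suc (3 * n)) > 0"
proof (induction n)
  case (Suc n)
  have "Suc (3 * Suc n) = Suc (Suc (Suc (Suc (3 * n))))" by simp
  then show ?case using Suc by (simp only: airy_coeff.simps) simp
qed simp

lemma solves_airy_on_subset:
  "solves_airy_on S y y' \<Longrightarrow> T \<subseteq> S \<Longrightarrow> solves_airy_on T y y'"
  unfolding solves_airy_on_def by (meson has_vector_derivative_within_subset subsetD)

lemma solves_airy_on_of_real:
  "solves_airy_on S y y' \<Longrightarrow> solves_airy_on S (\<lambda>x. of_real (y x)) (\<lambda>x. of_real (y' x) :: 'a::real_normed_field)"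
  unfolding solves_airy_on_def of_real_eq_id id_apply
  by (auto simp flip: has_real_derivative_iff_has_vector_derivative of_real_mult
      intro!: has_vector_derivative_of_real)

lemma airy_series_wronskian:
  "airy_series 1 0 x * airy_series' 0 1 x - airy_series' 1 0 x * airy_series 0 1 x = 1"
  using wronskian_constant[OF convex_UNIV airy_series_solves airy_series_solves, of x 0 1 0 0 1]
  by (simp add: airy_series_0)

lemma airy_series_01_ge: "x \<ge> 0 \<Longrightarrow> airy_series 0 1 x \<ge> x" "x \<ge> 0 \<Longrightarrow> airy_series' 0 1 x \<ge> 1"
  using airy_series_ge[of 0 1 x 1] airy_series_ge[of 0 1 x 0] by simp_all

lemma airy_series_deriv:
  "(airy_series c0 c1 has_real_derivative airy_series' c0 c1 x) (at x)"
  "(airy_series' c0 c1 has_real_derivative x * airy_series c0 c1 x) (at x)"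
  using airy_series_solves[of c0 c1]
  by (auto simp: solves_airy_on_def has_real_derivative_iff_has_vector_derivative)

section \<open>The recessive solution\<close>

text \<open>
  Let \<open>f\<close> and \<open>g\<close> be the solutions with initial data \<open>(1, 0)\<close> and \<open>(0, 1)\<close>. Their Wronskian is \<open>1\<close>, so
  on \<open>x > 0\<close> the quotient \<open>f / g\<close> decreases, \<open>f' / g'\<close> increases, and \<open>f' / g' < f / g\<close>. A number
  separating the two quotients is the \<open>c\<close> for which \<open>f - c g\<close> is recessive; no limit has to be
  computed.
\<close>

lemma ex_subdominant_slope:
  "\<exists>c. \<forall>x>0. airy_series' 1 0 x / airy_series' 0 1 x \<le> c \<and> c \<le> airy_series 1 0 x / airy_series 0 1 x"
proof -
  let ?f = "airy_series 1 0" and ?g = "airy_series 0 1"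
  let ?f' = "airy_series' 1 0" and ?g' = "airy_series' 0 1"
  have pos: "?g x > 0" "?g' x > 0" if "x > 0" for x
    using airy_series_01_ge[of x] that by linarith+
  have antimono: "?f y / ?g y \<le> ?f x / ?g x" if "0 < x" "x \<le> y" for x y
  proof (rule DERIV_nonpos_imp_nonincreasing[OF that(2)])
    fix t assume "x \<le> t" "t \<le> y"
    then have t: "?g t > 0" using pos that by simp
    have "((\<lambda>x. ?f x / ?g x) has_real_derivative (?f' t * ?g t - ?f t * ?g' t) / (?g t * ?g t)) (at t)"
      using t by (intro DERIV_divide airy_series_deriv) auto
    moreover have "?f' t * ?g t - ?f t * ?g' t = -1" using airy_series_wronskian[of t] by linarith
    ultimately show "\<exists>d. ((\<lambda>x. ?f x / ?g x) has_real_derivative d) (at t) \<and> d \<le> 0"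
      using t by (intro exI[of _ "-1 / (?g t * ?g t)"]) (auto simp: divide_nonpos_nonneg)
  qed
  have mono: "?f' x / ?g' x \<le> ?f' y / ?g' y" if "0 < x" "x \<le> y" for x y
  proof (rule DERIV_nonneg_imp_nondecreasing[OF that(2)])
    fix t assume t: "x \<le> t" "t \<le> y"
    then have t: "?g' t > 0" "t > 0" using pos that by auto
    have "((\<lambda>x. ?f' x / ?g' x) has_real_derivative ((t * ?f t) * ?g' t - ?f' t * (t * ?g t)) / (?g' t * ?g' t)) (at t)"
      using t by (intro DERIV_divide airy_series_deriv) auto
    moreover have "(t * ?f t) * ?g' t - ?f' t * (t * ?g t) = t * (?f t * ?g' t - ?f' t * ?g t)"
      by (simp add: algebra_simps)
    ultimately show "\<exists>d. ((\<lambda>x. ?f' x / ?g' x) has_real_derivative d) (at t) \<and> 0 \<le> d"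
      using t airy_series_wronskian[of t] by (intro exI[of _ "t / (?g' t * ?g' t)"]) auto
  qed
  have diag: "?f' x / ?g' x \<le> ?f x / ?g x" if "0 < x" for x
  proof -
    have "?f' x * ?g x \<le> ?f x * ?g' x" using airy_series_wronskian[of x] by linarith
    then show ?thesis using pos[OF that] by (simp add: divide_simps mult.commute)
  qed
  have cross: "?f' x / ?g' x \<le> ?f y / ?g y" if "0 < x" "0 < y" for x y
    using mono[of x "max x y"] diag[of "max x y"] antimono[of y "max x y"] that by linarith
  let ?c = "SUP x\<in>{0<..}. ?f' x / ?g' x"
  show ?thesis
  proof (intro exI[of _ ?c] allI impI conjI)
    fix x :: real assume x: "x > 0"
    show "?f' x / ?g' x \<le> ?c"
      by (rule cSUP_upper) (use x cross[of _ 1] in \<open>auto intro!: bdd_aboveI2\<close>)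
    show "?c \<le> ?f x / ?g x"
      by (rule cSUP_least) (use x cross[of _ x] in auto)
  qed
qed

definition subdominant_slope :: real where
  "subdominant_slope = (SOME c. \<forall>x>0. airy_series' 1 0 x / airy_series' 0 1 x \<le> c \<and>
     c \<le> airy_series 1 0 x / airy_series 0 1 x)"

definition subdominant :: "real \<Rightarrow> real" where
  "subdominant x = airy_series 1 0 x - subdominant_slope * airy_series 0 1 x"

definition subdominant' :: "real \<Rightarrow> real" where
  "subdominant' x = airy_series' 1 0 x - subdominant_slope * airy_series' 0 1 x"

text \<open>
  For \<open>y = f - c g\<close> the Wronskian identity reads \<open>y g' - y' g = 1\<close>. The choice of \<open>c\<close> makes both
  \<open>y g'\<close> and \<open>- y' g\<close> nonnegative, so each is at most \<open>1\<close>.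
\<close>

lemma subdominant_bounds:
  assumes "x > 0"
  shows "0 \<le> subdominant x" "subdominant x \<le> 1 / airy_series' 0 1 x"
    "- 1 / airy_series 0 1 x \<le> subdominant' x" "subdominant' x \<le> 0"
proof -
  have c: "airy_series' 1 0 x / airy_series' 0 1 x \<le> subdominant_slope"
     "subdominant_slope \<le> airy_series 1 0 x / airy_series 0 1 x"
    using someI_ex[OF ex_subdominant_slope] assms by (auto simp: subdominant_slope_def)
  have pos: "airy_series 0 1 x > 0" "airy_series' 0 1 x > 0"
    using airy_series_01_ge[of x] assms by linarith+
  note W = airy_series_wronskian[of x]
  show 1: "0 \<le> subdominant x"
    using c(2) pos by (simp add: subdominant_def field_simps)
  show 4: "subdominant' x \<le> 0"
    using c(1) pos by (simp add: subdominant'_def field_simps)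
  have "subdominant x * airy_series' 0 1 x - subdominant' x * airy_series 0 1 x = 1"
    using W by (simp add: subdominant_def subdominant'_def algebra_simps)
  moreover have "subdominant x * airy_series' 0 1 x \<ge> 0" "subdominant' x * airy_series 0 1 x \<le> 0"
    using 1 4 pos by (auto simp: mult_nonpos_nonneg)
  ultimately have "subdominant x * airy_series' 0 1 x \<le> 1" "- 1 \<le> subdominant' x * airy_series 0 1 x"
    by linarith+
  then show "subdominant x \<le> 1 / airy_series' 0 1 x" "- 1 / airy_series 0 1 x \<le> subdominant' x"
    using pos by (simp_all add: divide_simps)
qed

lemma subdominant_decay:
  "((\<lambda>x. x ^ n * subdominant x) \<longlongrightarrow> 0) at_top"
  "((\<lambda>x. x ^ n * subdominant' x) \<longlongrightarrow> 0) at_top"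
proof -
  \<comment> \<open>the exponent \<open>3 (n + 1)\<close> exceeds \<open>n\<close>, and the coefficient of the next power is nonzero\<close>
  define C where "C = airy_coeff 0 1 (Suc (3 * (n + 1)))"
  have C: "C > 0" unfolding C_def by (rule airy_coeff_01_pos)
  have lim: "((\<lambda>x::real. 1 / (C * x)) \<longlongrightarrow> 0) at_top" using C by real_asymp
  have key: "x ^ n / airy_series' 0 1 x \<le> 1 / (C * x)" "x ^ n / airy_series 0 1 x \<le> 1 / (C * x)"
    if x: "x \<ge> 1" for x
  proof -
    have "x ^ (n + 1) \<le> x ^ (3 * (n + 1))" "x ^ (n + 1) \<le> x ^ (Suc (3 * (n + 1)))"
      using x by (auto intro!: power_increasing simp del: power_Suc)
    then have h: "C * x ^ (n + 1) \<le> C * x ^ (3 * (n + 1))" "C * x ^ (n + 1) \<le> C * x ^ (Suc (3 * (n + 1)))"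
      using C by (auto simp del: power_Suc)
    have "C * x ^ (3 * (n + 1)) \<le> real (Suc (3 * (n + 1))) * C * x ^ (3 * (n + 1))"
      using C x by simp
    also have "\<dots> \<le> airy_series' 0 1 x"
      using airy_series_ge(2)[of 0 1 x "3 * (n + 1)"] x unfolding C_def by simp
    finally have a: "C * x ^ (n + 1) \<le> airy_series' 0 1 x" using h by linarith
    have b: "C * x ^ (n + 1) \<le> airy_series 0 1 x"
      using h airy_series_ge(1)[of 0 1 x "Suc (3 * (n + 1))"] x unfolding C_def by simp
    have *: "x ^ n / y \<le> 1 / (C * x)" if "C * x ^ (n + 1) \<le> y" for y
    proof -
      have "0 < C * x ^ (n + 1)" using C x by simp
      then have "y > 0" using that by linarith
      then show ?thesis using that C x by (simp add: divide_simps mult_ac)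
    qed
    show "x ^ n / airy_series' 0 1 x \<le> 1 / (C * x)" "x ^ n / airy_series 0 1 x \<le> 1 / (C * x)"
      using *[OF a] *[OF b] by auto
  qed
  show "((\<lambda>x. x ^ n * subdominant x) \<longlongrightarrow> 0) at_top"
  proof (rule Lim_null_comparison[OF _ lim])
    show "\<forall>\<^sub>F x in at_top. norm (x ^ n * subdominant x) \<le> 1 / (C * x)"
      using eventually_ge_at_top[of 1]
    proof eventually_elim
      case (elim x)
      have "norm (x ^ n * subdominant x) \<le> x ^ n * (1 / airy_series' 0 1 x)"
        using subdominant_bounds[of x] elim
          mult_left_mono[of "subdominant x" "1 / airy_series' 0 1 x" "x ^ n"] by (simp add: abs_mult)
      then show ?case using key[OF elim] by simp
    qed
  qed
  show "((\<lambda>x. x ^ n * subdominant' x) \<longlongrightarrow> 0) at_top"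
  proof (rule Lim_null_comparison[OF _ lim])
    show "\<forall>\<^sub>F x in at_top. norm (x ^ n * subdominant' x) \<le> 1 / (C * x)"
      using eventually_ge_at_top[of 1]
    proof eventually_elim
      case (elim x)
      have "norm (x ^ n * subdominant' x) \<le> x ^ n * (1 / airy_series 0 1 x)"
        using subdominant_bounds[of x] elim
          mult_left_mono[of "- subdominant' x" "1 / airy_series 0 1 x" "x ^ n"]
        by (simp add: abs_mult)
      then show ?case using key[OF elim] by simp
    qed
  qed
qed

lemma subdominant_deriv:
  "(subdominant has_real_derivative subdominant' x) (at x)"
  "(subdominant' has_real_derivative x * subdominant x) (at x)"
  unfolding subdominant_def[abs_def] subdominant'_def[abs_def]
  by (auto intro!: derivative_eq_intros airy_series_deriv simp: algebra_simps)

text \<open>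
  Cramer's rule: the coefficients are Wronskians, which are constant on a convex set.
\<close>

lemma subdominant_basis:
  fixes y y' :: "real \<Rightarrow> 'a::real_normed_field"
  assumes "convex S" "solves_airy_on S y y'"
  obtains a b where
    "\<And>x. x \<in> S \<Longrightarrow> y x = a * of_real (subdominant x) + b * of_real (airy_series 0 1 x)"
    "\<And>x. x \<in> S \<Longrightarrow> y' x = a * of_real (subdominant' x) + b * of_real (airy_series' 0 1 x)"
proof (cases "S = {}")
  case False
  then obtain t where t: "t \<in> S" by auto
  let ?r = "of_real :: real \<Rightarrow> 'a"
  define f f' g g' where "f = airy_series 1 0" "f' = airy_series' 1 0"
    and "g = airy_series 0 1" "g' = airy_series' 0 1"
  note [simp] = this
  have s: "solves_airy_on S (\<lambda>x. ?r (airy_series c0 c1 x)) (\<lambda>x. ?r (airy_series' c0 c1 x))" for c0 c1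
    by (intro solves_airy_on_of_real solves_airy_on_subset[OF airy_series_solves] subset_UNIV)
  define p where "p = y t * ?r (g' t) - y' t * ?r (g t)"
  define q where "q = y t * ?r (f' t) - y' t * ?r (f t)"
  have p: "y x * ?r (g' x) - y' x * ?r (g x) = p" if "x \<in> S" for x
    unfolding p_def using wronskian_constant[OF assms s that t] by simp
  have q: "y x * ?r (f' x) - y' x * ?r (f x) = q" if "x \<in> S" for x
    unfolding q_def using wronskian_constant[OF assms s that t] by simp
  have W: "?r (f x) * ?r (g' x) - ?r (f' x) * ?r (g x) = 1" for x
    using arg_cong[OF airy_series_wronskian[of x], of ?r] by simp
  have y: "y x = p * ?r (f x) - q * ?r (g x)" "y' x = p * ?r (f' x) - q * ?r (g' x)" if "x \<in> S" for x
  proof -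
    have "y x = y x * (?r (f x) * ?r (g' x) - ?r (f' x) * ?r (g x))" by (simp only: W) simp
    also have "\<dots> = p * ?r (f x) - q * ?r (g x)"
      unfolding p[OF that, symmetric] q[OF that, symmetric] by (simp add: algebra_simps)
    finally show "y x = p * ?r (f x) - q * ?r (g x)" .
    have "y' x = y' x * (?r (f x) * ?r (g' x) - ?r (f' x) * ?r (g x))" by (simp only: W) simp
    also have "\<dots> = p * ?r (f' x) - q * ?r (g' x)"
      unfolding p[OF that, symmetric] q[OF that, symmetric] by (simp add: algebra_simps)
    finally show "y' x = p * ?r (f' x) - q * ?r (g' x)" .
  qed
  show ?thesis
    by (rule that[of p "p * ?r subdominant_slope - q"])
       (simp_all add: y subdominant_def subdominant'_def algebra_simps)
qed (use that in auto)

lemma subdominant_0: "subdominant 0 = 1"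
  by (simp add: subdominant_def airy_series_0)

section \<open>The Airy function\<close>

definition airy_at_0 :: real where "airy_at_0 = 1 / (3 powr (2/3) * Gamma (2/3))"

lemma airy_at_0_pos: "airy_at_0 > 0"
  by (simp add: airy_at_0_def Gamma_real_pos)

text \<open>
  A solution that tends to \<open>0\<close> at \<open>+\<infinity>\<close> cannot contain the growing series, and the value at \<open>0\<close>
  then fixes its multiple of the recessive solution. So the definite description is met by exactly
  one function.
\<close>

lemma airy_eq: "airy = (\<lambda>x. airy_at_0 * subdominant x)"
  unfolding airy_def airy_at_0_def[symmetric]
proof (rule the_equality)
  let ?y = "\<lambda>x. airy_at_0 * subdominant x"
  have "\<forall>x. (?y has_real_derivative airy_at_0 * subdominant' x) (at x) \<and>
        ((\<lambda>x. airy_at_0 * subdominant' x) has_real_derivative x * ?y x) (at x)"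
    by (auto intro!: derivative_eq_intros subdominant_deriv)
  moreover have "(?y \<longlongrightarrow> 0) at_top"
    using tendsto_mult_right_zero[OF subdominant_decay(1)[of 0]] by simp
  ultimately show "(\<exists>y'. \<forall>x. (?y has_real_derivative y' x) (at x) \<and> (y' has_real_derivative x * ?y x) (at x)) \<and>
      (?y \<longlongrightarrow> 0) at_top \<and> ?y 0 = airy_at_0" by (auto simp: subdominant_0)
next
  fix y :: "real \<Rightarrow> real"
  assume "(\<exists>y'. \<forall>x. (y has_real_derivative y' x) (at x) \<and> (y' has_real_derivative x * y x) (at x)) \<and>
      (y \<longlongrightarrow> 0) at_top \<and> y 0 = airy_at_0"
  then obtain y' where "solves_airy_on UNIV y y'" and lim: "(y \<longlongrightarrow> 0) at_top" and y0: "y 0 = airy_at_0"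
    by (auto simp: solves_airy_on_def has_real_derivative_iff_has_vector_derivative)
  then obtain a b where ab: "\<And>x. y x = a * subdominant x + b * airy_series 0 1 x"
    using subdominant_basis[OF convex_UNIV, of y y'] by (metis UNIV_I of_real_eq_id id_apply)
  have "((\<lambda>x. y x - a * subdominant x) \<longlongrightarrow> 0 - a * 0) at_top"
    using subdominant_decay(1)[of 0] by (intro tendsto_intros lim) simp
  then have "((\<lambda>x. b * airy_series 0 1 x) \<longlongrightarrow> 0) at_top" by (simp add: ab)
  then have "\<forall>\<^sub>F x in at_top. norm (b * airy_series 0 1 x) < norm b \<or> b = 0"
    by (cases "b = 0") (auto dest!: tendstoD[of _ _ _ "norm b"])
  moreover have "\<forall>\<^sub>F x::real in at_top. x \<ge> 1" by (rule eventually_ge_at_top)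
  ultimately have "\<forall>\<^sub>F x::real in at_top. b = 0"
  proof eventually_elim
    case (elim x)
    have "norm b * 1 \<le> norm b * norm (airy_series 0 1 x)"
      using airy_series_01_ge(1)[of x] elim by (intro mult_left_mono) auto
    then show ?case using elim by (auto simp: abs_mult)
  qed
  then have "b = 0" by simp
  moreover have "a = airy_at_0" using ab[of 0] y0 by (simp add: subdominant_0 airy_series_0)
  ultimately show "y = (\<lambda>x. airy_at_0 * subdominant x)" using ab by auto
qed

lemma deriv_airy_eq: "deriv airy = (\<lambda>x. airy_at_0 * subdominant' x)"
  unfolding airy_eq by (intro ext DERIV_imp_deriv DERIV_cmult subdominant_deriv)

lemma airy_deriv:
  "(airy has_real_derivative deriv airy x) (at x)"
  "(deriv airy has_real_derivative x * airy x) (at x)"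
  unfolding airy_eq deriv_airy_eq[unfolded airy_eq]
  by (auto intro!: derivative_eq_intros subdominant_deriv)

lemma continuous_airy: "continuous_on S airy" "continuous_on S (deriv airy)"
  using airy_deriv DERIV_isCont continuous_at_imp_continuous_on by blast+

lemma airy_solves: "solves_airy_on S airy (deriv airy)"
  using airy_deriv by (auto simp: solves_airy_on_def has_real_derivative_iff_has_vector_derivative
      intro: has_vector_derivative_at_within)

lemma airy_decay:
  "((\<lambda>x. x ^ n * airy x) \<longlongrightarrow> 0) at_top" "((\<lambda>x. x ^ n * deriv airy x) \<longlongrightarrow> 0) at_top"
  using tendsto_mult_right_zero[OF subdominant_decay(1)[of n], of airy_at_0]
    tendsto_mult_right_zero[OF subdominant_decay(2)[of n], of airy_at_0]
  unfolding deriv_airy_eq unfolding airy_eq by (simp_all add: mult_ac)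

text \<open>
  The Airy function and the growing series form a basis on every convex set, in particular on the
  half-lines that occur for transforms of eigenfunctions.
\<close>

lemma airy_basis:
  fixes y y' :: "real \<Rightarrow> 'a::real_normed_field"
  assumes "convex S" "solves_airy_on S y y'"
  obtains a b where
    "\<And>x. x \<in> S \<Longrightarrow> y x = a * of_real (airy x) + b * of_real (airy_series 0 1 x)"
    "\<And>x. x \<in> S \<Longrightarrow> y' x = a * of_real (deriv airy x) + b * of_real (airy_series' 0 1 x)"
proof -
  obtain a b where "\<And>x. x \<in> S \<Longrightarrow> y x = a * of_real (subdominant x) + b * of_real (airy_series 0 1 x)"
    "\<And>x. x \<in> S \<Longrightarrow> y' x = a * of_real (subdominant' x) + b * of_real (airy_series' 0 1 x)"
    using subdominant_basis[OF assms] by metis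
  moreover have "airy_at_0 \<noteq> 0" using airy_at_0_pos by simp
  ultimately show ?thesis
    by (intro that[of "a / of_real airy_at_0" b]) (simp_all add: fun_cong[OF deriv_airy_eq] fun_cong[OF airy_eq])
qed

lemma airy_wronskian: "airy x * airy_series' 0 1 x - deriv airy x * airy_series 0 1 x = airy_at_0"
  using wronskian_constant[OF convex_UNIV airy_solves airy_series_solves, of x 0 0 1]
  by (simp add: airy_series_0) (simp add: airy_eq subdominant_0)

lemma airy_no_double_zero: "airy x = 0 \<Longrightarrow> deriv airy x \<noteq> 0"
  using airy_wronskian[of x] airy_at_0_pos by auto

text \<open>
  The derivative of \<open>y y'\<close> is \<open>y'\<^sup>2 + x y\<^sup>2 \<ge> 0\<close> for \<open>x \<ge> 0\<close>, and \<open>y y'\<close> tends to \<open>0\<close> at \<open>+\<infinity>\<close>. So it is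
  nonpositive, and if it vanished at one point it would vanish from there on, which forces a double
  zero.
\<close>

lemma airy_mult_deriv_neg:
  assumes "x \<ge> 0"
  shows "airy x * deriv airy x < 0"
proof -
  define h where "h x = airy x * deriv airy x" for x
  have dh: "(h has_real_derivative (deriv airy x)\<^sup>2 + x * (airy x)\<^sup>2) (at x)" for x
    unfolding h_def[abs_def]
    by (rule DERIV_cong, rule DERIV_mult[OF airy_deriv]) (simp add: power2_eq_square algebra_simps)
  have mono: "h a \<le> h b" if "0 \<le> a" "a \<le> b" for a b
    using that by (intro DERIV_nonneg_imp_nondecreasing[of a b h]) (auto intro!: exI dh)
  have lim: "(h \<longlongrightarrow> 0) at_top"
    unfolding h_def[abs_def] using tendsto_mult[OF airy_decay(1,2)[of 0]] by simp
  have nonpos: "h a \<le> 0" if "0 \<le> a" for a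
    by (rule tendsto_lowerbound[OF lim])
       (auto intro: eventually_mono[OF eventually_ge_at_top[of a]] mono that)
  have "h x < 0"
  proof (rule ccontr)
    assume "\<not> h x < 0"
    then have "h t = 0" if "t \<ge> x" for t
      using mono[of x t] nonpos[of t] assms that by simp
    then have "((\<lambda>t::real. 0) has_real_derivative (deriv airy (x + 1))\<^sup>2 + (x + 1) * (airy (x + 1))\<^sup>2) (at (x + 1))"
      by (intro has_field_derivative_transform_within[OF dh, where d = 1]) (auto simp: dist_real_def)
    then have "(deriv airy (x + 1))\<^sup>2 + (x + 1) * (airy (x + 1))\<^sup>2 = 0"
      using DERIV_unique[OF _ DERIV_const] by fastforce
    then have "(deriv airy (x + 1))\<^sup>2 = 0" "(x + 1) * (airy (x + 1))\<^sup>2 = 0"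
      using assms by (smt (verit) zero_le_power2 mult_nonneg_nonneg)+
    then show False using airy_no_double_zero[of "x + 1"] assms by auto
  qed
  then show ?thesis by (simp add: h_def)
qed

lemma airy_nonzero_of_nonneg:
  assumes "x \<ge> 0"
  shows "airy x \<noteq> 0" "deriv airy x \<noteq> 0"
  using airy_mult_deriv_neg[OF assms] by auto

section \<open>The Fourier transform of integrable functions\<close>

text \<open>
  The sign of the exponent is that of \<^const>\<open>L2_fourier\<close>; the factor \<open>(2 \<pi>)\<^bsup>-1/2\<^esup>\<close> is left out.
\<close>

definition ft :: "(real \<Rightarrow> complex) \<Rightarrow> real \<Rightarrow> complex" where
  "ft f x = (LINT z|lborel. iexp (x * z) * f z)"

lemma integrable_iexp_mult:
  fixes f :: "real \<Rightarrow> complex"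
  assumes "integrable lborel f"
  shows "integrable lborel (\<lambda>z. iexp (x * z) * f z)"
  by (rule Bochner_Integration.integrable_bound[OF assms])
     (use borel_measurable_integrable[OF assms] in \<open>auto simp: norm_mult\<close>)

lemma ft_diff:
  "integrable lborel f \<Longrightarrow> integrable lborel g \<Longrightarrow> ft (\<lambda>z. f z - g z) x = ft f x - ft g x"
  unfolding ft_def right_diff_distrib
  by (intro Bochner_Integration.integral_diff integrable_iexp_mult)

lemma ft_cmult: "ft (\<lambda>z. c * f z) x = c * ft f x"
proof -
  have "(\<lambda>z. iexp (x * z) * (c * f z)) = (\<lambda>z. c * (iexp (x * z) * f z))" by (simp add: mult_ac)
  then show ?thesis by (simp add: ft_def)
qed

lemma norm_ft_le:
  shows "cmod (ft f x) \<le> (LINT z|lborel. cmod (f z))"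
proof -
  have "cmod (ft f x) \<le> (LINT z|lborel. cmod (iexp (x * z) * f z))"
    unfolding ft_def by (rule integral_norm_bound)
  then show ?thesis by (simp add: norm_mult)
qed

lemma continuous_ft:
  assumes "integrable lborel f"
  shows "continuous_on S (ft f)"
proof -
  have [measurable]: "f \<in> borel_measurable borel" using borel_measurable_integrable[OF assms] by simp
  have "isCont (ft f) x" for x
    unfolding continuous_at_sequentially comp_def
  proof (intro allI impI)
    fix u assume u: "u \<longlonglongrightarrow> x"
    show "(\<lambda>n. ft f (u n)) \<longlonglongrightarrow> ft f x"
      unfolding ft_def
      by (rule integral_dominated_convergence[where w = "\<lambda>z. cmod (f z)"])
         (use assms u in \<open>auto intro!: tendsto_intros simp: norm_mult\<close>)
  qed
  then show ?thesis by (simp add: continuous_at_imp_continuous_on)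
qed

lemma ft_measurable [measurable]:
  "integrable lborel f \<Longrightarrow> ft f \<in> borel_measurable borel"
  by (intro borel_measurable_continuous_onI continuous_ft)

lemma norm_iexp_diff_le: "cmod (iexp a - iexp b) \<le> \<bar>a - b\<bar>"
proof -
  have "iexp a - iexp b = iexp b * (iexp (a - b) - 1)"
    by (simp add: algebra_simps flip: exp_add)
  then have "cmod (iexp a - iexp b) = cmod (iexp (a - b) - 1)" by (simp add: norm_mult)
  also have "\<dots> \<le> \<bar>a - b\<bar>" using iexp_approx1[of "a - b" 0] by simp
  finally show ?thesis .
qed

lemma iexp_has_vector_derivative:
  "((\<lambda>t. iexp (a * t)) has_vector_derivative \<i> * of_real a * iexp (a * x)) (at x)"
proof -
  have "((\<lambda>w. exp (\<i> * (of_real a * w))) has_field_derivative \<i> * of_real a * iexp (a * x)) (at (of_real x))"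
    by (auto intro!: derivative_eq_intros)
  from has_vector_derivative_real_field[OF this] show ?thesis by simp
qed

text \<open>
  Dominated convergence: the difference quotient of \<open>exp (\<i> x z)\<close> in \<open>x\<close> is at most \<open>\<bar>z\<bar>\<close> in modulus.
\<close>

lemma has_vector_derivative_ft:
  assumes f: "integrable lborel f" and zf: "integrable lborel (\<lambda>z. complex_of_real z * f z)"
  shows "(ft f has_vector_derivative ft (\<lambda>z. \<i> * (complex_of_real z * f z)) x) (at x)"
  unfolding has_vector_derivative_def has_derivative_at
proof (intro conjI bounded_linear_scaleR_left)
  let ?D = "ft (\<lambda>z. \<i> * (complex_of_real z * f z)) x"
  have [measurable]: "f \<in> borel_measurable borel" using borel_measurable_integrable[OF f] by simp
  let ?s = "\<lambda>h z. (iexp ((x + h) * z) - iexp (x * z)) / of_real h * f z - iexp (x * z) * (\<i> * (of_real z * f z))"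
  have *: "norm (ft f (x + h) - ft f x - h *\<^sub>R ?D) / norm h = cmod (LINT z|lborel. ?s h z)" if "h \<noteq> 0" for h
  proof -
    have "(LINT z|lborel. ?s h z) = (LINT z|lborel. (iexp ((x + h) * z) * f z - iexp (x * z) * f z) / of_real h
         - iexp (x * z) * (\<i> * (of_real z * f z)))"
      by (intro Bochner_Integration.integral_cong refl) (simp add: algebra_simps diff_divide_distrib)
    also have "\<dots> = (ft f (x + h) - ft f x) / of_real h - ?D"
    proof -
      note a = integrable_iexp_mult[OF f, of "x + h"]
      note b = integrable_iexp_mult[OF f, of x]
      have c: "integrable lborel (\<lambda>z. (iexp ((x + h) * z) * f z - iexp (x * z) * f z) / complex_of_real h)"
        by (intro integrable_divide Bochner_Integration.integrable_diff a b)
      have d: "integrable lborel (\<lambda>z. iexp (x * z) * (\<i> * (of_real z * f z)))"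
        by (intro integrable_iexp_mult integrable_mult_right zf)
      show ?thesis
        unfolding ft_def
        by (simp only: Bochner_Integration.integral_diff[OF c d] integral_divide_zero
            Bochner_Integration.integral_diff[OF a b])
    qed
    also have "\<dots> = (ft f (x + h) - ft f x - h *\<^sub>R ?D) / of_real h"
      using that by (simp add: divide_simps scaleR_conv_of_real)
    finally show ?thesis by (simp add: norm_divide)
  qed
  have "((\<lambda>h. cmod (LINT z|lborel. ?s h z)) \<longlongrightarrow> 0) (at 0)"
    unfolding tendsto_at_iff_sequentially comp_def
  proof (intro allI impI tendsto_norm_zero)
    fix u :: "nat \<Rightarrow> real" assume u: "\<forall>i. u i \<in> UNIV - {0}" "u \<longlonglongrightarrow> 0"
    have lim: "(\<lambda>n. ?s (u n) z) \<longlonglongrightarrow> 0" for z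
    proof -
      have "((\<lambda>t. iexp (t * z)) has_vector_derivative (\<i> * of_real z * iexp (x * z))) (at x)"
        using iexp_has_vector_derivative[of z x] by (simp add: mult.commute)
      then have "((\<lambda>h. norm (iexp ((x + h) * z) - iexp (x * z) - h *\<^sub>R (\<i> * of_real z * iexp (x * z))) / norm h) \<longlongrightarrow> 0) (at 0)"
        unfolding has_vector_derivative_def has_derivative_at by simp
      then have "(\<lambda>n. norm (iexp ((x + u n) * z) - iexp (x * z) - u n *\<^sub>R (\<i> * of_real z * iexp (x * z))) / norm (u n)) \<longlonglongrightarrow> 0"
        using u unfolding tendsto_at_iff_sequentially comp_def by blast
      from tendsto_mult_left_zero[OF this, of "cmod (f z)"]
      have "(\<lambda>n. norm (iexp ((x + u n) * z) - iexp (x * z) - u n *\<^sub>R (\<i> * of_real z * iexp (x * z))) / norm (u n) * cmod (f z)) \<longlonglongrightarrow> 0" .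
      moreover have "norm (iexp ((x + u n) * z) - iexp (x * z) - u n *\<^sub>R (\<i> * of_real z * iexp (x * z))) / norm (u n) * cmod (f z)
          = norm (?s (u n) z)" for n
      proof -
        have "u n \<noteq> 0" using u by auto
        then have "?s (u n) z = (iexp ((x + u n) * z) - iexp (x * z) - u n *\<^sub>R (\<i> * of_real z * iexp (x * z))) / of_real (u n) * f z"
          by (simp add: divide_simps scaleR_conv_of_real) (simp add: algebra_simps)
        then show ?thesis by (simp add: norm_mult norm_divide)
      qed
      ultimately show ?thesis by (simp add: tendsto_norm_zero_iff)
    qed
    have bound: "norm (?s (u n) z) \<le> 2 * cmod (of_real z * f z)" for n z
    proof -
      have "u n \<noteq> 0" using u by auto
      have "cmod ((iexp ((x + u n) * z) - iexp (x * z)) / of_real (u n) * f z) \<le> (\<bar>u n * z\<bar> / \<bar>u n\<bar>) * cmod (f z)"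
      proof -
        have "cmod (iexp ((x + u n) * z) - iexp (x * z)) \<le> \<bar>u n * z\<bar>"
          using norm_iexp_diff_le[of "(x + u n) * z" "x * z"] by (simp only: distrib_right add_diff_cancel_left')
        then show ?thesis
          unfolding norm_mult norm_divide norm_of_real by (intro mult_right_mono divide_right_mono) auto
      qed
      also have "\<dots> = cmod (of_real z * f z)" using \<open>u n \<noteq> 0\<close> by (simp add: norm_mult abs_mult)
      finally have 1: "cmod ((iexp ((x + u n) * z) - iexp (x * z)) / of_real (u n) * f z) \<le> cmod (of_real z * f z)" .
      have "norm (?s (u n) z) \<le> cmod ((iexp ((x + u n) * z) - iexp (x * z)) / of_real (u n) * f z)
          + cmod (iexp (x * z) * (\<i> * (of_real z * f z)))" by (rule norm_triangle_ineq4)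
      also have "cmod (iexp (x * z) * (\<i> * (of_real z * f z))) = cmod (of_real z * f z)"
        by (simp add: norm_mult)
      finally show ?thesis using 1 by linarith
    qed
    have "(\<lambda>n. LINT z|lborel. ?s (u n) z) \<longlonglongrightarrow> (LINT z::real|lborel. 0)"
      by (rule integral_dominated_convergence[where w = "\<lambda>z. 2 * cmod (of_real z * f z)"])
         (use zf lim bound in auto)
    then show "(\<lambda>n. LINT z|lborel. ?s (u n) z) \<longlonglongrightarrow> 0" by simp
  qed
  moreover have "\<forall>\<^sub>F h in at 0. cmod (LINT z|lborel. ?s h z) = norm (ft f (x + h) - ft f x - h *\<^sub>R ?D) / norm h"
    unfolding eventually_at_filter by (intro always_eventually allI impI) (rule *[symmetric])
  ultimately show "((\<lambda>h. norm (ft f (x + h) - ft f x - h *\<^sub>R ?D) / norm h) \<longlongrightarrow> 0) (at 0)"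
    by (rule Lim_transform_eventually)
qed

lemma ft_multiplication:
  assumes f: "integrable lborel f" and h: "integrable lborel h"
  shows "(LINT k|lborel. ft f k * h k) = (LINT z|lborel. f z * ft h z)"
proof -
  have [measurable]: "f \<in> borel_measurable borel" "h \<in> borel_measurable borel"
    using borel_measurable_integrable[OF f] borel_measurable_integrable[OF h] by simp_all
  have int: "integrable (lborel \<Otimes>\<^sub>M lborel) (\<lambda>(k, z). iexp (k * z) * f z * h k)"
  proof (rule lborel_pair.Fubini_integrable)
    have "(\<lambda>k. LINT z|lborel. norm (case (k, z) of (k, z) \<Rightarrow> iexp (k * z) * f z * h k)) =
        (\<lambda>k. (LINT z|lborel. cmod (f z)) * cmod (h k))" by (auto simp: norm_mult)
    then show "integrable lborel (\<lambda>k. LINT z|lborel. norm (case (k, z) of (k, z) \<Rightarrow> iexp (k * z) * f z * h k))"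
      using h by simp
    show "AE k in lborel. integrable lborel (\<lambda>z. case (k, z) of (k, z) \<Rightarrow> iexp (k * z) * f z * h k)"
      by (intro AE_I2, simp only: split_conv, intro integrable_mult_left integrable_iexp_mult f)
  qed measurable
  have "(LINT k|lborel. ft f k * h k) = (LINT k|lborel. LINT z|lborel. iexp (k * z) * f z * h k)"
    by (simp add: ft_def)
  also have "\<dots> = (LINT z|lborel. LINT k|lborel. iexp (k * z) * f z * h k)"
    using lborel_pair.Fubini_integral[OF int] by simp
  also have "\<dots> = (LINT z|lborel. f z * ft h z)"
  proof (rule Bochner_Integration.integral_cong[OF refl])
    fix z
    have "(\<lambda>k. iexp (k * z) * f z * h k) = (\<lambda>k. f z * (iexp (z * k) * h k))" by (simp add: mult_ac)
    then show "(LINT k|lborel. iexp (k * z) * f z * h k) = f z * ft h z" by (simp add: ft_def)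
  qed
  finally show ?thesis .
qed

section \<open>Gaussian regularization and Fourier inversion\<close>

lemma integral_std_normal_iexp:
  "(LINT k|lborel. iexp (t * k) * complex_of_real (std_normal_density k)) = complex_of_real (exp (- t\<^sup>2 / 2))"
proof -
  have "(LINT k|lborel. iexp (t * k) * complex_of_real (std_normal_density k)) =
      (LINT k|lborel. std_normal_density k *\<^sub>R iexp (t * k))"
    by (simp add: scaleR_conv_of_real mult_ac)
  also have "\<dots> = char std_normal_distribution t"
    unfolding char_def by (subst integral_density) auto
  finally show ?thesis by (simp add: char_std_normal_distribution)
qed

lemma integrable_gauss:
  fixes e :: real
  assumes "e > 0" shows "integrable lborel (\<lambda>k. exp (- (e * k)\<^sup>2 / 2))"
proof -
  have eq: "(\<lambda>k. exp (- (e * k)\<^sup>2 / 2)) = (\<lambda>k. (sqrt (2 * pi) / e) * normal_density 0 (1 / e) k)"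
    using assms by (auto simp: normal_density_def fun_eq_iff real_sqrt_mult real_sqrt_divide power_mult_distrib power_divide field_simps)
  show ?thesis unfolding eq using assms by (intro integrable_mult_right integrable_normal_density) simp
qed

text \<open>
  The modulated Gaussian is chosen so that its transform is \<open>2 \<pi>\<close> times the normal density centred at \<open>x\<close>, with
  standard deviation \<open>e\<close>.
\<close>

lemma ft_gauss:
  assumes "e > 0"
  shows "ft (\<lambda>k. iexp (- (x * k)) * complex_of_real (exp (- (e * k)\<^sup>2 / 2))) z = 2 * pi * normal_density x e z"
proof -
  have "ft (\<lambda>k. iexp (- (x * k)) * complex_of_real (exp (- (e * k)\<^sup>2 / 2))) z
      = (LINT k|lborel. iexp ((z - x) * k) * complex_of_real (exp (- (e * k)\<^sup>2 / 2)))"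
    unfolding ft_def by (intro Bochner_Integration.integral_cong refl)
      (simp add: algebra_simps flip: exp_add)
  also have "\<dots> = \<bar>1 / e\<bar> *\<^sub>R (LINT k|lborel. iexp ((z - x) * (0 + 1 / e * k)) * complex_of_real (exp (- (e * (0 + 1 / e * k))\<^sup>2 / 2)))"
    using assms by (intro lborel_integral_real_affine) simp
  also have "(\<lambda>k. iexp ((z - x) * (0 + 1 / e * k)) * complex_of_real (exp (- (e * (0 + 1 / e * k))\<^sup>2 / 2)))
      = (\<lambda>k. complex_of_real (sqrt (2 * pi)) * (iexp (((z - x) / e) * k) * complex_of_real (std_normal_density k)))"
    using assms by (simp add: std_normal_density_def fun_eq_iff)
  also have "(LINT k|lborel. complex_of_real (sqrt (2 * pi)) * (iexp (((z - x) / e) * k) * complex_of_real (std_normal_density k)))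
      = complex_of_real (sqrt (2 * pi) * exp (- ((z - x) / e)\<^sup>2 / 2))"
    using integral_std_normal_iexp[of "(z - x) / e"] by simp
  also have "\<bar>1 / e\<bar> *\<^sub>R complex_of_real (sqrt (2 * pi) * exp (- ((z - x) / e)\<^sup>2 / 2)) = complex_of_real ((sqrt (2 * pi) / e) * exp (- ((z - x) / e)\<^sup>2 / 2))"
    using assms by (simp add: scaleR_conv_of_real)
  also have "(sqrt (2 * pi) / e) * exp (- ((z - x) / e)\<^sup>2 / 2) = 2 * pi * normal_density x e z"
  proof -
    have "2 * pi / sqrt (2 * pi * e\<^sup>2) = sqrt (2 * pi) / e"
      using assms real_sqrt_pow2[of "2 * pi"] by (simp add: real_sqrt_mult power2_eq_square divide_simps)
    moreover have "- ((z - x) / e)\<^sup>2 / 2 = - (z - x)\<^sup>2 / (2 * e\<^sup>2)"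
      by (simp add: power_divide)
    moreover have "2 * pi * normal_density x e z = 2 * pi / sqrt (2 * pi * e\<^sup>2) * exp (- (z - x)\<^sup>2 / (2 * e\<^sup>2))"
      by (simp add: normal_density_def)
    ultimately show ?thesis by simp
  qed
  finally show ?thesis .
qed

text \<open>
  Damping the transform by a Gaussian before inverting it replaces point evaluation at \<open>x\<close> by
  averaging against a normal density. Inversion and Bessel's inequality are the limits \<open>e \<rightarrow> 0\<close> of
  this identity.
\<close>

lemma ft_gauss_smoothing:
  assumes f: "integrable lborel f" and e: "e > 0"
  shows "(LINT k|lborel. ft f k * (iexp (- (x * k)) * complex_of_real (exp (- (e * k)\<^sup>2 / 2)))) =
    2 * pi * (LINT z|lborel. f z * complex_of_real (normal_density x e z))"
proof -
  have "integrable lborel (\<lambda>k. iexp ((- x) * k) * complex_of_real (exp (- (e * k)\<^sup>2 / 2)))"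
    by (intro integrable_iexp_mult integrable_of_real integrable_gauss e)
  then have "integrable lborel (\<lambda>k. iexp (- (x * k)) * complex_of_real (exp (- (e * k)\<^sup>2 / 2)))" by simp
  from ft_multiplication[OF f this]
  have "(LINT k|lborel. ft f k * (iexp (- (x * k)) * complex_of_real (exp (- (e * k)\<^sup>2 / 2)))) =
    (LINT z|lborel. f z * complex_of_real (2 * pi * normal_density x e z))"
    unfolding ft_gauss[OF e] .
  also have "(\<lambda>z. f z * complex_of_real (2 * pi * normal_density x e z)) =
    (\<lambda>z. complex_of_real (2 * pi) * (f z * complex_of_real (normal_density x e z)))"
    by (simp add: mult_ac)
  finally show ?thesis by simp
qed

text \<open>
  Integrability of the transform lets the damping be removed by dominated convergence; on the other
  side the normal densities concentrate at \<open>x\<close>, where the function is continuous.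
\<close>

lemma ft_inversion:
  fixes f :: "real \<Rightarrow> complex"
  assumes f: "integrable lborel f" and ff: "integrable lborel (ft f)"
    and cont: "continuous_on UNIV f" and bound: "\<And>x. cmod (f x) \<le> B"
  shows "ft (ft f) (- x) = 2 * pi * f x"
proof -
  have [measurable]: "f \<in> borel_measurable borel" using borel_measurable_integrable[OF f] by simp
  have B: "B \<ge> 0" using bound[of 0] norm_ge_zero order_trans by blast
  define e where "e n = 1 / (real n + 1)" for n
  have e: "e n > 0" for n by (simp add: e_def)
  have e0: "e \<longlonglongrightarrow> 0" unfolding e_def[abs_def] by real_asymp
  have "(\<lambda>n. LINT k|lborel. ft f k * (iexp (- (x * k)) * complex_of_real (exp (- (e n * k)\<^sup>2 / 2))))
      \<longlonglongrightarrow> (LINT k|lborel. ft f k * (iexp (- (x * k)) * complex_of_real (exp (- (0 * k)\<^sup>2 / 2))))"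
  proof (rule integral_dominated_convergence[where w = "\<lambda>k. cmod (ft f k)"])
    show "AE k in lborel. (\<lambda>n. ft f k * (iexp (- (x * k)) * complex_of_real (exp (- (e n * k)\<^sup>2 / 2))))
      \<longlonglongrightarrow> ft f k * (iexp (- (x * k)) * complex_of_real (exp (- (0 * k)\<^sup>2 / 2)))"
      by (intro AE_I2 tendsto_intros e0) simp
  qed (use f ff in \<open>auto intro!: mult_left_le simp: norm_mult\<close>)
  also have "(LINT k|lborel. ft f k * (iexp (- (x * k)) * complex_of_real (exp (- (0 * k)\<^sup>2 / 2)))) = ft (ft f) (- x)"
    unfolding ft_def[of _ "- x"] by (simp add: mult_ac)
  finally have L: "(\<lambda>n. 2 * pi * (LINT z|lborel. f z * complex_of_real (normal_density x (e n) z))) \<longlonglongrightarrow> ft (ft f) (- x)"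
    by (simp only: ft_gauss_smoothing[OF f e])
  have sub: "(LINT z|lborel. f z * complex_of_real (normal_density x (e n) z)) =
      (LINT t|lborel. f (x + e n * t) * complex_of_real (std_normal_density t))" for n
  proof -
    have "(LINT z|lborel. f z * complex_of_real (normal_density x (e n) z)) =
      \<bar>e n\<bar> *\<^sub>R (LINT t|lborel. f (x + e n * t) * complex_of_real (normal_density x (e n) (x + e n * t)))"
      using e[of n] by (intro lborel_integral_real_affine) simp
    also have "\<dots> = (LINT t|lborel. \<bar>e n\<bar> *\<^sub>R (f (x + e n * t) * complex_of_real (normal_density x (e n) (x + e n * t))))"
      by simp
    also have "(\<lambda>t. \<bar>e n\<bar> *\<^sub>R (f (x + e n * t) * complex_of_real (normal_density x (e n) (x + e n * t)))) =
       (\<lambda>t. f (x + e n * t) * complex_of_real (std_normal_density t))"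
    proof
      fix t
      have "e n * normal_density x (e n) (x + e n * t) = std_normal_density t"
        using e[of n] by (simp add: normal_density_def real_sqrt_mult power_mult_distrib)
      then show "\<bar>e n\<bar> *\<^sub>R (f (x + e n * t) * complex_of_real (normal_density x (e n) (x + e n * t))) =
         f (x + e n * t) * complex_of_real (std_normal_density t)"
        using e[of n] by (simp add: scaleR_conv_of_real mult.left_commute flip: of_real_mult)
    qed
    finally show ?thesis .
  qed
  have "(\<lambda>n. LINT t|lborel. f (x + e n * t) * complex_of_real (std_normal_density t))
     \<longlonglongrightarrow> (LINT t|lborel. f x * complex_of_real (std_normal_density t))"
  proof (rule integral_dominated_convergence[where w = "\<lambda>t. B * std_normal_density t"])
    show "AE t in lborel. (\<lambda>n. f (x + e n * t) * complex_of_real (std_normal_density t)) \<longlonglongrightarrow> f x * complex_of_real (std_normal_density t)"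
    proof (intro AE_I2 tendsto_mult tendsto_const)
      fix t
      have "(\<lambda>n. x + e n * t) \<longlonglongrightarrow> x + 0 * t" by (intro tendsto_intros e0)
      then show "(\<lambda>n. f (x + e n * t)) \<longlonglongrightarrow> f x"
        using cont by (intro isCont_tendsto_compose[of x f]) (auto simp: continuous_on_eq_continuous_at)
    qed
    show "AE t in lborel. norm (f (x + e n * t) * complex_of_real (std_normal_density t)) \<le> B * std_normal_density t" for n
      using bound by (auto simp: norm_mult intro!: mult_right_mono)
  qed auto
  then have "(\<lambda>n. LINT t|lborel. f (x + e n * t) * complex_of_real (std_normal_density t)) \<longlonglongrightarrow> f x"
    by (simp add: integral_complex_of_real)
  from tendsto_mult_left[OF this] L show ?thesis
    unfolding sub by (rule LIMSEQ_unique[rotated])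
qed

section \<open>Bessel and Plancherel\<close>

lemma norm_integral_le_nn_integral:
  "ennreal (norm (integral\<^sup>L M f)) \<le> (\<integral>\<^sup>+x. ennreal (norm (f x)) \<partial>M)"
  by (cases "integrable M f") (simp_all add: integral_norm_bound_ennreal not_integrable_integral_eq)

text \<open>
  The damped square norm of the transform is the pairing of \<open>f\<close> with its own Gaussian average. The
  kernel is symmetric with total mass \<open>2 \<pi>\<close>, so \<open>2 \<bar>f x\<bar> \<bar>f z\<bar> \<le> \<bar>f x\<bar>\<^sup>2 + \<bar>f z\<bar>\<^sup>2\<close> bounds the pairing (Schur's
  test).
\<close>

lemma ft_gauss_smoothing_le:
  assumes f: "integrable lborel f" and f2: "integrable lborel (\<lambda>z. (cmod (f z))\<^sup>2)" and e: "e > 0"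
  shows "(\<integral>\<^sup>+k. ennreal ((cmod (ft f k))\<^sup>2 * exp (- (e * k)\<^sup>2 / 2)) \<partial>lborel)
     \<le> ennreal (2 * pi * (LINT z|lborel. (cmod (f z))\<^sup>2))"
proof -
  have [measurable]: "f \<in> borel_measurable borel" using borel_measurable_integrable[OF f] by simp
  have [measurable]: "ft f \<in> borel_measurable borel" using f by (rule ft_measurable)
  have [measurable]: "(\<lambda>k. cnj (ft f k)) \<in> borel_measurable borel"
    by (intro borel_measurable_continuous_onI continuous_on_cnj continuous_ft f)
  define E where "E k = complex_of_real (exp (- (e * k)\<^sup>2 / 2))" for k
  define h where "h k = cnj (ft f k) * E k" for k
  have E: "integrable lborel E"
    unfolding E_def[abs_def] by (intro integrable_of_real integrable_gauss e)
  have [measurable]: "E \<in> borel_measurable borel" using borel_measurable_integrable[OF E] by simp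
  have h: "integrable lborel h"
  proof (rule Bochner_Integration.integrable_bound)
    show "integrable lborel (\<lambda>k. (LINT z|lborel. cmod (f z)) * cmod (E k))" using E by simp
    show "AE k in lborel. norm (h k) \<le> norm ((LINT z|lborel. cmod (f z)) * cmod (E k))"
      using norm_ft_le by (auto simp: h_def norm_mult intro!: mult_right_mono)
  qed (simp add: h_def[abs_def])
  have sq: "ft f k * h k = complex_of_real ((cmod (ft f k))\<^sup>2 * exp (- (e * k)\<^sup>2 / 2))" for k
    unfolding h_def E_def of_real_mult complex_norm_square by (simp add: mult_ac)
  have int: "integrable lborel (\<lambda>k. (cmod (ft f k))\<^sup>2 * exp (- (e * k)\<^sup>2 / 2))"
  proof -
    have "integrable lborel (\<lambda>k. ft f k * h k)"
    proof (rule Bochner_Integration.integrable_bound)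
      show "integrable lborel (\<lambda>k. (LINT z|lborel. cmod (f z)) * cmod (h k))" using h by simp
      show "AE k in lborel. norm (ft f k * h k) \<le> norm ((LINT z|lborel. cmod (f z)) * cmod (h k))"
        using norm_ft_le by (auto simp: norm_mult intro!: mult_right_mono)
    qed (use h in \<open>auto dest: borel_measurable_integrable\<close>)
    then show ?thesis unfolding sq by (simp only: complex_of_real_integrable_eq)
  qed
  \<comment> \<open>conjugating turns \<open>h\<close> into the damped transform, so smoothing applies\<close>
  have ft_h: "ft h x = cnj (2 * pi * (LINT z|lborel. f z * complex_of_real (normal_density x e z)))" for x
  proof -
    have "cnj (ft h x) = (LINT k|lborel. ft f k * (iexp (- (x * k)) * E k))"
      unfolding ft_def[of h] Bochner_Integration.integral_cnj[symmetric]
      by (intro Bochner_Integration.integral_cong refl) (simp add: h_def E_def exp_cnj mult_ac)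
    then show ?thesis unfolding E_def ft_gauss_smoothing[OF f e] by (metis complex_cnj_cnj)
  qed
  have norm_ft_h: "ennreal (cmod (ft h x)) \<le> (\<integral>\<^sup>+z. ennreal (2 * pi * cmod (f z) * normal_density x e z) \<partial>lborel)" for x
  proof -
    have "cmod (ft h x) = cmod (LINT z|lborel. complex_of_real (2 * pi) * (f z * complex_of_real (normal_density x e z)))"
      unfolding ft_h complex_mod_cnj by simp
    then have "ennreal (cmod (ft h x)) \<le> (\<integral>\<^sup>+z. ennreal (norm (complex_of_real (2 * pi) * (f z * complex_of_real (normal_density x e z)))) \<partial>lborel)"
      using norm_integral_le_nn_integral by (simp only:)
    also have "(\<lambda>z. norm (complex_of_real (2 * pi) * (f z * complex_of_real (normal_density x e z)))) =
        (\<lambda>z. 2 * pi * cmod (f z) * normal_density x e z)"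
      by (simp add: norm_mult fun_eq_iff)
    finally show ?thesis .
  qed
  have mass: "(\<integral>\<^sup>+z. ennreal (normal_density x e z) \<partial>lborel) = 1" for x
    by (subst nn_integral_eq_integral) (use e in auto)
  have sym: "normal_density x e z = normal_density z e x" for x z
    by (simp add: normal_density_def power2_commute)
  have half: "(\<integral>\<^sup>+x. \<integral>\<^sup>+z. ennreal (pi * (cmod (f x))\<^sup>2 * normal_density x e z) \<partial>lborel \<partial>lborel)
     = ennreal (pi * (LINT z|lborel. (cmod (f z))\<^sup>2))"
  proof -
    have "(\<integral>\<^sup>+z. ennreal (pi * (cmod (f x))\<^sup>2 * normal_density x e z) \<partial>lborel) = ennreal (pi * (cmod (f x))\<^sup>2)" for x
      using mass[of x] by (subst ennreal_mult) (auto simp: nn_integral_cmult)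
    then show ?thesis
      using f2 by (simp add: nn_integral_eq_integral)
  qed
  have half': "(\<integral>\<^sup>+x. \<integral>\<^sup>+z. ennreal (pi * (cmod (f z))\<^sup>2 * normal_density x e z) \<partial>lborel \<partial>lborel)
     = ennreal (pi * (LINT z|lborel. (cmod (f z))\<^sup>2))"
  proof -
    have "(\<integral>\<^sup>+x. \<integral>\<^sup>+z. ennreal (pi * (cmod (f z))\<^sup>2 * normal_density x e z) \<partial>lborel \<partial>lborel)
       = (\<integral>\<^sup>+z. \<integral>\<^sup>+x. ennreal (pi * (cmod (f z))\<^sup>2 * normal_density x e z) \<partial>lborel \<partial>lborel)"
      by (rule lborel_pair.Fubini') (simp add: normal_density_def)
    also have "\<dots> = ennreal (pi * (LINT z|lborel. (cmod (f z))\<^sup>2))"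
      by (subst sym) (rule half)
    finally show ?thesis .
  qed
  have "ennreal (LINT k|lborel. (cmod (ft f k))\<^sup>2 * exp (- (e * k)\<^sup>2 / 2)) = ennreal (cmod (LINT z|lborel. f z * ft h z))"
  proof -
    have "complex_of_real (LINT k|lborel. (cmod (ft f k))\<^sup>2 * exp (- (e * k)\<^sup>2 / 2)) = (LINT z|lborel. f z * ft h z)"
      unfolding ft_multiplication[OF f h, symmetric] sq by (rule integral_complex_of_real[symmetric])
    moreover have "(LINT k|lborel. (cmod (ft f k))\<^sup>2 * exp (- (e * k)\<^sup>2 / 2)) \<ge> 0"
      by (intro Bochner_Integration.integral_nonneg) simp
    ultimately have "(LINT k|lborel. (cmod (ft f k))\<^sup>2 * exp (- (e * k)\<^sup>2 / 2)) = cmod (LINT z|lborel. f z * ft h z)"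
      using norm_of_real[of "LINT k|lborel. (cmod (ft f k))\<^sup>2 * exp (- (e * k)\<^sup>2 / 2)", where 'a = complex]
      by (simp only: abs_of_nonneg)
    then show ?thesis by (simp only:)
  qed
  also have "\<dots> \<le> (\<integral>\<^sup>+z. ennreal (norm (f z * ft h z)) \<partial>lborel)"
    by (rule norm_integral_le_nn_integral)
  also have "\<dots> \<le> (\<integral>\<^sup>+x. \<integral>\<^sup>+z. ennreal (pi * (cmod (f x))\<^sup>2 * normal_density x e z) +
      ennreal (pi * (cmod (f z))\<^sup>2 * normal_density x e z) \<partial>lborel \<partial>lborel)"
  proof (rule nn_integral_mono)
    fix x
    have "ennreal (norm (f x * ft h x)) = ennreal (cmod (f x)) * ennreal (cmod (ft h x))"
      by (simp add: norm_mult ennreal_mult)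
    also have "\<dots> \<le> ennreal (cmod (f x)) * (\<integral>\<^sup>+z. ennreal (2 * pi * cmod (f z) * normal_density x e z) \<partial>lborel)"
      by (intro mult_left_mono norm_ft_h) simp
    also have "\<dots> = (\<integral>\<^sup>+z. ennreal (cmod (f x)) * ennreal (2 * pi * cmod (f z) * normal_density x e z) \<partial>lborel)"
      by (rule nn_integral_cmult[symmetric]) simp
    also have "\<dots> \<le> (\<integral>\<^sup>+z. ennreal (pi * (cmod (f x))\<^sup>2 * normal_density x e z) +
      ennreal (pi * (cmod (f z))\<^sup>2 * normal_density x e z) \<partial>lborel)"
    proof (rule nn_integral_mono)
      fix z
      have "2 * (cmod (f x) * cmod (f z)) \<le> (cmod (f x))\<^sup>2 + (cmod (f z))\<^sup>2"
        using sum_squares_bound[of "cmod (f x)" "cmod (f z)"] by simp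
      then have "(pi * normal_density x e z) * (2 * (cmod (f x) * cmod (f z))) \<le>
          (pi * normal_density x e z) * ((cmod (f x))\<^sup>2 + (cmod (f z))\<^sup>2)"
        by (intro mult_left_mono) auto
      then have "cmod (f x) * (2 * pi * cmod (f z) * normal_density x e z) \<le>
         pi * (cmod (f x))\<^sup>2 * normal_density x e z + pi * (cmod (f z))\<^sup>2 * normal_density x e z"
        by (simp add: algebra_simps)
      then show "ennreal (cmod (f x)) * ennreal (2 * pi * cmod (f z) * normal_density x e z) \<le>
         ennreal (pi * (cmod (f x))\<^sup>2 * normal_density x e z) + ennreal (pi * (cmod (f z))\<^sup>2 * normal_density x e z)"
        by (subst ennreal_mult[symmetric], simp, simp, subst ennreal_plus[symmetric], simp, simp)
          (rule ennreal_leI)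
    qed
    finally show "ennreal (norm (f x * ft h x)) \<le> (\<integral>\<^sup>+z. ennreal (pi * (cmod (f x))\<^sup>2 * normal_density x e z) +
      ennreal (pi * (cmod (f z))\<^sup>2 * normal_density x e z) \<partial>lborel)" .
  qed
  also have "\<dots> = (\<integral>\<^sup>+x. (\<integral>\<^sup>+z. ennreal (pi * (cmod (f x))\<^sup>2 * normal_density x e z) \<partial>lborel) +
      (\<integral>\<^sup>+z. ennreal (pi * (cmod (f z))\<^sup>2 * normal_density x e z) \<partial>lborel) \<partial>lborel)"
    by (intro nn_integral_cong nn_integral_add) (auto simp: normal_density_def)
  also have "\<dots> = ennreal (pi * (LINT z|lborel. (cmod (f z))\<^sup>2)) + ennreal (pi * (LINT z|lborel. (cmod (f z))\<^sup>2))"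
    by (rule trans[OF nn_integral_add], simp add: normal_density_def, simp add: normal_density_def)
      (simp only: half half')
  also have "\<dots> = ennreal (2 * pi * (LINT z|lborel. (cmod (f z))\<^sup>2))"
    by (simp flip: ennreal_plus)
  finally show ?thesis using int by (simp add: nn_integral_eq_integral)
qed

text \<open>
  Removing the damping by Fatou's lemma gives one half of Plancherel's identity without any density
  argument. The inequality is all that convergence in \<open>L\<^sup>2\<close> requires.
\<close>

lemma ft_bessel:
  assumes f: "integrable lborel f" and f2: "integrable lborel (\<lambda>z. (cmod (f z))\<^sup>2)"
  shows "(\<integral>\<^sup>+k. ennreal ((cmod (ft f k))\<^sup>2) \<partial>lborel) \<le> ennreal (2 * pi * (LINT z|lborel. (cmod (f z))\<^sup>2))"
proof -
  have [measurable]: "ft f \<in> borel_measurable borel" using f by (rule ft_measurable)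
  define e where "e n = 1 / (real n + 1)" for n
  have e: "e n > 0" for n by (simp add: e_def)
  have e0: "e \<longlonglongrightarrow> 0" unfolding e_def[abs_def] by real_asymp
  have lim: "liminf (\<lambda>n. ennreal ((cmod (ft f k))\<^sup>2 * exp (- (e n * k)\<^sup>2 / 2))) = ennreal ((cmod (ft f k))\<^sup>2)" for k
  proof (rule lim_imp_Liminf)
    have "(\<lambda>n. ennreal ((cmod (ft f k))\<^sup>2 * exp (- (e n * k)\<^sup>2 / 2))) \<longlonglongrightarrow> ennreal ((cmod (ft f k))\<^sup>2 * exp (- (0 * k)\<^sup>2 / 2))"
      by (intro tendsto_intros e0) simp
    then show "(\<lambda>n. ennreal ((cmod (ft f k))\<^sup>2 * exp (- (e n * k)\<^sup>2 / 2))) \<longlonglongrightarrow> ennreal ((cmod (ft f k))\<^sup>2)" by simp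
  qed simp
  have "(\<integral>\<^sup>+k. ennreal ((cmod (ft f k))\<^sup>2) \<partial>lborel) =
      (\<integral>\<^sup>+k. liminf (\<lambda>n. ennreal ((cmod (ft f k))\<^sup>2 * exp (- (e n * k)\<^sup>2 / 2))) \<partial>lborel)"
    by (simp only: lim)
  also have "\<dots> \<le> liminf (\<lambda>n. \<integral>\<^sup>+k. ennreal ((cmod (ft f k))\<^sup>2 * exp (- (e n * k)\<^sup>2 / 2)) \<partial>lborel)"
    by (rule nn_integral_liminf) simp
  also have "\<dots> \<le> liminf (\<lambda>n::nat. ennreal (2 * pi * (LINT z|lborel. (cmod (f z))\<^sup>2)))"
    by (intro Liminf_mono always_eventually allI ft_gauss_smoothing_le f f2 e)
  also have "\<dots> = ennreal (2 * pi * (LINT z|lborel. (cmod (f z))\<^sup>2))" by (simp add: Liminf_const)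
  finally show ?thesis .
qed

lemma ft_square_integrable:
  assumes f: "integrable lborel f" and f2: "square_integrable f"
  shows "square_integrable (ft f)"
  unfolding square_integrable_def
proof (intro conjI integrableI_bounded)
  have [measurable]: "ft f \<in> borel_measurable borel" using f by (rule ft_measurable)
  show "ft f \<in> borel_measurable lborel" "(\<lambda>x. (cmod (ft f x))\<^sup>2) \<in> borel_measurable lborel" by simp_all
  show "(\<integral>\<^sup>+x. ennreal (norm ((cmod (ft f x))\<^sup>2)) \<partial>lborel) < \<infinity>"
    using ft_bessel[OF f] f2 by (auto simp: square_integrable_def intro: le_less_trans)
qed

text \<open>
  When the inversion formula holds pointwise, the full identity is the multiplication formula
  applied to \<open>f\<close> and the conjugate of its transform.
\<close>

lemma ft_plancherel:
  fixes f :: "real \<Rightarrow> complex"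
  assumes f: "integrable lborel f" and ff: "integrable lborel (ft f)"
    and cont: "continuous_on UNIV f" and bound: "\<And>x. cmod (f x) \<le> B"
  shows "(LINT k|lborel. (cmod (ft f k))\<^sup>2) = 2 * pi * (LINT z|lborel. (cmod (f z))\<^sup>2)"
proof -
  have ft_cnj: "ft (\<lambda>k. cnj (ft f k)) z = 2 * pi * cnj (f z)" for z
  proof -
    have "cnj (ft (ft f) (- z)) = (LINT k|lborel. cnj (iexp (- z * k) * ft f k))"
      unfolding ft_def[of "ft f"] by (rule Bochner_Integration.integral_cnj[symmetric])
    also have "\<dots> = ft (\<lambda>k. cnj (ft f k)) z"
      unfolding ft_def[of "\<lambda>k. cnj (ft f k)"]
      by (intro Bochner_Integration.integral_cong refl) (simp add: exp_cnj)
    finally have "ft (\<lambda>k. cnj (ft f k)) z = cnj (ft (ft f) (- z))" by simp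
    then show ?thesis using ft_inversion[OF assms] by simp
  qed
  have "(LINT k|lborel. ft f k * cnj (ft f k)) = (LINT z|lborel. f z * (2 * pi * cnj (f z)))"
    using ft_multiplication[OF f, of "\<lambda>k. cnj (ft f k)"] ff by (simp add: ft_cnj)
  moreover have "(\<lambda>k. ft f k * cnj (ft f k)) = (\<lambda>k. complex_of_real ((cmod (ft f k))\<^sup>2))"
    by (simp only: complex_norm_square[symmetric] of_real_power)
  moreover have "(\<lambda>z. f z * (2 * pi * cnj (f z))) = (\<lambda>z. complex_of_real (2 * pi * (cmod (f z))\<^sup>2))"
    by (auto simp: fun_eq_iff complex_norm_square simp del: of_real_power)
  ultimately have "(LINT k|lborel. complex_of_real ((cmod (ft f k))\<^sup>2)) = (LINT z|lborel. complex_of_real (2 * pi * (cmod (f z))\<^sup>2))"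
    by simp
  then show ?thesis unfolding integral_complex_of_real of_real_eq_iff by simp
qed

section \<open>The transform on square integrable functions\<close>

lemma square_integrable_cmult:
  "square_integrable f \<Longrightarrow> square_integrable (\<lambda>x. c * f x)"
  by (auto simp: square_integrable_def norm_mult power_mult_distrib)

lemma set_lint_eq_ft:
  "(LINT z:A|lborel. exp (\<i> * complex_of_real (x * z)) * f z) = ft (\<lambda>z. indicator A z *\<^sub>R f z) x"
  unfolding set_lebesgue_integral_def ft_def by (intro Bochner_Integration.integral_cong refl) simp

lemma tendsto_0_squeeze_ennreal:
  fixes f g :: "'a \<Rightarrow> ennreal"
  assumes "(g \<longlongrightarrow> 0) F" "\<And>x. f x \<le> g x"
  shows "(f \<longlongrightarrow> 0) F"
  by (rule tendsto_sandwich[OF _ _ tendsto_const assms(1)]) (auto intro!: always_eventually assms(2))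

text \<open>
  The error of the truncated transform is the transform of the tail of \<open>f\<close>, so Bessel's inequality
  bounds it by the \<open>L\<^sup>2\<close> norm of the tail.
\<close>

lemma L2_fourier_ft:
  assumes f: "integrable lborel f" and f2: "square_integrable f"
  shows "L2_fourier f (\<lambda>k. complex_of_real (1 / sqrt (2 * pi)) * ft f k)"
  unfolding L2_fourier_def
proof (intro conjI f2 square_integrable_cmult ft_square_integrable f)
  have [measurable]: "f \<in> borel_measurable borel" using borel_measurable_integrable[OF f] by simp
  have f2': "integrable lborel (\<lambda>z. (cmod (f z))\<^sup>2)" using f2 by (simp add: square_integrable_def)
  let ?c = "complex_of_real (1 / sqrt (2 * pi))"
  let ?t = "\<lambda>R z. indicator (- {-R..R}) z *\<^sub>R f z"
  let ?m = "\<lambda>R::real. LINT z|lborel. indicator (- {-R..R}) z * (cmod (f z))\<^sup>2"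
  let ?d = "\<lambda>R. \<integral>\<^sup>+x. ennreal ((cmod (?c * ft f x - ?c * (LINT z:{-R..R}|lborel. exp (\<i> * complex_of_real (x * z)) * f z)))\<^sup>2) \<partial>lborel"
  have tail: "?d R \<le> ennreal (?m R)" for R
  proof -
    have t: "integrable lborel (?t R)" and u: "integrable lborel (\<lambda>z. indicator {-R..R} z *\<^sub>R f z)"
      using f by (auto intro!: integrable_mult_indicator[of _ lborel f, unfolded scaleR_conv_of_real] simp: scaleR_conv_of_real)
    have n: "(cmod (?t R z))\<^sup>2 = indicator (- {-R..R}) z * (cmod (f z))\<^sup>2" for z
      by (auto simp: indicator_def)
    have t2: "integrable lborel (\<lambda>z. (cmod (?t R z))\<^sup>2)"
      unfolding n using f2' integrable_mult_indicator[OF _ f2', of "- {-R..R}"] by simp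
    have "ft f x - ft (\<lambda>z. indicator {-R..R} z *\<^sub>R f z) x = ft (?t R) x" for x
      by (subst ft_diff[OF f u, symmetric]) (auto intro!: arg_cong2[where f = ft] simp: indicator_def)
    then have "(cmod (?c * ft f x - ?c * (LINT z:{-R..R}|lborel. exp (\<i> * complex_of_real (x * z)) * f z)))\<^sup>2 =
       1 / (2 * pi) * (cmod (ft (?t R) x))\<^sup>2" for x
      unfolding set_lint_eq_ft right_diff_distrib[symmetric] norm_mult power_mult_distrib
      by (simp add: power_divide norm_divide)
    then have "?d R = (\<integral>\<^sup>+x. ennreal (1 / (2 * pi)) * ennreal ((cmod (ft (?t R) x))\<^sup>2) \<partial>lborel)"
      by (simp only: ennreal_mult'' zero_le_power2)
    also have "\<dots> = ennreal (1 / (2 * pi)) * (\<integral>\<^sup>+x. ennreal ((cmod (ft (?t R) x))\<^sup>2) \<partial>lborel)"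
      using ft_measurable[OF t] by (intro nn_integral_cmult) simp
    also have "\<dots> \<le> ennreal (1 / (2 * pi)) * ennreal (2 * pi * (LINT z|lborel. (cmod (?t R z))\<^sup>2))"
      by (intro mult_left_mono ft_bessel t t2) simp
    also have "\<dots> = ennreal (?m R)"
      unfolding n by (subst ennreal_mult[symmetric]) (auto intro!: Bochner_Integration.integral_nonneg)
    finally show ?thesis .
  qed
  have "(?m \<longlongrightarrow> (LINT z::real|lborel. 0 :: real)) at_top"
  proof (rule integral_dominated_convergence_at_top[where w = "\<lambda>z. (cmod (f z))\<^sup>2"])
    show "AE z in lborel. ((\<lambda>R. indicator (- {-R..R}) z * (cmod (f z))\<^sup>2) \<longlongrightarrow> 0) at_top"
    proof (rule AE_I2)
      fix z
      have "\<forall>\<^sub>F R in at_top. indicator (- {-R..R}) z * (cmod (f z))\<^sup>2 = 0"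
        using eventually_ge_at_top[of "\<bar>z\<bar>"] by eventually_elim (auto simp: indicator_def)
      then show "((\<lambda>R. indicator (- {-R..R}) z * (cmod (f z))\<^sup>2) \<longlongrightarrow> 0) at_top"
        by (simp add: tendsto_eventually)
    qed
    show "\<forall>\<^sub>F R in at_top. AE z in lborel. norm (indicator (- {-R..R}) z * (cmod (f z))\<^sup>2) \<le> (cmod (f z))\<^sup>2"
      by (intro always_eventually allI AE_I2) (auto simp: indicator_def)
  qed (use f2' in auto)
  then have "(?m \<longlongrightarrow> 0) at_top" by simp
  then have "((\<lambda>R. ennreal (?m R)) \<longlongrightarrow> 0) at_top"
    using tendsto_ennrealI by fastforce
  then show "(?d \<longlongrightarrow> 0) at_top"
    by (rule tendsto_0_squeeze_ennreal) (rule tail)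
qed

lemma norm_add_square_le: "(norm (a + b))\<^sup>2 \<le> 2 * (norm a)\<^sup>2 + 2 * (norm b)\<^sup>2"
proof -
  have "(norm (a + b))\<^sup>2 \<le> (norm a + norm b)\<^sup>2" by (intro power_mono norm_triangle_ineq) simp
  also have "\<dots> \<le> 2 * (norm a)\<^sup>2 + 2 * (norm b)\<^sup>2"
    using sum_squares_bound[of "norm a" "norm b"] by (simp add: power2_sum)
  finally show ?thesis .
qed

lemma L2_fourier_unique:
  assumes "L2_fourier f g" "L2_fourier f h"
  shows "AE x in lborel. g x = h x"
proof -
  let ?t = "\<lambda>R x. complex_of_real (1 / sqrt (2 * pi)) * (LINT z:{-R..R}|lborel. exp (\<i> * complex_of_real (x * z)) * f z)"
  have [measurable]: "f \<in> borel_measurable borel" "g \<in> borel_measurable borel" "h \<in> borel_measurable borel"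
    using assms by (auto simp: L2_fourier_def square_integrable_def)
  have t [measurable]: "?t R \<in> borel_measurable borel" for R
    unfolding set_lebesgue_integral_def by measurable
  have lim: "((\<lambda>R. \<integral>\<^sup>+x. ennreal ((cmod (g x - ?t R x))\<^sup>2) \<partial>lborel) \<longlongrightarrow> 0) at_top"
     "((\<lambda>R. \<integral>\<^sup>+x. ennreal ((cmod (h x - ?t R x))\<^sup>2) \<partial>lborel) \<longlongrightarrow> 0) at_top"
    using assms by (auto simp: L2_fourier_def)
  have le: "(\<integral>\<^sup>+x. ennreal ((cmod (g x - h x))\<^sup>2) \<partial>lborel) \<le>
     2 * (\<integral>\<^sup>+x. ennreal ((cmod (g x - ?t R x))\<^sup>2) \<partial>lborel) + 2 * (\<integral>\<^sup>+x. ennreal ((cmod (h x - ?t R x))\<^sup>2) \<partial>lborel)" for R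
  proof -
    have "(\<integral>\<^sup>+x. ennreal ((cmod (g x - h x))\<^sup>2) \<partial>lborel) \<le>
      (\<integral>\<^sup>+x. 2 * ennreal ((cmod (g x - ?t R x))\<^sup>2) + 2 * ennreal ((cmod (h x - ?t R x))\<^sup>2) \<partial>lborel)"
    proof (rule nn_integral_mono)
      fix x
      have "(cmod (g x - h x))\<^sup>2 \<le> 2 * (cmod (g x - ?t R x))\<^sup>2 + 2 * (cmod (h x - ?t R x))\<^sup>2"
        using norm_add_square_le[of "g x - ?t R x" "- (h x - ?t R x)"] unfolding norm_minus_cancel by simp
      then have "ennreal ((cmod (g x - h x))\<^sup>2) \<le> ennreal (2 * (cmod (g x - ?t R x))\<^sup>2 + 2 * (cmod (h x - ?t R x))\<^sup>2)"
        by (rule ennreal_leI)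
      also have "\<dots> = 2 * ennreal ((cmod (g x - ?t R x))\<^sup>2) + 2 * ennreal ((cmod (h x - ?t R x))\<^sup>2)"
        by (simp add: ennreal_plus ennreal_mult)
      finally show "ennreal ((cmod (g x - h x))\<^sup>2) \<le> 2 * ennreal ((cmod (g x - ?t R x))\<^sup>2) + 2 * ennreal ((cmod (h x - ?t R x))\<^sup>2)" .
    qed
    also have "\<dots> = (\<integral>\<^sup>+x. 2 * ennreal ((cmod (g x - ?t R x))\<^sup>2) \<partial>lborel) + (\<integral>\<^sup>+x. 2 * ennreal ((cmod (h x - ?t R x))\<^sup>2) \<partial>lborel)"
      using t[of R] by (intro nn_integral_add) auto
    also have "\<dots> = 2 * (\<integral>\<^sup>+x. ennreal ((cmod (g x - ?t R x))\<^sup>2) \<partial>lborel) + 2 * (\<integral>\<^sup>+x. ennreal ((cmod (h x - ?t R x))\<^sup>2) \<partial>lborel)"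
      using t[of R] by (intro arg_cong2[where f = "(+)"] nn_integral_cmult) auto
    finally show ?thesis .
  qed
  have "((\<lambda>R. 2 * (\<integral>\<^sup>+x. ennreal ((cmod (g x - ?t R x))\<^sup>2) \<partial>lborel) + 2 * (\<integral>\<^sup>+x. ennreal ((cmod (h x - ?t R x))\<^sup>2) \<partial>lborel)) \<longlongrightarrow> 2 * 0 + 2 * 0) at_top"
    by (intro tendsto_add ennreal_tendsto_cmult lim) auto
  then have "(\<integral>\<^sup>+x. ennreal ((cmod (g x - h x))\<^sup>2) \<partial>lborel) \<le> 2 * 0 + 2 * 0"
    by (rule tendsto_lowerbound) (use le in \<open>auto intro!: always_eventually\<close>)
  then have "(\<integral>\<^sup>+x. ennreal ((cmod (g x - h x))\<^sup>2) \<partial>lborel) = 0" by simp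
  then have "AE x in lborel. ennreal ((cmod (g x - h x))\<^sup>2) = 0"
    by (subst (asm) nn_integral_0_iff_AE) auto
  then show ?thesis by eventually_elim simp
qed

section \<open>Injectivity of the transform\<close>

text \<open>
  The positive and negative parts of \<open>f\<close> have equal transforms, hence equal mass. Normalized, they
  are densities of two probability distributions with the same characteristic function, so Levy's
  theorem identifies them.
\<close>

lemma ft_eq_0_imp_AE_0_real:
  fixes f :: "real \<Rightarrow> real"
  assumes f: "integrable lborel f" and zero: "\<And>k. ft (\<lambda>z. complex_of_real (f z)) k = 0"
  shows "AE x in lborel. f x = 0"
proof -
  have [measurable]: "f \<in> borel_measurable borel" using borel_measurable_integrable[OF f] by simp
  define p where "p x = max (f x) 0" for x
  define q where "q x = max (- f x) 0" for x
  have [measurable]: "p \<in> borel_measurable borel" "q \<in> borel_measurable borel"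
    unfolding p_def[abs_def] q_def[abs_def] by simp_all
  have p: "integrable lborel p" "\<And>x. p x \<ge> 0" and q: "integrable lborel q" "\<And>x. q x \<ge> 0"
    using f by (auto simp: p_def[abs_def] q_def[abs_def] intro!: integrable_max)
  have fpq: "f x = p x - q x" for x by (simp add: p_def q_def)
  have eq: "ft (\<lambda>z. complex_of_real (p z)) k = ft (\<lambda>z. complex_of_real (q z)) k" for k
    using zero[of k] ft_diff[of "\<lambda>z. complex_of_real (p z)" "\<lambda>z. complex_of_real (q z)" k] p q by (simp add: fpq)
  define m where "m = (LINT x|lborel. p x)"
  have m: "(LINT x|lborel. q x) = m"
    using eq[of 0] unfolding ft_def m_def by (simp add: integral_complex_of_real)
  have m0: "m \<ge> 0" unfolding m_def using p by (intro Bochner_Integration.integral_nonneg) auto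
  show ?thesis
  proof (cases "m = 0")
    case True
    then have "AE x in lborel. p x = 0" "AE x in lborel. q x = 0"
      using m p q integral_nonneg_eq_0_iff_AE[of lborel p] integral_nonneg_eq_0_iff_AE[of lborel q]
      unfolding m_def by auto
    then show ?thesis by eventually_elim (simp add: fpq)
  next
    case False
    then have mpos: "m > 0" using m0 by simp
    have dist: "real_distribution (density lborel (\<lambda>x. ennreal (r x / m)))"
      and char: "char (density lborel (\<lambda>x. ennreal (r x / m))) k = ft (\<lambda>z. complex_of_real (r z)) k / m"
      if r: "integrable lborel r" "\<And>x. r x \<ge> 0" "(LINT x|lborel. r x) = m" for r k
    proof -
      have [measurable]: "r \<in> borel_measurable borel" using borel_measurable_integrable[OF r(1)] by simp
      have "(\<integral>\<^sup>+x. ennreal (r x / m) \<partial>lborel) = ennreal (LINT x|lborel. r x / m)"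
        using r mpos by (intro nn_integral_eq_integral) auto
      also have "\<dots> = 1" using r mpos by simp
      finally have "prob_space (density lborel (\<lambda>x. ennreal (r x / m)))"
        by (intro prob_spaceI) (simp add: emeasure_density)
      then show "real_distribution (density lborel (\<lambda>x. ennreal (r x / m)))"
        by (intro real_distribution.intro) (auto simp: real_distribution_axioms_def)
      have "char (density lborel (\<lambda>x. ennreal (r x / m))) k = (LINT x|lborel. (r x / m) *\<^sub>R iexp (k * x))"
        unfolding char_def using r mpos by (subst integral_density) auto
      also have "(\<lambda>x. (r x / m) *\<^sub>R iexp (k * x)) = (\<lambda>x. (iexp (k * x) * complex_of_real (r x)) / complex_of_real m)"
        by (simp add: scaleR_conv_of_real mult_ac)
      also have "(LINT x|lborel. (iexp (k * x) * complex_of_real (r x)) / complex_of_real m) = ft (\<lambda>z. complex_of_real (r z)) k / m"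
        unfolding ft_def by (rule integral_divide_zero)
      finally show "char (density lborel (\<lambda>x. ennreal (r x / m))) k = ft (\<lambda>z. complex_of_real (r z)) k / m" .
    qed
    have "density lborel (\<lambda>x. ennreal (p x / m)) = density lborel (\<lambda>x. ennreal (q x / m))"
      using p q m by (intro Levy_uniqueness dist ext) (auto simp: m_def[symmetric] char eq)
    then have "AE x in lborel. ennreal (p x / m) = ennreal (q x / m)"
      by (subst (asm) sigma_finite_measure.density_unique_iff[OF sigma_finite_lborel]) auto
    then show ?thesis
    proof eventually_elim
      case (elim x)
      then show ?case using p(2)[of x] q(2)[of x] mpos by (simp add: fpq ennreal_inj)
    qed
  qed
qed

text \<open>
  Conjugation reflects the transform, so the real and imaginary parts of \<open>f\<close> have zero transform
  too.
\<close>

lemma ft_eq_0_imp_AE_0: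
  assumes f: "integrable lborel f" and zero: "\<And>k. ft f k = 0"
  shows "AE x in lborel. f x = 0"
proof -
  have cnj_f: "integrable lborel (\<lambda>z. cnj (f z))" using f by simp
  have zero': "ft (\<lambda>z. cnj (f z)) k = 0" for k
  proof -
    have "cnj (ft f (- k)) = (LINT z|lborel. cnj (iexp (- k * z) * f z))"
      unfolding ft_def by (rule Bochner_Integration.integral_cnj[symmetric])
    also have "\<dots> = ft (\<lambda>z. cnj (f z)) k"
      unfolding ft_def by (intro Bochner_Integration.integral_cong refl) (simp add: exp_cnj)
    finally show ?thesis using zero[of "- k"] by simp
  qed
  have re: "complex_of_real (Re (f z)) = (1/2) * (f z - (- 1) * cnj (f z))"
    and im: "complex_of_real (Im (f z)) = (1 / (2 * \<i>)) * (f z - cnj (f z))" for z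
    by (simp_all add: complex_eq_iff)
  have "AE x in lborel. Re (f x) = 0"
  proof (rule ft_eq_0_imp_AE_0_real)
    show "ft (\<lambda>z. complex_of_real (Re (f z))) k = 0" for k
      unfolding re ft_cmult using ft_diff[OF f integrable_mult_right[OF cnj_f, of "-1"], of k]
      unfolding ft_cmult by (simp add: zero zero')
  qed (use f in simp)
  moreover have "AE x in lborel. Im (f x) = 0"
  proof (rule ft_eq_0_imp_AE_0_real)
    show "ft (\<lambda>z. complex_of_real (Im (f z))) k = 0" for k
      unfolding im ft_cmult using ft_diff[OF f cnj_f, of k] by (simp add: zero zero')
  qed (use f in simp)
  ultimately show ?thesis by eventually_elim (simp add: complex_eq_iff)
qed

lemma continuous_AE_0_imp_0:
  fixes f :: "real \<Rightarrow> complex"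
  assumes "continuous_on UNIV f" "AE x in lborel. f x = 0"
  shows "f x = 0"
proof (rule ccontr)
  assume "f x \<noteq> 0"
  have "open {y. f y \<noteq> 0}" using assms(1) by (intro open_Collect_neq continuous_on_const)
  moreover have "emeasure lborel {y. f y \<noteq> 0} = 0"
  proof -
    have "{y. f y \<noteq> 0} \<in> sets lborel" using \<open>open {y. f y \<noteq> 0}\<close> by simp
    then show ?thesis using assms(2) AE_iff_measurable[of "{y. f y \<noteq> 0}" lborel "\<lambda>y. f y = 0"] by simp
  qed
  ultimately have "{y. f y \<noteq> 0} = {}"
    using open_not_negligible negligible_iff_null_sets null_sets_completionI by (metis (no_types, lifting) null_setsI sets_lborel borel_open)
  then show False using \<open>f x \<noteq> 0\<close> by auto
qed

section \<open>The eigenvalue equation on the Fourier side\<close>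

lemma integrable_inverse_1_plus_square_lborel: "integrable lborel (\<lambda>x::real. inverse (1 + x\<^sup>2))"
  using integrable_inverse_1_plus_square by (simp add: set_integrable_def)

text \<open>
  For \<open>w\<^sup>2 \<le> 1 + x\<^sup>2\<close> write \<open>w \<bar>f\<bar> = (w / (1 + x\<^sup>2)) ((1 + x\<^sup>2) \<bar>f\<bar>)\<close> and bound the product by
  half the sum of the squares of its factors, which are integrable; \<open>w = 1\<close> and \<open>w = \<bar>x\<bar>\<close> give
  the two claims.
\<close>

lemma integrable_of_second_moment:
  fixes f :: "real \<Rightarrow> complex"
  assumes "square_integrable f" "square_integrable (\<lambda>x. complex_of_real (x\<^sup>2) * f x)"
  shows "integrable lborel f" "integrable lborel (\<lambda>x. complex_of_real x * f x)"
proof -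
  have [measurable]: "f \<in> borel_measurable borel" using assms by (simp add: square_integrable_def)
  let ?B = "\<lambda>x. inverse (1 + x\<^sup>2) + ((cmod (f x))\<^sup>2 + (cmod (complex_of_real (x\<^sup>2) * f x))\<^sup>2)"
  have B: "integrable lborel ?B"
    using assms by (intro Bochner_Integration.integrable_add integrable_inverse_1_plus_square_lborel)
      (auto simp: square_integrable_def)
  have le: "w * cmod (f x) \<le> ?B x" if "w\<^sup>2 \<le> 1 + x\<^sup>2" for w x
  proof -
    define s where "s = 1 + x\<^sup>2"
    have s: "s > 0" unfolding s_def by (simp add: add_pos_nonneg)
    define F where "F = cmod (f x)"
    have "2 * (w / s) * (s * F) \<le> (w / s)\<^sup>2 + (s * F)\<^sup>2" by (rule sum_squares_bound)
    moreover have "(w / s) * (s * F) = w * F" using s by simp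
    moreover have "(w / s)\<^sup>2 \<le> inverse s"
    proof -
      have "w\<^sup>2 \<le> s" using that by (simp add: s_def)
      then show ?thesis using s by (simp add: power_divide power2_eq_square divide_simps)
    qed
    moreover have "(s * F)\<^sup>2 \<le> 2 * F\<^sup>2 + 2 * (x\<^sup>2 * F)\<^sup>2"
      using sum_squares_bound[of F "x\<^sup>2 * F"] by (simp add: s_def power2_eq_square algebra_simps)
    moreover have "?B x = inverse s + (F\<^sup>2 + (x\<^sup>2 * F)\<^sup>2)"
      by (simp add: s_def F_def norm_mult norm_power)
    moreover have "inverse s > 0" using s by simp
    ultimately show ?thesis unfolding F_def[symmetric] by linarith
  qed
  have nB: "norm (?B x) = ?B x" for x by (simp add: add_nonneg_nonneg)
  show "integrable lborel f"
    by (rule Bochner_Integration.integrable_bound[OF B]) (use le[of 1] in \<open>auto simp: nB\<close>)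
  show "integrable lborel (\<lambda>x. complex_of_real x * f x)"
    by (rule Bochner_Integration.integrable_bound[OF B]) (use le[of "\<bar>_\<bar>"] in \<open>auto simp: nB norm_mult\<close>)
qed

lemma eigenfunction_integrable:
  assumes "H_eigenfunction \<mu> f"
  shows "square_integrable f" "square_integrable (\<lambda>x. complex_of_real (x\<^sup>2) * f x)"
    "integrable lborel f" "integrable lborel (\<lambda>x. complex_of_real x * f x)"
proof -
  show "square_integrable f" "square_integrable (\<lambda>x. complex_of_real (x\<^sup>2) * f x)"
    using assms by (auto simp: H_eigenfunction_def H_op_def fourier_multiplier_def L2_fourier_def)
  then show "integrable lborel f" "integrable lborel (\<lambda>x. complex_of_real x * f x)"
    by (rule integrable_of_second_moment)+
qed

abbreviation truncate_at :: "real \<Rightarrow> (real \<Rightarrow> complex) \<Rightarrow> real \<Rightarrow> complex" where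
  "truncate_at R f \<equiv> \<lambda>z. indicator {-R..R} z *\<^sub>R f z"

lemma integrable_truncate:
  assumes f: "integrable lborel f"
  shows "integrable lborel (truncate_at R f)"
  using integrable_mult_indicator[OF _ f, of "{-R..R}"] by simp

lemma integrable_truncate_power:
  assumes f: "integrable lborel f"
  shows "integrable lborel (truncate_at R (\<lambda>z. complex_of_real (z ^ n) * f z))"
proof (rule Bochner_Integration.integrable_bound)
  have [measurable]: "f \<in> borel_measurable borel" using borel_measurable_integrable[OF f] by simp
  show "integrable lborel (\<lambda>z. R ^ n * cmod (f z))" using f by simp
  show "truncate_at R (\<lambda>z. complex_of_real (z ^ n) * f z) \<in> borel_measurable lborel" by simp
  show "AE z in lborel. norm (truncate_at R (\<lambda>z. complex_of_real (z ^ n) * f z) z) \<le> norm (R ^ n * cmod (f z))"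
    by (intro AE_I2) (auto simp: indicator_def norm_mult norm_power abs_mult power_abs intro!: mult_right_mono power_mono)
qed

text \<open>
  The eigenvalue equation says \<open>x\<^sup>2 f = \<mu> f - u\<close> with \<open>u\<close> having transform \<open>\<bar>k\<bar> g\<close>. Since \<open>x\<^sup>2 f\<close> is known
  to be square integrable but not integrable, its transform is only available as the \<open>L\<^sup>2\<close> limit of
  transforms of truncations.
\<close>

lemma eigenfunction_fourier_limit:
  assumes eig: "H_eigenfunction \<mu> f"
  shows "((\<lambda>R. \<integral>\<^sup>+k. ennreal ((cmod (ft (truncate_at R (\<lambda>z. complex_of_real (z\<^sup>2) * f z)) k -
            complex_of_real (\<mu> - \<bar>k\<bar>) * ft f k))\<^sup>2) \<partial>lborel) \<longlongrightarrow> 0) at_top"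
proof -
  note int = eigenfunction_integrable[OF eig]
  have [measurable]: "f \<in> borel_measurable borel" using int by (simp add: square_integrable_def)
  have [measurable]: "ft f \<in> borel_measurable borel" using int(3) by (rule ft_measurable)
  define c where "c = complex_of_real (1 / sqrt (2 * pi))"
  have c: "c \<noteq> 0" by (simp add: c_def)
  obtain u g where g: "L2_fourier f g" and u: "L2_fourier u (\<lambda>k. complex_of_real \<bar>k\<bar> * g k)"
    and eq: "AE x in lborel. complex_of_real \<mu> * f x = u x + complex_of_real (x\<^sup>2) * f x"
    using eig by (auto simp: H_eigenfunction_def H_op_def fourier_multiplier_def)
  have [measurable]: "u \<in> borel_measurable borel" using u by (simp add: L2_fourier_def square_integrable_def)
  note f = L2_fourier_ft[OF int(3,1), folded c_def]
  have gf: "AE k in lborel. g k = c * ft f k" by (rule L2_fourier_unique[OF g f])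
  have uR: "ft (truncate_at R u) k = complex_of_real \<mu> * ft (truncate_at R f) k - ft (truncate_at R (\<lambda>z. complex_of_real (z\<^sup>2) * f z)) k" for R k
  proof -
    have "ft (truncate_at R u) k = ft (\<lambda>z. complex_of_real \<mu> * truncate_at R f z - truncate_at R (\<lambda>z. complex_of_real (z\<^sup>2) * f z) z) k"
      unfolding ft_def
    proof (rule integral_cong_AE)
      show "AE z in lborel. iexp (k * z) * truncate_at R u z =
         iexp (k * z) * (complex_of_real \<mu> * truncate_at R f z - truncate_at R (\<lambda>z. complex_of_real (z\<^sup>2) * f z) z)"
        using eq
      proof eventually_elim
        case (elim z)
        then have "u z = complex_of_real \<mu> * f z - complex_of_real (z\<^sup>2) * f z" by simp
        then show ?case by (simp add: indicator_def)
      qed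
    qed auto
    also have "\<dots> = complex_of_real \<mu> * ft (truncate_at R f) k - ft (truncate_at R (\<lambda>z. complex_of_real (z\<^sup>2) * f z)) k"
    proof -
      have "integrable lborel (\<lambda>z. complex_of_real \<mu> * truncate_at R f z)"
        by (intro integrable_mult_right integrable_truncate int)
      from ft_diff[OF this integrable_truncate_power[OF int(3)]] show ?thesis
        unfolding ft_cmult .
    qed
    finally show ?thesis .
  qed
  define F where "F R k = c * ft f k - c * ft (truncate_at R f) k" for R k
  define U where "U R k = complex_of_real \<bar>k\<bar> * g k - c * ft (truncate_at R u) k" for R k
  let ?D = "\<lambda>R k. ft (truncate_at R (\<lambda>z. complex_of_real (z\<^sup>2) * f z)) k - complex_of_real (\<mu> - \<bar>k\<bar>) * ft f k"
  have limF: "((\<lambda>R. \<integral>\<^sup>+k. ennreal ((cmod (F R k))\<^sup>2) \<partial>lborel) \<longlongrightarrow> 0) at_top"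
    using f unfolding L2_fourier_def set_lint_eq_ft F_def c_def by blast
  have limU: "((\<lambda>R. \<integral>\<^sup>+k. ennreal ((cmod (U R k))\<^sup>2) \<partial>lborel) \<longlongrightarrow> 0) at_top"
    using u unfolding L2_fourier_def set_lint_eq_ft U_def c_def by blast
  have [measurable]: "g \<in> borel_measurable borel" using g by (simp add: L2_fourier_def square_integrable_def)
  have mR [measurable]: "ft (truncate_at R f) \<in> borel_measurable borel" for R
    using int by (intro ft_measurable integrable_truncate)
  have mR2 [measurable]: "ft (truncate_at R (\<lambda>z. complex_of_real (z\<^sup>2) * f z)) \<in> borel_measurable borel" for R
    using int by (intro ft_measurable integrable_truncate_power)
  have uReq: "ft (truncate_at R u) = (\<lambda>k. complex_of_real \<mu> * ft (truncate_at R f) k - ft (truncate_at R (\<lambda>z. complex_of_real (z\<^sup>2) * f z)) k)" for R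
    using uR by blast
  have mU [measurable]: "U R \<in> borel_measurable borel" and mF [measurable]: "F R \<in> borel_measurable borel" for R
    unfolding U_def[abs_def] F_def[abs_def] uReq by measurable
  have D: "AE k in lborel. c * ?D R k = U R k - complex_of_real \<mu> * F R k" for R
    using gf
  proof eventually_elim
    case (elim k)
    show ?case unfolding U_def F_def uR elim by (simp add: algebra_simps)
  qed
  define C where "C = (2 / (cmod c)\<^sup>2) * (1 + \<mu>\<^sup>2)"
  have C: "C \<ge> 0" by (simp add: C_def)
  have le: "(\<integral>\<^sup>+k. ennreal ((cmod (?D R k))\<^sup>2) \<partial>lborel) \<le>
      ennreal C * (\<integral>\<^sup>+k. ennreal ((cmod (U R k))\<^sup>2) \<partial>lborel) + ennreal C * (\<integral>\<^sup>+k. ennreal ((cmod (F R k))\<^sup>2) \<partial>lborel)" for R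
  proof -
    have "(\<integral>\<^sup>+k. ennreal ((cmod (?D R k))\<^sup>2) \<partial>lborel) \<le>
       (\<integral>\<^sup>+k. ennreal C * ennreal ((cmod (U R k))\<^sup>2) + ennreal C * ennreal ((cmod (F R k))\<^sup>2) \<partial>lborel)"
    proof (rule nn_integral_mono_AE)
      show "AE k in lborel. ennreal ((cmod (?D R k))\<^sup>2) \<le> ennreal C * ennreal ((cmod (U R k))\<^sup>2) + ennreal C * ennreal ((cmod (F R k))\<^sup>2)"
        using D[of R]
      proof eventually_elim
        case (elim k)
        have "(cmod c)\<^sup>2 * (cmod (?D R k))\<^sup>2 = (cmod (U R k + - (complex_of_real \<mu> * F R k)))\<^sup>2"
          using arg_cong[OF elim, of "\<lambda>x. (cmod x)\<^sup>2"] by (simp add: norm_mult power_mult_distrib)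
        also have "\<dots> \<le> 2 * (cmod (U R k))\<^sup>2 + 2 * (cmod (- (complex_of_real \<mu> * F R k)))\<^sup>2"
          by (rule norm_add_square_le)
        also have "\<dots> = 2 * (cmod (U R k))\<^sup>2 + 2 * \<mu>\<^sup>2 * (cmod (F R k))\<^sup>2"
          by (simp add: norm_mult power_mult_distrib)
        also have "\<dots> \<le> 2 * (1 + \<mu>\<^sup>2) * (cmod (U R k))\<^sup>2 + 2 * (1 + \<mu>\<^sup>2) * (cmod (F R k))\<^sup>2"
          by (intro add_mono mult_right_mono) auto
        also have "\<dots> = (cmod c)\<^sup>2 * (C * (cmod (U R k))\<^sup>2 + C * (cmod (F R k))\<^sup>2)"
          using c by (simp add: C_def field_simps)
        finally have "(cmod (?D R k))\<^sup>2 \<le> C * (cmod (U R k))\<^sup>2 + C * (cmod (F R k))\<^sup>2"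
          using c by simp
        then have "ennreal ((cmod (?D R k))\<^sup>2) \<le> ennreal (C * (cmod (U R k))\<^sup>2 + C * (cmod (F R k))\<^sup>2)"
          by (rule ennreal_leI)
        then show ?case using C by (simp add: ennreal_plus ennreal_mult)
      qed
    qed
    also have "\<dots> = (\<integral>\<^sup>+k. ennreal C * ennreal ((cmod (U R k))\<^sup>2) \<partial>lborel) + (\<integral>\<^sup>+k. ennreal C * ennreal ((cmod (F R k))\<^sup>2) \<partial>lborel)"
      by (intro nn_integral_add) auto
    also have "\<dots> = ennreal C * (\<integral>\<^sup>+k. ennreal ((cmod (U R k))\<^sup>2) \<partial>lborel) + ennreal C * (\<integral>\<^sup>+k. ennreal ((cmod (F R k))\<^sup>2) \<partial>lborel)"
      by (intro arg_cong2[where f = "(+)"] nn_integral_cmult) auto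
    finally show ?thesis .
  qed
  have "((\<lambda>R. ennreal C * (\<integral>\<^sup>+k. ennreal ((cmod (U R k))\<^sup>2) \<partial>lborel) + ennreal C * (\<integral>\<^sup>+k. ennreal ((cmod (F R k))\<^sup>2) \<partial>lborel)) \<longlongrightarrow> ennreal C * 0 + ennreal C * 0) at_top"
    by (intro tendsto_add ennreal_tendsto_cmult limU limF) auto
  then have "((\<lambda>R. ennreal C * (\<integral>\<^sup>+k. ennreal ((cmod (U R k))\<^sup>2) \<partial>lborel) + ennreal C * (\<integral>\<^sup>+k. ennreal ((cmod (F R k))\<^sup>2) \<partial>lborel)) \<longlongrightarrow> 0) at_top"
    by simp
  then show ?thesis
    by (rule tendsto_0_squeeze_ennreal) (rule le)
qed

text \<open>
  Cauchy--Schwarz on an interval of finite length.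
\<close>

lemma tendsto_set_integral_of_L2:
  fixes D :: "real \<Rightarrow> real \<Rightarrow> complex"
  assumes [measurable]: "\<And>R. D R \<in> borel_measurable borel"
    and lim: "((\<lambda>R. \<integral>\<^sup>+k. ennreal ((cmod (D R k))\<^sup>2) \<partial>lborel) \<longlongrightarrow> 0) at_top"
  shows "((\<lambda>R. LINT k:{a..b}|lborel. D R k) \<longlongrightarrow> 0) at_top"
proof -
  have le: "(ennreal (cmod (LINT k:{a..b}|lborel. D R k)))\<^sup>2 \<le> ennreal (b - a) * (\<integral>\<^sup>+k. ennreal ((cmod (D R k))\<^sup>2) \<partial>lborel)" for R
  proof -
    have "ennreal (cmod (LINT k:{a..b}|lborel. D R k)) \<le> (\<integral>\<^sup>+k. ennreal (norm (indicator {a..b} k *\<^sub>R D R k)) \<partial>lborel)"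
      unfolding set_lebesgue_integral_def by (rule norm_integral_le_nn_integral)
    also have "\<dots> = (\<integral>\<^sup>+k. indicator {a..b} k * ennreal (cmod (D R k)) \<partial>lborel)"
      by (intro nn_integral_cong) (auto simp: indicator_def)
    finally have "(ennreal (cmod (LINT k:{a..b}|lborel. D R k)))\<^sup>2 \<le> (\<integral>\<^sup>+k. indicator {a..b} k * ennreal (cmod (D R k)) \<partial>lborel)\<^sup>2"
      by (intro power_mono) auto
    also have "\<dots> \<le> (\<integral>\<^sup>+k. (indicator {a..b} k)\<^sup>2 \<partial>lborel) * (\<integral>\<^sup>+k. (ennreal (cmod (D R k)))\<^sup>2 \<partial>lborel)"
      by (intro Cauchy_Schwarz_nn_integral) auto
    also have "(\<integral>\<^sup>+k. (indicator {a..b} k)\<^sup>2 \<partial>lborel) = (\<integral>\<^sup>+k. indicator {a..b} k \<partial>lborel)"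
      by (intro nn_integral_cong) (auto simp: indicator_def)
    also have "\<dots> = ennreal (b - a)"
      by (cases "a \<le> b") (auto simp: ennreal_neg)
    finally show ?thesis by (simp add: ennreal_power)
  qed
  have "((\<lambda>R. ennreal (b - a) * (\<integral>\<^sup>+k. ennreal ((cmod (D R k))\<^sup>2) \<partial>lborel)) \<longlongrightarrow> ennreal (b - a) * 0) at_top"
    by (intro ennreal_tendsto_cmult lim) auto
  then have "((\<lambda>R. ennreal (b - a) * (\<integral>\<^sup>+k. ennreal ((cmod (D R k))\<^sup>2) \<partial>lborel)) \<longlongrightarrow> 0) at_top" by simp
  then have "((\<lambda>R. (ennreal (cmod (LINT k:{a..b}|lborel. D R k)))\<^sup>2) \<longlongrightarrow> 0) at_top"
    by (rule tendsto_0_squeeze_ennreal) (rule le)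
  then have "((\<lambda>R. ennreal ((cmod (LINT k:{a..b}|lborel. D R k))\<^sup>2)) \<longlongrightarrow> ennreal 0) at_top"
    by (simp add: ennreal_power)
  then have "((\<lambda>R. (cmod (LINT k:{a..b}|lborel. D R k))\<^sup>2) \<longlongrightarrow> 0) at_top"
    by (subst (asm) tendsto_ennreal_iff) (auto intro!: always_eventually)
  then have "((\<lambda>R. sqrt ((cmod (LINT k:{a..b}|lborel. D R k))\<^sup>2)) \<longlongrightarrow> sqrt 0) at_top"
    by (rule tendsto_real_sqrt)
  then show ?thesis by (simp add: tendsto_norm_zero_iff)
qed

text \<open>
  The first derivative can be taken under the integral sign. The second one cannot, because \<open>x\<^sup>2 f\<close>
  need not be integrable. Instead the fundamental theorem of calculus is applied to truncations of
  \<open>f\<close>, and the \<open>L\<^sup>2\<close> limit, which passes to integrals over bounded intervals, gives the increment of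
  the first derivative as the integral of a continuous function.
\<close>

lemma eigenfunction_ft_ode:
  assumes eig: "H_eigenfunction \<mu> f"
  shows "(ft f has_vector_derivative ft (\<lambda>z. \<i> * (complex_of_real z * f z)) k) (at k)"
    and "(ft (\<lambda>z. \<i> * (complex_of_real z * f z)) has_vector_derivative complex_of_real (\<bar>k\<bar> - \<mu>) * ft f k) (at k)"
proof -
  note int = eigenfunction_integrable[OF eig]
  have [measurable]: "f \<in> borel_measurable borel" using int by (simp add: square_integrable_def)
  have cont: "continuous_on S (ft f)" for S using int(3) by (rule continuous_ft)
  let ?zf = "\<lambda>z. \<i> * (complex_of_real z * f z)"
  let ?h = "\<lambda>k. complex_of_real (\<bar>k\<bar> - \<mu>) * ft f k"
  show "(ft f has_vector_derivative ft ?zf k) (at k)"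
    by (rule has_vector_derivative_ft[OF int(3,4)])
  have zf: "integrable lborel ?zf" using int(4) by simp
  have hcont: "continuous_on S ?h" for S by (intro continuous_intros cont)
  let ?W = "\<lambda>R. truncate_at R (\<lambda>z. complex_of_real (z\<^sup>2) * f z)"
  have W: "integrable lborel (?W R)" for R using int by (intro integrable_truncate_power)
  have incr: "ft ?zf b - ft ?zf a = (LINT k:{a..b}|lborel. ?h k)" if "a \<le> b" for a b
  proof -
    have trunc: "ft (truncate_at R ?zf) b - ft (truncate_at R ?zf) a = - (LINT k:{a..b}|lborel. ft (?W R) k)" for R
    proof -
      have mult: "\<i> * (complex_of_real z * truncate_at R ?zf z) = (- 1) * ?W R z" for z
        by (simp add: indicator_def power2_eq_square algebra_simps)
      have int2: "integrable lborel (\<lambda>z. complex_of_real z * truncate_at R ?zf z)"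
      proof -
        have "(\<lambda>z. complex_of_real z * truncate_at R ?zf z) = (\<lambda>z. \<i> * ?W R z)"
          by (simp add: fun_eq_iff scaleR_conv_of_real power2_eq_square)
        then show ?thesis using W[of R] by (simp only: integrable_mult_right)
      qed
      have d: "(ft (truncate_at R ?zf) has_vector_derivative - ft (?W R) x) (at x within {a..b})" for x
        using has_vector_derivative_ft[OF integrable_truncate[OF zf] int2, of x]
        unfolding mult ft_cmult by (simp add: has_vector_derivative_at_within)
      have "(LINT k|lborel. indicator {a..b} k *\<^sub>R - ft (?W R) k) = ft (truncate_at R ?zf) b - ft (truncate_at R ?zf) a"
        by (rule integral_FTC_atLeastAtMost[OF that d]) (intro continuous_intros continuous_ft W)
      then show ?thesis by (simp add: set_lebesgue_integral_def)
    qed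
    have lim: "((\<lambda>R. ft (truncate_at R ?zf) x) \<longlongrightarrow> ft ?zf x) at_top" for x
      unfolding ft_def
    proof (rule integral_dominated_convergence_at_top[where w = "\<lambda>z. cmod (complex_of_real z * f z)"])
      show "AE z in lborel. ((\<lambda>R. iexp (x * z) * truncate_at R ?zf z) \<longlongrightarrow> iexp (x * z) * ?zf z) at_top"
      proof (rule AE_I2)
        fix z :: real
        have "\<forall>\<^sub>F R in at_top. iexp (x * z) * truncate_at R ?zf z = iexp (x * z) * ?zf z"
          using eventually_ge_at_top[of "\<bar>z\<bar>"] by eventually_elim (auto simp: indicator_def)
        then show "((\<lambda>R. iexp (x * z) * truncate_at R ?zf z) \<longlongrightarrow> iexp (x * z) * ?zf z) at_top"
          by (rule tendsto_eventually)
      qed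
      show "\<forall>\<^sub>F R in at_top. AE z in lborel. norm (iexp (x * z) * truncate_at R ?zf z) \<le> cmod (complex_of_real z * f z)"
        by (intro always_eventually allI AE_I2) (auto simp: indicator_def norm_mult)
      show "integrable lborel (\<lambda>z. cmod (complex_of_real z * f z))" by (intro integrable_norm int)
    qed auto
    have lim1: "((\<lambda>R. - (LINT k:{a..b}|lborel. ft (?W R) k)) \<longlongrightarrow> ft ?zf b - ft ?zf a) at_top"
      unfolding trunc[symmetric] by (intro tendsto_diff lim)
    let ?g = "\<lambda>k. complex_of_real (\<mu> - \<bar>k\<bar>) * ft f k"
    have gc: "continuous_on S ?g" for S by (intro continuous_intros cont)
    have "((\<lambda>R. LINT k:{a..b}|lborel. ft (?W R) k - ?g k) \<longlongrightarrow> 0) at_top"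
      by (rule tendsto_set_integral_of_L2[OF _ eigenfunction_fourier_limit[OF eig]])
         (intro borel_measurable_continuous_onI continuous_intros continuous_ft W gc)
    moreover have "(LINT k:{a..b}|lborel. ft (?W R) k - ?g k) = (LINT k:{a..b}|lborel. ft (?W R) k) - (LINT k:{a..b}|lborel. ?g k)" for R
      by (intro set_integral_diff borel_integrable_atLeastAtMost' gc continuous_ft W)
    ultimately have "((\<lambda>R. (LINT k:{a..b}|lborel. ft (?W R) k) - (LINT k:{a..b}|lborel. ?g k)) \<longlongrightarrow> 0) at_top" by simp
    from tendsto_minus[OF this]
    have "((\<lambda>R. - (LINT k:{a..b}|lborel. ft (?W R) k) + (LINT k:{a..b}|lborel. ?g k)) \<longlongrightarrow> 0) at_top" by simp
    from tendsto_diff[OF this tendsto_const[of "LINT k:{a..b}|lborel. ?g k"]]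
    have "((\<lambda>R. - (LINT k:{a..b}|lborel. ft (?W R) k)) \<longlongrightarrow> - (LINT k:{a..b}|lborel. ?g k)) at_top" by simp
    from tendsto_unique[OF _ lim1 this]
    have "ft ?zf b - ft ?zf a = - (LINT k:{a..b}|lborel. ?g k)" by simp
    also have "\<dots> = (LINT k:{a..b}|lborel. - ?g k)"
      by (simp add: set_lebesgue_integral_def)
    also have "(\<lambda>k. - ?g k) = ?h" by (simp add: fun_eq_iff algebra_simps)
    finally show ?thesis .
  qed
  have "((\<lambda>u. ft ?zf (k - 1) + integral {k - 1..u} ?h) has_vector_derivative ?h k) (at k within {k - 1..k + 1})"
    by (rule has_vector_derivative_eq_rhs,
        rule has_vector_derivative_add[OF has_vector_derivative_const integral_has_vector_derivative[OF hcont]])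
       auto
  moreover have "ft ?zf (k - 1) + integral {k - 1..u} ?h = ft ?zf u" if "u \<in> {k - 1..k + 1}" for u
  proof -
    have "(LINT k:{k - 1..u}|lborel. ?h k) = integral {k - 1..u} ?h"
      by (intro set_borel_integral_eq_integral borel_integrable_atLeastAtMost' hcont)
    then show ?thesis using incr[of "k - 1" u] that by (simp add: algebra_simps)
  qed
  ultimately have "(ft ?zf has_vector_derivative ?h k) (at k within {k - 1..k + 1})"
    by (intro has_vector_derivative_transform[of k "{k - 1..k + 1}" "ft ?zf"
        "\<lambda>u. ft ?zf (k - 1) + integral {k - 1..u} ?h"]) auto
  then show "(ft ?zf has_vector_derivative ?h k) (at k)"
    by (simp add: at_within_Icc_at)
qed

section \<open>Transforms of eigenfunctions\<close>

text \<open>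
  A nonzero multiple of the growing series would keep the modulus of \<open>y\<close> away from \<open>0\<close> near \<open>+\<infinity>\<close>,
  on a set of infinite measure.
\<close>

lemma solves_airy_on_square_integrable:
  fixes y y' :: "real \<Rightarrow> complex"
  assumes sol: "solves_airy_on {c..} y y'"
    and sq: "integrable lborel (\<lambda>x. indicator {c..} x * (cmod (y x))\<^sup>2)"
  obtains a where "\<And>x. x \<ge> c \<Longrightarrow> y x = a * complex_of_real (airy x)"
    "\<And>x. x \<ge> c \<Longrightarrow> y' x = a * complex_of_real (deriv airy x)"
proof -
  obtain a b where ab: "\<And>x. x \<ge> c \<Longrightarrow> y x = a * complex_of_real (airy x) + b * complex_of_real (airy_series 0 1 x)"
    "\<And>x. x \<ge> c \<Longrightarrow> y' x = a * complex_of_real (deriv airy x) + b * complex_of_real (airy_series' 0 1 x)"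
    using airy_basis[OF _ sol] by (metis convex_real_interval(1) atLeast_iff)
  have "b = 0"
  proof (rule ccontr)
    assume "b \<noteq> 0"
    have "((\<lambda>x. cmod a * \<bar>airy x\<bar>) \<longlongrightarrow> cmod a * 0) at_top"
      using airy_decay(1)[of 0] by (intro tendsto_intros tendsto_rabs_zero) simp
    then have "\<forall>\<^sub>F x in at_top. cmod a * \<bar>airy x\<bar> < cmod b / 2"
      using \<open>b \<noteq> 0\<close> by (intro order_tendstoD(2)) auto
    then have "\<forall>\<^sub>F x in at_top. cmod b / 2 \<le> cmod (y x)"
      using eventually_ge_at_top[of c] eventually_ge_at_top[of 1]
    proof eventually_elim
      case (elim x)
      have "cmod b * 1 \<le> cmod b * \<bar>airy_series 0 1 x\<bar>"
        using airy_series_01_ge(1)[of x] elim by (intro mult_left_mono) auto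
      also have "\<dots> = cmod (b * complex_of_real (airy_series 0 1 x))" by (simp add: norm_mult)
      also have "\<dots> = cmod (y x - a * complex_of_real (airy x))" using ab(1) elim by simp
      also have "\<dots> \<le> cmod (y x) + cmod a * \<bar>airy x\<bar>"
        using norm_triangle_ineq4[of "y x" "a * complex_of_real (airy x)"] by (simp add: norm_mult)
      finally show ?case using elim by linarith
    qed
    then obtain X where X: "\<And>x. x \<ge> X \<Longrightarrow> cmod b / 2 \<le> cmod (y x)"
      by (auto simp: eventually_at_top_linorder)
    define Z where "Z = max X c"
    have "integrable lborel (\<lambda>x. (cmod b / 2)\<^sup>2 * indicator {Z..} x)"
    proof (rule Bochner_Integration.integrable_bound[OF sq])
      show "AE x in lborel. norm ((cmod b / 2)\<^sup>2 * indicator {Z..} x) \<le> norm (indicator {c..} x * (cmod (y x))\<^sup>2)"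
        using X by (intro AE_I2) (auto simp: indicator_def Z_def intro!: power_mono)
    qed simp
    then have "integrable lborel (indicator {Z..} :: real \<Rightarrow> real)" using \<open>b \<noteq> 0\<close> by simp
    then have fin: "emeasure lborel {Z..} < \<infinity>" by (simp add: integrable_indicator_iff)
    then obtain r where r: "emeasure lborel {Z..} = ennreal r" "r \<ge> 0"
      by (cases "emeasure lborel {Z..}") auto
    have "emeasure lborel {Z..Z + (r + 1)} \<le> emeasure lborel {Z..}"
      by (intro emeasure_mono) auto
    then show False using r by simp
  qed
  then show ?thesis using ab by (intro that[of a]) simp_all
qed

text \<open>
  The extension of \<open>Ai (k - \<mu>)\<close> from the positive half-line to an even function for \<open>s = 1\<close> and to an
  odd one for \<open>s = - 1\<close>.
\<close>

definition airy_profile :: "real \<Rightarrow> real \<Rightarrow> real \<Rightarrow> complex" where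
  "airy_profile \<mu> s k = complex_of_real (if 0 \<le> k then airy (k - \<mu>) else s * airy (- k - \<mu>))"

text \<open>
  The condition under which \<open>airy_profile \<mu> s\<close> is continuously differentiable at \<open>0\<close>.
\<close>

definition airy_parity :: "real \<Rightarrow> real \<Rightarrow> bool" where
  "airy_parity \<mu> s \<longleftrightarrow> s = 1 \<and> deriv airy (- \<mu>) = 0 \<or> s = - 1 \<and> airy (- \<mu>) = 0"

text \<open>
  On both half-lines the transform is a multiple of \<open>Ai (\<bar>k\<bar> - \<mu>)\<close>, say by \<open>a\<close> and \<open>b\<close>. At \<open>k = 0\<close> the
  values give \<open>a Ai (- \<mu>) = b Ai (- \<mu>)\<close> and the slopes give \<open>a Ai' (- \<mu>) = - b Ai' (- \<mu>)\<close>. As \<open>Ai\<close> has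
  no double zeros, \<open>b = \<plusminus> a\<close>, and the sign decides which of the two values must vanish.
\<close>

lemma eigenfunction_ft_profile:
  assumes eig: "H_eigenfunction \<mu> f"
  obtains a s where "a \<noteq> 0" "airy_parity \<mu> s" "\<And>k. ft f k = a * airy_profile \<mu> s k"
proof -
  note int = eigenfunction_integrable[OF eig]
  define G where "G = ft f"
  define G' where "G' = ft (\<lambda>z. \<i> * (complex_of_real z * f z))"
  have d: "(G has_vector_derivative G' k) (at k)"
    "(G' has_vector_derivative complex_of_real (\<bar>k\<bar> - \<mu>) * G k) (at k)" for k
    unfolding G_def G'_def by (rule eigenfunction_ft_ode[OF eig])+
  have G2: "integrable lborel (\<lambda>k. (cmod (G k))\<^sup>2)"
    using ft_square_integrable[OF int(3,1)] by (simp add: square_integrable_def G_def)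
  \<comment> \<open>\<open>t\<close> selects the half-line; \<open>t\<close> times the derivative is the outward slope\<close>
  have half_line: "\<exists>a. \<forall>k\<ge>0. G (t * k) = a * complex_of_real (airy (k - \<mu>)) \<and>
      t *\<^sub>R G' (t * k) = a * complex_of_real (deriv airy (k - \<mu>))" if t: "t = 1 \<or> t = - 1" for t
  proof -
    define y where "y x = G (t * (x + \<mu>))" for x
    define y' where "y' x = t *\<^sub>R G' (t * (x + \<mu>))" for x
    have lin: "((\<lambda>x. t * (x + \<mu>)) has_vector_derivative t) (at x within S)" for x S
      by (auto intro!: derivative_eq_intros simp: has_vector_derivative_def)
    have sol: "solves_airy_on {- \<mu>..} y y'"
      unfolding solves_airy_on_def
    proof (intro ballI conjI)
      fix x assume "x \<in> {- \<mu>..}"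
      then have x: "x + \<mu> \<ge> 0" by simp
      show "(y has_vector_derivative y' x) (at x within {- \<mu>..})"
        unfolding y_def[abs_def] y'_def
        using vector_diff_chain_within[OF lin[of x "{- \<mu>..}"], of G "G' (t * (x + \<mu>))"] d(1)
        by (simp add: o_def has_vector_derivative_at_within)
      have "(y' has_vector_derivative t *\<^sub>R (t *\<^sub>R (complex_of_real (\<bar>t * (x + \<mu>)\<bar> - \<mu>) * G (t * (x + \<mu>))))) (at x within {- \<mu>..})"
        unfolding y'_def[abs_def]
        using vector_diff_chain_within[OF lin[of x "{- \<mu>..}"], of G' "complex_of_real (\<bar>t * (x + \<mu>)\<bar> - \<mu>) * G (t * (x + \<mu>))"] d(2)
        by (intro bounded_linear.has_vector_derivative[OF bounded_linear_scaleR_right])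
          (simp add: o_def has_vector_derivative_at_within)
      moreover have "\<bar>t * (x + \<mu>)\<bar> - \<mu> = x" "t * t = 1" using t x by auto
      ultimately show "(y' has_vector_derivative complex_of_real x * y x) (at x within {- \<mu>..})"
        by (simp add: y_def)
    qed
    have sq: "integrable lborel (\<lambda>x. indicator {- \<mu>..} x * (cmod (y x))\<^sup>2)"
    proof -
      have "integrable lborel (\<lambda>x. (cmod (G (t * \<mu> + t * x)))\<^sup>2)"
        using t by (subst lborel_integrable_real_affine_iff) (auto intro!: G2)
      then have "integrable lborel (\<lambda>x. (cmod (y x))\<^sup>2)"
        by (simp add: y_def algebra_simps)
      from integrable_mult_indicator[OF _ this, of "{- \<mu>..}"] show ?thesis by simp
    qed
    obtain a where a: "\<And>x. x \<ge> - \<mu> \<Longrightarrow> y x = a * complex_of_real (airy x)"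
      "\<And>x. x \<ge> - \<mu> \<Longrightarrow> y' x = a * complex_of_real (deriv airy x)"
      using solves_airy_on_square_integrable[OF sol sq] by blast
    show ?thesis
    proof (intro exI[of _ a] allI impI)
      fix k :: real assume "k \<ge> 0"
      then show "G (t * k) = a * complex_of_real (airy (k - \<mu>)) \<and>
        t *\<^sub>R G' (t * k) = a * complex_of_real (deriv airy (k - \<mu>))"
        using a[of "k - \<mu>"] by (simp add: y_def y'_def)
    qed
  qed
  obtain a where a: "\<And>k. k \<ge> 0 \<Longrightarrow> G k = a * complex_of_real (airy (k - \<mu>))"
      "\<And>k. k \<ge> 0 \<Longrightarrow> G' k = a * complex_of_real (deriv airy (k - \<mu>))"
    using half_line[of 1] by auto
  obtain b where b: "\<And>k. k \<ge> 0 \<Longrightarrow> G (- k) = b * complex_of_real (airy (k - \<mu>))"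
      "\<And>k. k \<ge> 0 \<Longrightarrow> - G' (- k) = b * complex_of_real (deriv airy (k - \<mu>))"
    using half_line[of "- 1"] by auto
  have match: "a * complex_of_real (airy (- \<mu>)) = b * complex_of_real (airy (- \<mu>))"
     "a * complex_of_real (deriv airy (- \<mu>)) = - b * complex_of_real (deriv airy (- \<mu>))"
  proof -
    show "a * complex_of_real (airy (- \<mu>)) = b * complex_of_real (airy (- \<mu>))"
      using a(1)[of 0] b(1)[of 0] by simp
    have "- (a * complex_of_real (deriv airy (- \<mu>))) = b * complex_of_real (deriv airy (- \<mu>))"
      using a(2)[of 0] b(2)[of 0] by simp
    then show "a * complex_of_real (deriv airy (- \<mu>)) = - b * complex_of_real (deriv airy (- \<mu>))"
      by (metis add.inverse_inverse mult_minus_left)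
  qed
  have nonzero: "\<not> (\<forall>k. G k = 0)"
    using ft_eq_0_imp_AE_0[OF int(3)] eig unfolding G_def H_eigenfunction_def by blast
  have G_a: "G k = a * airy_profile \<mu> s k" if "b = s * a" for s k
    using a(1)[of k] b(1)[of "- k"] that by (cases "k \<ge> 0") (auto simp: airy_profile_def)
  show ?thesis
  proof (cases "airy (- \<mu>) = 0")
    case True
    then have nz: "complex_of_real (deriv airy (- \<mu>)) \<noteq> 0" using airy_no_double_zero[of "- \<mu>"] by simp
    have "a = - b" using match(2) unfolding mult_right_cancel[OF nz] .
    then have "b = - a" by simp
    then have "G k = a * airy_profile \<mu> (- 1) k" for k using G_a[of "- 1"] by simp
    moreover from this have "a \<noteq> 0" using nonzero by auto
    ultimately show ?thesis
      using True by (intro that[of a "- 1"]) (auto simp: airy_parity_def G_def)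
  next
    case False
    then have "b = a" using match by simp
    then have G: "G k = a * airy_profile \<mu> 1 k" for k using G_a[of 1] by simp
    then have "a \<noteq> 0" using nonzero by auto
    moreover have "deriv airy (- \<mu>) = 0"
      using match(2) \<open>b = a\<close> \<open>a \<noteq> 0\<close> by simp
    ultimately show ?thesis
      using G by (intro that[of a 1]) (auto simp: airy_parity_def G_def)
  qed
qed

section \<open>Derivatives of the Airy function\<close>

text \<open>
  The \<open>n\<close>-th derivative of the Airy function, see \<open>airy_nth_deriv\<close>.
\<close>

definition airy_nth :: "nat \<Rightarrow> real \<Rightarrow> real" where
  "airy_nth n x = poly (airy_p n) x * airy x + poly (airy_q n) x * deriv airy x"

lemma airy_nth_deriv: "(airy_nth n has_real_derivative airy_nth (Suc n) x) (at x)"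
  unfolding airy_nth_def[abs_def]
  by (rule DERIV_cong, (rule DERIV_add DERIV_mult poly_DERIV airy_deriv)+) (simp add: algebra_simps)

lemma airy_nth_simps: "airy_nth 0 x = airy x" "airy_nth (Suc 0) x = deriv airy x" "airy_nth 2 x = x * airy x"
  by (simp_all add: airy_nth_def numeral_2_eq_2)

lemma continuous_airy_nth: "continuous_on S (airy_nth n)"
  by (meson DERIV_isCont airy_nth_deriv continuous_at_imp_continuous_on)

lemma poly_airy_decay:
  "((\<lambda>x. poly p x * airy x) \<longlongrightarrow> 0) at_top" "((\<lambda>x. poly p x * deriv airy x) \<longlongrightarrow> 0) at_top"
proof -
  have *: "((\<lambda>x. poly p x * y x) \<longlongrightarrow> 0) at_top" if "\<And>n. ((\<lambda>x. x ^ n * y x) \<longlongrightarrow> 0) at_top" for y :: "real \<Rightarrow> real"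
  proof -
    have "((\<lambda>x. \<Sum>i\<le>degree p. coeff p i * (x ^ i * y x)) \<longlongrightarrow> (\<Sum>i\<le>degree p. coeff p i * 0)) at_top"
      by (intro tendsto_sum tendsto_mult_left that)
    then show ?thesis by (simp add: poly_altdef sum_distrib_right mult.assoc)
  qed
  show "((\<lambda>x. poly p x * airy x) \<longlongrightarrow> 0) at_top" "((\<lambda>x. poly p x * deriv airy x) \<longlongrightarrow> 0) at_top"
    by (intro * airy_decay)+
qed

lemma airy_nth_decay: "((\<lambda>x. poly p x * airy_nth n x) \<longlongrightarrow> 0) at_top"
  using tendsto_add[OF poly_airy_decay(1)[of "p * airy_p n"] poly_airy_decay(2)[of "p * airy_q n"]]
  by (simp add: airy_nth_def algebra_simps)

lemma bounded_of_tendsto_at_top: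
  fixes f :: "real \<Rightarrow> real"
  assumes "continuous_on {c..} f" "(f \<longlongrightarrow> 0) at_top"
  obtains B where "B \<ge> 0" "\<And>x. x \<ge> c \<Longrightarrow> \<bar>f x\<bar> \<le> B"
proof -
  have "\<forall>\<^sub>F x in at_top. \<bar>f x\<bar> < 1"
    using tendstoD[OF assms(2), of 1] by (simp add: dist_real_def)
  then obtain X where X: "\<And>x. x \<ge> X \<Longrightarrow> \<bar>f x\<bar> < 1" by (auto simp: eventually_at_top_linorder)
  have "compact (f ` {c..X})"
    using assms(1) by (intro compact_continuous_image) (auto intro: continuous_on_subset)
  then obtain B where "\<forall>y\<in>f ` {c..X}. \<bar>y\<bar> \<le> B"
    by (meson compact_imp_bounded bounded_real)
  then have B: "\<bar>f x\<bar> \<le> B" if "x \<in> {c..X}" for x using that by blast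
  show ?thesis
  proof (rule that[of "max B 1"])
    fix x assume "x \<ge> c"
    then show "\<bar>f x\<bar> \<le> max B 1" using X[of x] B[of x] by (cases "x \<ge> X") (auto simp: le_max_iff_disj)
  qed simp
qed

text \<open>
  The quadratic rate is one convenient choice; the decay is faster than that of any power.
\<close>

lemma airy_nth_bound:
  obtains B where "B \<ge> 0" "\<And>k. k \<ge> 0 \<Longrightarrow> \<bar>airy_nth n (k - \<mu>)\<bar> \<le> B * inverse (1 + k\<^sup>2)"
proof -
  define p where "p = 1 + [:\<mu>, 1:] * [:\<mu>, 1:]"
  have cont: "continuous_on {- \<mu>..} (\<lambda>x. poly p x * airy_nth n x)"
    by (intro continuous_intros continuous_airy_nth)
  obtain B where B: "B \<ge> 0" "\<And>x. x \<ge> - \<mu> \<Longrightarrow> \<bar>poly p x * airy_nth n x\<bar> \<le> B"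
    using bounded_of_tendsto_at_top[OF cont airy_nth_decay] by blast
  show ?thesis
  proof (rule that[OF B(1)])
    fix k :: real assume "k \<ge> 0"
    have pos: "1 + k\<^sup>2 > 0" by (simp add: add_pos_nonneg)
    have "poly p (k - \<mu>) = 1 + k\<^sup>2" by (simp add: p_def power2_eq_square algebra_simps)
    then have "(1 + k\<^sup>2) * \<bar>airy_nth n (k - \<mu>)\<bar> \<le> B"
      using B(2)[of "k - \<mu>"] \<open>k \<ge> 0\<close> pos by (simp add: abs_mult)
    then show "\<bar>airy_nth n (k - \<mu>)\<bar> \<le> B * inverse (1 + k\<^sup>2)"
      using pos by (simp add: field_simps)
  qed
qed

lemma integrable_of_quadratic_decay:
  fixes f :: "real \<Rightarrow> complex"
  assumes [measurable]: "f \<in> borel_measurable borel" and le: "\<And>x. cmod (f x) \<le> B * inverse (1 + x\<^sup>2)"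
  shows "integrable lborel f" "square_integrable f"
proof -
  show "integrable lborel f"
  proof (rule Bochner_Integration.integrable_bound)
    show "integrable lborel (\<lambda>x::real. B * inverse (1 + x\<^sup>2))"
      by (intro integrable_mult_right integrable_inverse_1_plus_square_lborel)
    show "AE x in lborel. norm (f x) \<le> norm (B * inverse (1 + x\<^sup>2))"
      using le by (intro AE_I2) (smt (verit) real_norm_def)
  qed simp
  have "integrable lborel (\<lambda>x. (cmod (f x))\<^sup>2)"
  proof (rule Bochner_Integration.integrable_bound)
    show "integrable lborel (\<lambda>x::real. B\<^sup>2 * inverse (1 + x\<^sup>2))"
      by (intro integrable_mult_right integrable_inverse_1_plus_square_lborel)
    show "AE x in lborel. norm ((cmod (f x))\<^sup>2) \<le> norm (B\<^sup>2 * inverse (1 + x\<^sup>2))"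
    proof (rule AE_I2)
      fix x :: real
      have pos: "1 + x\<^sup>2 > 0" by (simp add: add_pos_nonneg)
      have "(cmod (f x))\<^sup>2 \<le> (B * inverse (1 + x\<^sup>2))\<^sup>2" using le by (intro power_mono) auto
      also have "\<dots> = B\<^sup>2 * inverse (1 + x\<^sup>2) * inverse (1 + x\<^sup>2)" by (simp add: power2_eq_square)
      also have "\<dots> \<le> B\<^sup>2 * inverse (1 + x\<^sup>2) * 1"
        using pos by (intro mult_left_mono) (auto simp: inverse_le_1_iff)
      finally show "norm ((cmod (f x))\<^sup>2) \<le> norm (B\<^sup>2 * inverse (1 + x\<^sup>2))" using pos by simp
    qed
  qed simp
  then show "square_integrable f" by (simp add: square_integrable_def)
qed

section \<open>Half-line transforms and integration by parts\<close>

text \<open>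
  The open half-line keeps both one-sided pieces of a profile disjoint; the origin is a null set.
\<close>

definition airy_half :: "real \<Rightarrow> nat \<Rightarrow> real \<Rightarrow> complex" where
  "airy_half \<mu> n k = indicator {0<..} k *\<^sub>R complex_of_real (airy_nth n (k - \<mu>))"

lemma airy_nth_shift_continuous: "continuous_on S (\<lambda>k. airy_nth n (k - \<mu>))"
  by (intro continuous_on_compose2[OF continuous_airy_nth[of UNIV]] continuous_intros) auto

lemma integrable_airy_half: "integrable lborel (airy_half \<mu> n)"
proof -
  obtain B where B: "B \<ge> 0" "\<And>k. k \<ge> 0 \<Longrightarrow> \<bar>airy_nth n (k - \<mu>)\<bar> \<le> B * inverse (1 + k\<^sup>2)"
    using airy_nth_bound[of n \<mu>] by blast
  have [measurable]: "(\<lambda>k. airy_nth n (k - \<mu>)) \<in> borel_measurable borel"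
    by (intro borel_measurable_continuous_onI airy_nth_shift_continuous)
  show ?thesis
  proof (rule integrable_of_quadratic_decay)
    show "airy_half \<mu> n \<in> borel_measurable borel" unfolding airy_half_def[abs_def] by measurable
    show "cmod (airy_half \<mu> n k) \<le> B * inverse (1 + k\<^sup>2)" for k
      using B by (cases "k > 0") (auto simp: airy_half_def)
  qed
qed

text \<open>
  Integration by parts on the half-line: the left-hand side is the integral of the derivative of
  \<open>exp (\<i> z k) Ai\<^bsup>(n)\<^esup> (k - \<mu>)\<close>, and only the boundary term at \<open>0\<close> remains.
\<close>

lemma ft_airy_half_parts:
  "\<i> * z * ft (airy_half \<mu> n) z + ft (airy_half \<mu> (Suc n)) z = - complex_of_real (airy_nth n (- \<mu>))"
proof -
  define F where "F k = iexp (z * k) * complex_of_real (airy_nth n (k - \<mu>))" for k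
  define F' where "F' k = \<i> * z * (iexp (z * k) * complex_of_real (airy_nth n (k - \<mu>)))
      + iexp (z * k) * complex_of_real (airy_nth (Suc n) (k - \<mu>))" for k
  have nth_deriv: "((\<lambda>k. complex_of_real (airy_nth m (k - \<mu>))) has_vector_derivative complex_of_real (airy_nth (Suc m) (k - \<mu>))) (at k)" for k m
  proof (rule has_vector_derivative_of_real)
    show "((\<lambda>k. airy_nth m (k - \<mu>)) has_real_derivative airy_nth (Suc m) (k - \<mu>)) (at k)"
      using airy_nth_deriv[of m "k + - \<mu>"] unfolding DERIV_shift by simp
  qed
  have F: "(F has_vector_derivative F' k) (at k)" for k
    unfolding F_def[abs_def] F'_def
    by (rule has_vector_derivative_eq_rhs, rule has_vector_derivative_mult[OF iexp_has_vector_derivative nth_deriv])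
       (simp add: algebra_simps)
  have contF': "isCont F' k" for k
  proof -
    have "isCont (\<lambda>k. airy_nth m (k - \<mu>)) k" for m
      using airy_nth_shift_continuous[of UNIV] by (simp add: continuous_on_eq_continuous_at)
    then show ?thesis unfolding F'_def[abs_def] by (intro continuous_intros)
  qed
  have half_F': "indicator {0<..} k *\<^sub>R F' k = \<i> * z * (iexp (z * k) * airy_half \<mu> n k) + iexp (z * k) * airy_half \<mu> (Suc n) k" for k
    by (simp add: F'_def airy_half_def indicator_def)
  note i1 = integrable_iexp_mult[OF integrable_airy_half, of z \<mu>]
  have i2: "integrable lborel (\<lambda>k. \<i> * z * (iexp (z * k) * airy_half \<mu> n k))"
    by (intro integrable_mult_right i1)
  have ein: "einterval 0 \<infinity> = {0<..}" by (auto simp: einterval_def zero_ereal_def)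
  have int: "set_integrable lborel {0<..} F'"
    unfolding set_integrable_def half_F' by (intro Bochner_Integration.integrable_add i1 i2)
  have "(LBINT k=0..\<infinity>. F' k) = 0 - F 0"
  proof (rule interval_integral_FTC_integrable)
    have "(F \<longlongrightarrow> F 0) (at_right 0)"
      using has_vector_derivative_continuous[OF F[of 0]] by (simp add: continuous_within filterlim_at_split)
    then show "((F \<circ> real_of_ereal) \<longlongrightarrow> F 0) (at_right 0)"
      by (simp add: zero_ereal_def ereal_tendsto_simps)
    have "((\<lambda>x. airy_nth n x) \<longlongrightarrow> 0) at_top" using airy_nth_decay[of 1 n] by simp
    then have "((\<lambda>k. airy_nth n (k - \<mu>)) \<longlongrightarrow> 0) at_top"
      by (rule filterlim_compose) real_asymp
    then have "(F \<longlongrightarrow> 0) at_top"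
      by (intro tendsto_norm_zero_cancel[of F]) (simp add: F_def norm_mult tendsto_rabs_zero)
    then show "((F \<circ> real_of_ereal) \<longlongrightarrow> 0) (at_left \<infinity>)"
      by (simp add: ereal_tendsto_simps)
  qed (use F contF' int ein in auto)
  moreover have "(LBINT k=0..\<infinity>. F' k) = \<i> * z * ft (airy_half \<mu> n) z + ft (airy_half \<mu> (Suc n)) z"
  proof -
    have "(LBINT k=0..\<infinity>. F' k) = (LINT k|lborel. \<i> * z * (iexp (z * k) * airy_half \<mu> n k) + iexp (z * k) * airy_half \<mu> (Suc n) k)"
      by (simp only: interval_lebesgue_integral_0_infty set_lebesgue_integral_def half_F')
    also have "\<dots> = (LINT k|lborel. \<i> * z * (iexp (z * k) * airy_half \<mu> n k)) + ft (airy_half \<mu> (Suc n)) z"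
      unfolding ft_def by (rule Bochner_Integration.integral_add[OF i2 i1])
    also have "(LINT k|lborel. \<i> * z * (iexp (z * k) * airy_half \<mu> n k)) = \<i> * z * ft (airy_half \<mu> n) z"
      unfolding ft_def by (rule integral_mult_right_zero)
    finally show ?thesis .
  qed
  ultimately show ?thesis by (simp add: F_def)
qed

text \<open>
  The transform of the \<open>n\<close>-th derivative, taken separately on the two half-lines, of the profile with
  parity \<open>s\<close>. Each derivative flips the parity, hence the sign \<open>(- 1)\<^sup>n\<close>.
\<close>

definition airy_sym :: "real \<Rightarrow> real \<Rightarrow> nat \<Rightarrow> real \<Rightarrow> complex" where
  "airy_sym \<mu> s n z = ft (airy_half \<mu> n) z + complex_of_real (s * (- 1) ^ n) * ft (airy_half \<mu> n) (- z)"

lemma airy_sym_bound: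
  obtains C where "C \<ge> 0" "\<And>z. cmod (airy_sym \<mu> s n z) \<le> C"
proof (rule that)
  let ?I = "LINT k|lborel. cmod (airy_half \<mu> n k)"
  have I: "?I \<ge> 0" by (intro Bochner_Integration.integral_nonneg) simp
  then show "?I + \<bar>s\<bar> * ?I \<ge> 0" by simp
  fix z
  have "cmod (airy_sym \<mu> s n z) \<le> cmod (ft (airy_half \<mu> n) z) + cmod (complex_of_real (s * (- 1) ^ n) * ft (airy_half \<mu> n) (- z))"
    unfolding airy_sym_def by (rule norm_triangle_ineq)
  also have "\<dots> \<le> ?I + \<bar>s\<bar> * ?I"
    using norm_ft_le[of "airy_half \<mu> n"] by (intro add_mono) (auto simp: norm_mult norm_power intro!: mult_left_mono)
  finally show "cmod (airy_sym \<mu> s n z) \<le> ?I + \<bar>s\<bar> * ?I" .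
qed

text \<open>
  The jump at \<open>0\<close> of the \<open>n\<close>-th derivative of the profile with parity \<open>s\<close>.
\<close>

definition airy_boundary :: "real \<Rightarrow> real \<Rightarrow> nat \<Rightarrow> complex" where
  "airy_boundary \<mu> s n = complex_of_real (airy_nth n (- \<mu>) * (1 - s * (- 1) ^ n))"

lemma airy_sym_step:
  assumes "z \<noteq> 0"
  shows "airy_sym \<mu> s n z = \<i> / z * (airy_boundary \<mu> s n + airy_sym \<mu> s (Suc n) z)"
proof -
  have E: "ft (airy_half \<mu> n) w = \<i> / w * (airy_nth n (- \<mu>) + ft (airy_half \<mu> (Suc n)) w)" if "w \<noteq> 0" for w :: real
  proof -
    have "\<i> * w * ft (airy_half \<mu> n) w = - (airy_nth n (- \<mu>) + ft (airy_half \<mu> (Suc n)) w)"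
      using ft_airy_half_parts[of w \<mu> n] by (simp add: algebra_simps eq_neg_iff_add_eq_0)
    then have "\<i> * (\<i> * w * ft (airy_half \<mu> n) w) = \<i> * - (airy_nth n (- \<mu>) + ft (airy_half \<mu> (Suc n)) w)" by simp
    then show ?thesis using that by (simp add: field_simps)
  qed
  define w where "w = \<i> / z"
  have E1: "ft (airy_half \<mu> n) z = w * (airy_nth n (- \<mu>) + ft (airy_half \<mu> (Suc n)) z)"
    using E[OF assms] by (simp add: w_def)
  have E2: "ft (airy_half \<mu> n) (- z) = - w * (airy_nth n (- \<mu>) + ft (airy_half \<mu> (Suc n)) (- z))"
    using E[of "- z"] assms by (simp add: w_def)
  show ?thesis
    unfolding airy_sym_def airy_boundary_def w_def[symmetric] E1 E2 by (simp add: algebra_simps)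
qed

lemma airy_sym_expansion:
  assumes "z \<noteq> 0"
  shows "airy_sym \<mu> s 0 z = (\<Sum>m<M. (\<i> / z) ^ Suc m * airy_boundary \<mu> s m) + (\<i> / z) ^ M * airy_sym \<mu> s M z"
proof (induction M)
  case (Suc M)
  show ?case
    unfolding Suc airy_sym_step[OF assms, of \<mu> s M] by (simp add: algebra_simps)
qed simp

section \<open>Construction of eigenfunctions\<close>

lemma AE_nonzero: "AE k in lborel. k \<noteq> (0::real)"
  by (rule AE_I[of _ _ "{0}"]) auto

lemma ft_reflect: "ft (\<lambda>k. f (- k)) z = ft f (- z)"
proof -
  have "ft (\<lambda>k. f (- k)) z = \<bar>- 1\<bar> *\<^sub>R (LINT k|lborel. iexp (z * (0 + - 1 * k)) * f (- (0 + - 1 * k)))"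
    unfolding ft_def by (rule lborel_integral_real_affine) simp
  then show ?thesis by (simp add: ft_def)
qed

lemma integrable_reflect:
  fixes f :: "real \<Rightarrow> complex"
  assumes "integrable lborel f"
  shows "integrable lborel (\<lambda>k. f (- k))"
  using lborel_integrable_real_affine[OF assms, of "- 1" 0] by simp

text \<open>
  The second derivative of a profile away from \<open>0\<close> is \<open>(\<bar>k\<bar> - \<mu>)\<close> times the profile, and it has the
  same parity.
\<close>

lemma profile_of_half:
  assumes "k \<noteq> 0"
  shows "airy_profile \<mu> s k = airy_half \<mu> 0 k + complex_of_real s * airy_half \<mu> 0 (- k)"
    and "complex_of_real (\<bar>k\<bar> - \<mu>) * airy_profile \<mu> s k = airy_half \<mu> 2 k + complex_of_real s * airy_half \<mu> 2 (- k)"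
  using assms by (auto simp: airy_profile_def airy_half_def airy_nth_simps indicator_def)

lemma
  assumes [measurable]: "f \<in> borel_measurable borel"
    and eq: "\<And>k. k \<noteq> 0 \<Longrightarrow> f k = airy_half \<mu> n k + complex_of_real s * airy_half \<mu> n (- k)"
  shows integrable_symmetrized: "integrable lborel f"
    and ft_symmetrized: "ft f z = ft (airy_half \<mu> n) z + complex_of_real s * ft (airy_half \<mu> n) (- z)"
proof -
  note h = integrable_airy_half[of \<mu> n]
  have r: "integrable lborel (\<lambda>k. complex_of_real s * airy_half \<mu> n (- k))"
    by (intro integrable_mult_right integrable_reflect h)
  have [measurable]: "airy_half \<mu> n \<in> borel_measurable borel" using borel_measurable_integrable[OF h] by simp
  have "integrable lborel (\<lambda>k. airy_half \<mu> n k + complex_of_real s * airy_half \<mu> n (- k))"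
    by (intro Bochner_Integration.integrable_add h r)
  moreover have AE: "AE k in lborel. f k = airy_half \<mu> n k + complex_of_real s * airy_half \<mu> n (- k)"
    using AE_nonzero by eventually_elim (rule eq)
  ultimately show "integrable lborel f"
    by (subst integrable_cong_AE[where g = "\<lambda>k. airy_half \<mu> n k + complex_of_real s * airy_half \<mu> n (- k)"]) auto
  have "ft f z = (LINT k|lborel. iexp (z * k) * airy_half \<mu> n k + iexp (z * k) * (complex_of_real s * airy_half \<mu> n (- k)))"
    unfolding ft_def
  proof (rule integral_cong_AE)
    show "AE k in lborel. iexp (z * k) * f k = iexp (z * k) * airy_half \<mu> n k + iexp (z * k) * (complex_of_real s * airy_half \<mu> n (- k))"
      using AE by eventually_elim (simp add: distrib_left)
  qed auto
  also have "\<dots> = ft (airy_half \<mu> n) z + ft (\<lambda>k. complex_of_real s * airy_half \<mu> n (- k)) z"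
    unfolding ft_def by (intro Bochner_Integration.integral_add integrable_iexp_mult h r)
  also have "ft (\<lambda>k. complex_of_real s * airy_half \<mu> n (- k)) z = complex_of_real s * ft (airy_half \<mu> n) (- z)"
    unfolding ft_cmult ft_reflect ..
  finally show "ft f z = ft (airy_half \<mu> n) z + complex_of_real s * ft (airy_half \<mu> n) (- z)" .
qed

context
  fixes \<mu> s :: real
  assumes parity: "airy_parity \<mu> s"
begin

text \<open>
  Under the parity condition the profile and its derivative have no jump, and the second derivative
  at \<open>0\<^sup>+\<close> is \<open>- \<mu> Ai (- \<mu>)\<close>, which jumps only for odd profiles and is zero for these. So the
  expansion below starts with the fourth power of \<open>1 / z\<close>.
\<close>

lemma airy_boundary_vanishes: "airy_boundary \<mu> s 0 = 0" "airy_boundary \<mu> s 1 = 0" "airy_boundary \<mu> s 2 = 0"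
  using parity by (auto simp: airy_boundary_def airy_nth_simps airy_parity_def)

lemma profile_reflect: "airy_profile \<mu> s (- k) = complex_of_real s * airy_profile \<mu> s k"
  using parity by (cases k "0::real" rule: linorder_cases) (auto simp: airy_profile_def airy_parity_def)

lemma continuous_profile: "continuous_on UNIV (airy_profile \<mu> s)"
proof -
  have "continuous_on ({0..} \<union> {..0}) (\<lambda>k. if 0 \<le> k then airy (k - \<mu>) else s * airy (- k - \<mu>))"
  proof (rule continuous_on_If)
    show "continuous_on {0..} (\<lambda>k. airy (k - \<mu>))" "continuous_on {..0} (\<lambda>k. s * airy (- k - \<mu>))"
      by (intro continuous_intros continuous_on_compose2[OF continuous_airy(1)[of UNIV]] subset_UNIV)+
    show "airy (k - \<mu>) = s * airy (- k - \<mu>)" if "k \<in> {..0}" "0 \<le> k" for k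
      using that parity by (auto simp: airy_parity_def)
  qed auto
  moreover have "{0..} \<union> {..0} = (UNIV :: real set)" by auto
  ultimately show ?thesis
    unfolding airy_profile_def[abs_def] by (intro continuous_intros) simp
qed

lemma profile_measurable: "airy_profile \<mu> s \<in> borel_measurable borel"
  by (rule borel_measurable_continuous_onI) (rule continuous_profile)

lemma profile_bound:
  obtains B where "\<And>k. cmod (airy_profile \<mu> s k) \<le> B"
     "\<And>k. cmod (complex_of_real (\<bar>k\<bar> - \<mu>) * airy_profile \<mu> s k) \<le> B"
proof -
  have s: "\<bar>s\<bar> = 1" using parity by (auto simp: airy_parity_def)
  have abs: "cmod (airy_profile \<mu> s k) = \<bar>airy_nth 0 (\<bar>k\<bar> - \<mu>)\<bar>"
    "cmod (complex_of_real (\<bar>k\<bar> - \<mu>) * airy_profile \<mu> s k) = \<bar>airy_nth 2 (\<bar>k\<bar> - \<mu>)\<bar>" for k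
    using s by (auto simp: airy_profile_def airy_nth_simps abs_mult norm_mult simp flip: of_real_diff)
  have bounded: "\<exists>B\<ge>0. \<forall>k\<ge>0. \<bar>airy_nth n (k - \<mu>)\<bar> \<le> B" for n
  proof -
    obtain B where B: "B \<ge> 0" "\<And>k. k \<ge> 0 \<Longrightarrow> \<bar>airy_nth n (k - \<mu>)\<bar> \<le> B * inverse (1 + k\<^sup>2)"
      using airy_nth_bound[of n \<mu>] by blast
    have "B * inverse (1 + k\<^sup>2) \<le> B * 1" for k :: real
      using B(1) by (intro mult_left_mono) (auto simp: inverse_le_1_iff add_pos_nonneg)
    then show ?thesis using B by (intro exI[of _ B]) (auto intro: order_trans)
  qed
  obtain A where A: "A \<ge> 0" "\<And>k. k \<ge> 0 \<Longrightarrow> \<bar>airy_nth 0 (k - \<mu>)\<bar> \<le> A" using bounded by blast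
  obtain B where B: "B \<ge> 0" "\<And>k. k \<ge> 0 \<Longrightarrow> \<bar>airy_nth 2 (k - \<mu>)\<bar> \<le> B" using bounded by blast
  show ?thesis
  proof (rule that[of "A + B"]; unfold abs)
    fix k :: real
    show "\<bar>airy_nth 0 (\<bar>k\<bar> - \<mu>)\<bar> \<le> A + B" using A(2)[of "\<bar>k\<bar>"] B(1) by linarith
    show "\<bar>airy_nth 2 (\<bar>k\<bar> - \<mu>)\<bar> \<le> A + B" using B(2)[of "\<bar>k\<bar>"] A(1) by linarith
  qed
qed

lemma integrable_profile: "integrable lborel (airy_profile \<mu> s)"
  by (rule integrable_symmetrized[OF profile_measurable profile_of_half(1)])

lemma ft_profile: "ft (airy_profile \<mu> s) z = airy_sym \<mu> s 0 z"
  by (simp add: ft_symmetrized[OF profile_measurable profile_of_half(1)] airy_sym_def)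

lemma profile2_measurable: "(\<lambda>k. complex_of_real (\<bar>k\<bar> - \<mu>) * airy_profile \<mu> s k) \<in> borel_measurable borel"
  by (intro borel_measurable_continuous_onI continuous_intros continuous_profile)

lemma integrable_profile2: "integrable lborel (\<lambda>k. complex_of_real (\<bar>k\<bar> - \<mu>) * airy_profile \<mu> s k)"
  by (rule integrable_symmetrized[OF profile2_measurable profile_of_half(2)])

lemma ft_profile2: "ft (\<lambda>k. complex_of_real (\<bar>k\<bar> - \<mu>) * airy_profile \<mu> s k) z = airy_sym \<mu> s 2 z"
  using ft_symmetrized[OF profile2_measurable profile_of_half(2), of z] by (simp add: airy_sym_def)

text \<open>
  With no jumps of the profile and its first derivative, two integrations by parts leave no
  boundary terms.
\<close>

lemma ft_profile2_eq:
  assumes "z \<noteq> 0"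
  shows "ft (\<lambda>k. complex_of_real (\<bar>k\<bar> - \<mu>) * airy_profile \<mu> s k) z = - (complex_of_real (z\<^sup>2) * ft (airy_profile \<mu> s) z)"
  using airy_sym_expansion[OF assms, of \<mu> s 2] assms
  unfolding ft_profile ft_profile2
  by (simp add: numeral_2_eq_2 airy_boundary_vanishes[unfolded One_nat_def])

text \<open>
  One more integration by parts than the number of displayed terms gains the last power of \<open>1 / z\<close>.
\<close>

lemma ft_profile_remainder:
  obtains C where "C \<ge> 0" "\<And>z. z \<noteq> 0 \<Longrightarrow>
    cmod (ft (airy_profile \<mu> s) z - (\<Sum>m<M. (\<i> / z) ^ Suc m * airy_boundary \<mu> s m)) \<le> C / \<bar>z\<bar> ^ Suc M"
proof -
  obtain C where C: "C \<ge> 0" "\<And>z. cmod (airy_sym \<mu> s (Suc M) z) \<le> C" using airy_sym_bound by blast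
  show ?thesis
  proof (rule that[of "cmod (airy_boundary \<mu> s M) + C"])
    fix z :: real assume z: "z \<noteq> 0"
    have "ft (airy_profile \<mu> s) z - (\<Sum>m<M. (\<i> / z) ^ Suc m * airy_boundary \<mu> s m) =
       (\<i> / z) ^ Suc M * (airy_boundary \<mu> s M + airy_sym \<mu> s (Suc M) z)"
      unfolding ft_profile airy_sym_expansion[OF z, of \<mu> s "Suc M"] by (simp add: distrib_left)
    then have "cmod (ft (airy_profile \<mu> s) z - (\<Sum>m<M. (\<i> / z) ^ Suc m * airy_boundary \<mu> s m)) =
       cmod (airy_boundary \<mu> s M + airy_sym \<mu> s (Suc M) z) / \<bar>z\<bar> ^ Suc M"
      by (simp only: norm_mult norm_power norm_divide norm_ii norm_of_real) (simp add: power_divide del: power_Suc)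
    also have "\<dots> \<le> (cmod (airy_boundary \<mu> s M) + C) / \<bar>z\<bar> ^ Suc M"
      using C(2)[of z] norm_triangle_ineq[of "airy_boundary \<mu> s M" "airy_sym \<mu> s (Suc M) z"]
      by (intro divide_right_mono) auto
    finally show "cmod (ft (airy_profile \<mu> s) z - (\<Sum>m<M. (\<i> / z) ^ Suc m * airy_boundary \<mu> s m)) \<le> (cmod (airy_boundary \<mu> s M) + C) / \<bar>z\<bar> ^ Suc M" .
  qed (use C in simp)
qed

text \<open>
  The first three terms of the expansion vanish, so the transform is \<open>O (z\<^bsup>-4\<^esup>)\<close>. This is what makes
  \<open>z\<^sup>2\<close> times the transform both integrable and square integrable.
\<close>

lemma ft_profile_decay:
  obtains B where "\<And>z. cmod (ft (airy_profile \<mu> s) z) \<le> B * inverse (1 + z\<^sup>2)"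
    "\<And>z. cmod (complex_of_real (z\<^sup>2) * ft (airy_profile \<mu> s) z) \<le> B * inverse (1 + z\<^sup>2)"
proof -
  obtain C where C: "C \<ge> 0" "\<And>z. z \<noteq> 0 \<Longrightarrow>
    cmod (ft (airy_profile \<mu> s) z - (\<Sum>m<3. (\<i> / z) ^ Suc m * airy_boundary \<mu> s m)) \<le> C / \<bar>z\<bar> ^ Suc 3"
    using ft_profile_remainder by blast
  have C4: "cmod (ft (airy_profile \<mu> s) z) \<le> C / z ^ 4" if "z \<noteq> 0" for z
    using C(2)[OF that] by (simp add: numeral_3_eq_3 airy_boundary_vanishes[unfolded One_nat_def numeral_2_eq_2] power4_eq_xxxx mult.assoc abs_mult)
  obtain D where D: "D \<ge> 0" "\<And>z. cmod (ft (airy_profile \<mu> s) z) \<le> D"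
    unfolding ft_profile using airy_sym_bound by blast
  define E where "E = max C D"
  have E: "E \<ge> C" "E \<ge> D" "E \<ge> 0" using C D by (auto simp: E_def)
  have pos: "1 + z\<^sup>2 > 0" for z :: real by (simp add: add_pos_nonneg)
  have main: "cmod (ft (airy_profile \<mu> s) z) \<le> 2 * E * inverse (1 + z\<^sup>2) \<and>
      z\<^sup>2 * cmod (ft (airy_profile \<mu> s) z) \<le> 2 * E * inverse (1 + z\<^sup>2)" for z
  proof (cases "z\<^sup>2 \<ge> 1")
    case True
    then have z: "z \<noteq> 0" by auto
    then have zpos: "z\<^sup>2 > 0" by simp
    let ?f = "cmod (ft (airy_profile \<mu> s) z)"
    have "z\<^sup>2 * ?f \<le> z\<^sup>2 * (C / z ^ 4)" using C4[OF z] by (intro mult_left_mono) auto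
    also have "\<dots> = C / z\<^sup>2" using z by (simp add: power4_eq_xxxx power2_eq_square)
    also have "\<dots> \<le> E / z\<^sup>2" using E by (intro divide_right_mono) auto
    also have "\<dots> \<le> 2 * E * inverse (1 + z\<^sup>2)"
    proof -
      have "E * (1 + z\<^sup>2) \<le> E * (2 * z\<^sup>2)" using True E by (intro mult_left_mono) auto
      then show ?thesis using zpos pos[of z] by (simp add: field_simps)
    qed
    finally have 1: "z\<^sup>2 * ?f \<le> 2 * E * inverse (1 + z\<^sup>2)" .
    have "1 * ?f \<le> z\<^sup>2 * ?f" using True by (intro mult_right_mono) auto
    then show ?thesis using 1 by simp
  next
    case False
    let ?f = "cmod (ft (airy_profile \<mu> s) z)"
    have "?f \<le> E" using D(2)[of z] E by linarith
    also have "E * (1 + z\<^sup>2) \<le> E * 2" using False E by (intro mult_left_mono) auto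
    then have "E \<le> 2 * E * inverse (1 + z\<^sup>2)" using pos[of z] by (simp add: field_simps)
    finally have 1: "?f \<le> 2 * E * inverse (1 + z\<^sup>2)" .
    have "z\<^sup>2 * ?f \<le> 1 * ?f" using False by (intro mult_right_mono) auto
    then show ?thesis using 1 by simp
  qed
  show ?thesis by (rule that[of "2 * E"]) (use main in \<open>auto simp: norm_mult norm_power\<close>)
qed

lemma ft_profile_integrable:
  shows "integrable lborel (ft (airy_profile \<mu> s))" "square_integrable (ft (airy_profile \<mu> s))"
    "integrable lborel (\<lambda>z. complex_of_real (z\<^sup>2) * ft (airy_profile \<mu> s) z)"
    "square_integrable (\<lambda>z. complex_of_real (z\<^sup>2) * ft (airy_profile \<mu> s) z)"
proof -
  obtain B where B: "\<And>z. cmod (ft (airy_profile \<mu> s) z) \<le> B * inverse (1 + z\<^sup>2)"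
    "\<And>z. cmod (complex_of_real (z\<^sup>2) * ft (airy_profile \<mu> s) z) \<le> B * inverse (1 + z\<^sup>2)"
    using ft_profile_decay by blast
  have [measurable]: "ft (airy_profile \<mu> s) \<in> borel_measurable borel"
    by (rule ft_measurable) (rule integrable_profile)
  show "integrable lborel (ft (airy_profile \<mu> s))" "square_integrable (ft (airy_profile \<mu> s))"
    by (rule integrable_of_quadratic_decay[OF _ B(1)]; measurable)+
  show "integrable lborel (\<lambda>z. complex_of_real (z\<^sup>2) * ft (airy_profile \<mu> s) z)"
    "square_integrable (\<lambda>z. complex_of_real (z\<^sup>2) * ft (airy_profile \<mu> s) z)"
    by (rule integrable_of_quadratic_decay[OF _ B(2)]; measurable)+
qed

text \<open>
  Inversion returns the reflected profile, and reflection multiplies by the parity sign.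
\<close>

lemma ft_ft_profile: "ft (ft (airy_profile \<mu> s)) k = complex_of_real (2 * pi * s) * airy_profile \<mu> s k"
proof -
  obtain B where "\<And>k. cmod (airy_profile \<mu> s k) \<le> B" using profile_bound by metis
  from ft_inversion[OF integrable_profile ft_profile_integrable(1) continuous_profile this, of "- k"]
  show ?thesis by (simp add: profile_reflect)
qed

text \<open>
  By \<open>ft_profile2_eq\<close>, \<open>z\<^sup>2\<close> times the transform of the profile is minus the transform of
  \<open>(\<bar>k\<bar> - \<mu>)\<close> times the profile, to which inversion applies as well.
\<close>

lemma ft_square_ft_profile:
  "ft (\<lambda>z. complex_of_real (z\<^sup>2) * ft (airy_profile \<mu> s) z) k = complex_of_real (\<mu> - \<bar>k\<bar>) * ft (ft (airy_profile \<mu> s)) k"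
proof -
  define K where "K k = complex_of_real (\<bar>k\<bar> - \<mu>) * airy_profile \<mu> s k" for k
  have K: "integrable lborel K" unfolding K_def[abs_def] by (rule integrable_profile2)
  let ?F = "\<lambda>z. complex_of_real (z\<^sup>2) * ft (airy_profile \<mu> s) z"
  have [measurable]: "ft (airy_profile \<mu> s) \<in> borel_measurable borel" "ft K \<in> borel_measurable borel"
    by (rule ft_measurable, rule integrable_profile, rule ft_measurable, rule K)
  have AE: "AE z in lborel. ft K z = - ?F z"
    using AE_nonzero unfolding K_def[abs_def] by eventually_elim (rule ft_profile2_eq)
  have ftK: "integrable lborel (ft K)"
    using ft_profile_integrable(3) AE by (subst integrable_cong_AE[where g = "\<lambda>z. - ?F z"]) auto
  obtain B where B: "\<And>k. cmod (K k) \<le> B" unfolding K_def using profile_bound by metis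
  have "continuous_on UNIV K" unfolding K_def[abs_def] by (intro continuous_intros continuous_profile)
  from ft_inversion[OF K ftK this B, of "- k"] have "ft (ft K) k = 2 * pi * K (- k)" by simp
  moreover have "ft (ft K) k = - ft ?F k"
  proof -
    have "ft (ft K) k = ft (\<lambda>z. (- 1) * ?F z) k"
      unfolding ft_def[of _ k] by (rule integral_cong_AE) (use AE in auto)
    then show ?thesis unfolding ft_cmult by simp
  qed
  ultimately have "ft ?F k = - (2 * pi * K (- k))" by (simp add: minus_equation_iff)
  then show ?thesis by (simp add: ft_ft_profile K_def profile_reflect algebra_simps)
qed

text \<open>
  For \<open>F\<close> the transform of the profile, \<open>u = \<mu> F - z\<^sup>2 F\<close> has transform
  \<open>\<mu> g - (\<mu> - \<bar>k\<bar>) g = \<bar>k\<bar> g\<close>, where \<open>g\<close> is the transform of \<open>F\<close>. So \<open>u\<close> is the value of the multiplier at \<open>F\<close>.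
\<close>

lemma eigenfunction_of_parity: "H_eigenfunction \<mu> (ft (airy_profile \<mu> s))"
proof -
  let ?f = "ft (airy_profile \<mu> s)" and ?c = "complex_of_real (1 / sqrt (2 * pi))"
  note int = ft_profile_integrable
  define u where "u z = complex_of_real \<mu> * ?f z - complex_of_real (z\<^sup>2) * ?f z" for z
  have mf: "integrable lborel (\<lambda>z. complex_of_real \<mu> * ?f z)" using int(1) by simp
  have u: "integrable lborel u"
    unfolding u_def[abs_def] by (intro Bochner_Integration.integrable_diff mf int)
  have u2: "square_integrable u"
  proof -
    have [measurable]: "?f \<in> borel_measurable borel" using int(2) by (simp add: square_integrable_def)
    have "integrable lborel (\<lambda>z. 2 * (cmod (complex_of_real \<mu> * ?f z))\<^sup>2 + 2 * (cmod (complex_of_real (z\<^sup>2) * ?f z))\<^sup>2)"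
      using square_integrable_cmult[OF int(2)] int(4)
      by (intro Bochner_Integration.integrable_add integrable_mult_right) (auto simp: square_integrable_def)
    then have "integrable lborel (\<lambda>z. (cmod (u z))\<^sup>2)"
    proof (rule Bochner_Integration.integrable_bound)
      show "AE z in lborel. norm ((cmod (u z))\<^sup>2) \<le> norm (2 * (cmod (complex_of_real \<mu> * ?f z))\<^sup>2 + 2 * (cmod (complex_of_real (z\<^sup>2) * ?f z))\<^sup>2)"
        unfolding u_def using norm_add_square_le[of "complex_of_real \<mu> * ?f _" "- (complex_of_real (_\<^sup>2) * ?f _)"]
        by (intro AE_I2) (simp only: norm_minus_cancel add_uminus_conv_diff real_norm_def abs_of_nonneg zero_le_power2 add_nonneg_nonneg mult_nonneg_nonneg zero_le_numeral)
    qed (simp add: u_def[abs_def])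
    then show ?thesis unfolding square_integrable_def u_def[abs_def] by simp
  qed
  have "ft u k = complex_of_real \<bar>k\<bar> * ft ?f k" for k
    unfolding u_def[abs_def] using ft_diff[OF mf int(3), of k] unfolding ft_cmult ft_square_ft_profile
    by (simp add: algebra_simps)
  then have "(\<lambda>k. ?c * ft u k) = (\<lambda>k. complex_of_real \<bar>k\<bar> * (?c * ft ?f k))" by (simp add: fun_eq_iff)
  then have "L2_fourier u (\<lambda>k. complex_of_real \<bar>k\<bar> * (?c * ft ?f k))"
    using L2_fourier_ft[OF u u2] by simp
  then have "fourier_multiplier (\<lambda>k. complex_of_real \<bar>k\<bar>) ?f u"
    unfolding fourier_multiplier_def using L2_fourier_ft[OF int(1,2)] by blast
  then have "H_op ?f (\<lambda>z. complex_of_real \<mu> * ?f z)"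
    unfolding H_op_def using int square_integrable_cmult[OF int(2)]
    by (intro exI[of _ u]) (auto simp: u_def)
  moreover have "\<not> (AE z in lborel. ?f z = 0)"
  proof
    assume "AE z in lborel. ?f z = 0"
    then have "?f z = 0" for z
      by (rule continuous_AE_0_imp_0[rotated]) (intro continuous_ft integrable_profile)
    then have "ft ?f k = 0" for k by (simp add: ft_def)
    then have "complex_of_real (2 * pi * s) * airy_profile \<mu> s (max \<mu> 0) = 0"
      unfolding ft_ft_profile by blast
    then have "airy_profile \<mu> s (max \<mu> 0) = 0"
      using parity by (auto simp: airy_parity_def)
    then show False using airy_nonzero_of_nonneg(1)[of "max \<mu> 0 - \<mu>"] by (simp add: airy_profile_def)
  qed
  ultimately show ?thesis by (simp add: H_eigenfunction_def)
qed

end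

theorem H_eigenvalues_eq: "H_eigenvalues = {\<mu>. airy (- \<mu>) = 0 \<or> deriv airy (- \<mu>) = 0}"
proof (intro set_eqI iffI)
  fix \<mu> assume "\<mu> \<in> H_eigenvalues"
  then obtain f where "H_eigenfunction \<mu> f" by (auto simp: H_eigenvalues_def)
  then obtain a s where "airy_parity \<mu> s" using eigenfunction_ft_profile by metis
  then show "\<mu> \<in> {\<mu>. airy (- \<mu>) = 0 \<or> deriv airy (- \<mu>) = 0}" by (auto simp: airy_parity_def)
next
  fix \<mu> assume "\<mu> \<in> {\<mu>. airy (- \<mu>) = 0 \<or> deriv airy (- \<mu>) = 0}"
  then obtain s where "airy_parity \<mu> s" by (auto simp: airy_parity_def)
  then show "\<mu> \<in> H_eigenvalues" unfolding H_eigenvalues_def using eigenfunction_of_parity by blast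
qed

section \<open>Normalization\<close>

text \<open>
  \<open>x Ai\<^sup>2 - Ai'\<^sup>2\<close> has derivative \<open>Ai\<^sup>2\<close> and tends to \<open>0\<close> at \<open>+\<infinity>\<close>.
\<close>

lemma nn_integral_airy_square:
  "(\<integral>\<^sup>+k. ennreal ((airy (k - \<mu>))\<^sup>2) * indicator {0..} k \<partial>lborel) =
    ennreal (\<mu> * (airy (- \<mu>))\<^sup>2 + (deriv airy (- \<mu>))\<^sup>2)"
proof -
  define F where "F k = (k - \<mu>) * (airy (k - \<mu>))\<^sup>2 - (deriv airy (k - \<mu>))\<^sup>2" for k
  have dF: "(F has_real_derivative (airy (k - \<mu>))\<^sup>2) (at k)" for k
  proof -
    have "((\<lambda>x. x * (airy x)\<^sup>2 - (deriv airy x)\<^sup>2) has_real_derivative (airy x)\<^sup>2) (at x)" for x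
      by (auto intro!: derivative_eq_intros airy_deriv)
    from this[of "k + - \<mu>"] show ?thesis unfolding DERIV_shift F_def[abs_def] by simp
  qed
  have "((\<lambda>x. (x ^ 1 * airy x) * (x ^ 0 * airy x) - (x ^ 0 * deriv airy x) * (x ^ 0 * deriv airy x)) \<longlongrightarrow> 0 * 0 - 0 * 0) at_top"
    by (intro tendsto_diff tendsto_mult airy_decay)
  then have "((\<lambda>x. x * (airy x)\<^sup>2 - (deriv airy x)\<^sup>2) \<longlongrightarrow> 0) at_top" by (simp add: power2_eq_square mult.assoc)
  moreover have "filterlim (\<lambda>k. k - \<mu>) at_top at_top" by real_asymp
  ultimately have "(F \<longlongrightarrow> 0) at_top" unfolding F_def[abs_def] by (rule filterlim_compose)
  then have "(\<integral>\<^sup>+k. ennreal ((airy (k - \<mu>))\<^sup>2) * indicator {0..} k \<partial>lborel) = ennreal (0 - F 0)"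
    by (intro nn_integral_FTC_atLeast dF)
       (auto intro!: borel_measurable_continuous_onI continuous_intros continuous_on_compose2[OF continuous_airy(1)[of UNIV]])
  then show ?thesis by (simp add: F_def add.commute)
qed

lemma airy_square_pos: "airy_parity \<mu> s \<Longrightarrow> \<mu> * (airy (- \<mu>))\<^sup>2 + (deriv airy (- \<mu>))\<^sup>2 > 0"
proof -
  assume "airy_parity \<mu> s"
  then have or: "deriv airy (- \<mu>) = 0 \<or> airy (- \<mu>) = 0" by (auto simp: airy_parity_def)
  have "\<mu> > 0" using or airy_nonzero_of_nonneg[of "- \<mu>"] by (cases "\<mu> > 0") auto
  then show ?thesis using or airy_no_double_zero[of "- \<mu>"] by (auto intro!: mult_pos_pos)
qed

lemma integral_profile_square:
  assumes parity: "airy_parity \<mu> s"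
  shows "(LINT k|lborel. (cmod (airy_profile \<mu> s k))\<^sup>2) = 2 * (\<mu> * (airy (- \<mu>))\<^sup>2 + (deriv airy (- \<mu>))\<^sup>2)"
proof -
  let ?J = "\<mu> * (airy (- \<mu>))\<^sup>2 + (deriv airy (- \<mu>))\<^sup>2"
  let ?h = "\<lambda>k. ennreal ((airy (k - \<mu>))\<^sup>2) * indicator {0..} k"
  have s: "s\<^sup>2 = 1" using parity by (auto simp: airy_parity_def)
  have [measurable]: "airy \<in> borel_measurable borel" by (intro borel_measurable_continuous_onI continuous_airy)
  have [measurable]: "airy_profile \<mu> s \<in> borel_measurable borel" by (rule profile_measurable[OF parity])
  have J: "?J > 0" by (rule airy_square_pos[OF parity])
  have "(\<integral>\<^sup>+k. ennreal ((cmod (airy_profile \<mu> s k))\<^sup>2) \<partial>lborel) = (\<integral>\<^sup>+k. ?h k + ?h (- k) \<partial>lborel)"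
  proof (rule nn_integral_cong_AE)
    show "AE k in lborel. ennreal ((cmod (airy_profile \<mu> s k))\<^sup>2) = ?h k + ?h (- k)"
      using AE_nonzero by eventually_elim (auto simp: airy_profile_def indicator_def abs_mult power_mult_distrib s)
  qed
  also have "\<dots> = (\<integral>\<^sup>+k. ?h k \<partial>lborel) + (\<integral>\<^sup>+k. ?h (- k) \<partial>lborel)"
    by (rule nn_integral_add) measurable
  also have "(\<integral>\<^sup>+k. ?h (- k) \<partial>lborel) = (\<integral>\<^sup>+k. ?h k \<partial>lborel)"
    using nn_integral_real_affine[of ?h "- 1" 0] by simp
  also have "(\<integral>\<^sup>+k. ?h k \<partial>lborel) + (\<integral>\<^sup>+k. ?h k \<partial>lborel) = ennreal (2 * ?J)"
    unfolding nn_integral_airy_square using J by (simp flip: ennreal_plus)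
  finally show ?thesis using J by (subst integral_eq_nn_integral) auto
qed

text \<open>
  An eigenfunction and a multiple of the transform of a profile have the same transform, so they
  agree almost everywhere, and everywhere by continuity. Plancherel's identity for the profile turns the
  normalization into a condition on the constant.
\<close>

lemma normalized_eigenfunction:
  assumes eig: "H_eigenfunction \<mu> \<phi>" and norm: "L2_normalized \<phi>" and cont: "continuous_on UNIV \<phi>"
  obtains a s where "airy_parity \<mu> s" "\<And>z. \<phi> z = a * ft (airy_profile \<mu> s) z"
    "(cmod a)\<^sup>2 * (4 * pi * (\<mu> * (airy (- \<mu>))\<^sup>2 + (deriv airy (- \<mu>))\<^sup>2)) = 1"
proof -
  obtain b s where par: "airy_parity \<mu> s" and b: "\<And>k. ft \<phi> k = b * airy_profile \<mu> s k"
    using eigenfunction_ft_profile[OF eig] by metis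
  let ?F = "ft (airy_profile \<mu> s)"
  note int = eigenfunction_integrable(3)[OF eig] and intF = ft_profile_integrable(1)[OF par]
  have s: "s * s = 1" using par by (auto simp: airy_parity_def)
  \<comment> \<open>the transform of the transform of a profile is \<open>2 \<pi> s\<close> times it, and \<open>1 / s = s\<close>\<close>
  define a where "a = b * complex_of_real (s / (2 * pi))"
  have "ft (\<lambda>z. \<phi> z - a * ?F z) k = 0" for k
  proof -
    have "ft (\<lambda>z. \<phi> z - a * ?F z) k = ft \<phi> k - a * ft ?F k"
      using ft_diff[OF int integrable_mult_right[of a, OF intF], of k] unfolding ft_cmult by simp
    also have "a * ft ?F k = b * complex_of_real (s * s) * airy_profile \<mu> s k"
      unfolding a_def ft_ft_profile[OF par] by simp
    finally show ?thesis using b by (simp add: s)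
  qed
  then have "AE z in lborel. \<phi> z - a * ?F z = 0"
    by (intro ft_eq_0_imp_AE_0) (use int intF in simp)
  moreover have "continuous_on UNIV (\<lambda>z. \<phi> z - a * ?F z)"
    by (intro continuous_intros cont continuous_ft integrable_profile[OF par])
  ultimately have \<phi>: "\<phi> z = a * ?F z" for z
    using continuous_AE_0_imp_0[of "\<lambda>z. \<phi> z - a * ?F z" z] by simp
  obtain B where "\<And>k. cmod (airy_profile \<mu> s k) \<le> B" using profile_bound[OF par] by metis
  note P = ft_plancherel[OF integrable_profile[OF par] intF continuous_profile[OF par] this]
  have "1 = (LINT z|lborel. (cmod a)\<^sup>2 * (cmod (?F z))\<^sup>2)"
    using norm by (simp add: L2_normalized_def \<phi> norm_mult power_mult_distrib)
  also have "\<dots> = (cmod a)\<^sup>2 * (4 * pi * (\<mu> * (airy (- \<mu>))\<^sup>2 + (deriv airy (- \<mu>))\<^sup>2))"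
    unfolding integral_mult_right_zero P integral_profile_square[OF par] by simp
  finally show ?thesis using that[OF par \<phi>] by simp
qed

section \<open>Interlacing zeros and the order of the eigenvalues\<close>

lemma deriv_airy_zero_between:
  assumes "airy (- x) = 0" "airy (- y) = 0" "x < y"
  obtains t where "x < t" "t < y" "deriv airy (- t) = 0"
proof -
  have "continuous_on {- y..- x} airy"
    by (rule continuous_airy)
  moreover have "airy differentiable (at t)" for t
    using airy_deriv(1) by (auto simp: real_differentiable_def)
  ultimately obtain z where z: "- y < z" "z < - x" "DERIV airy z :> 0"
    using Rolle[of "- y" "- x" airy] assms by auto
  have "deriv airy z = 0" using z(3) by (rule DERIV_imp_deriv)
  then show ?thesis using z by (intro that[of "- z"]) auto
qed

text \<open>
  Rolle's theorem for \<open>Ai'\<close>, whose derivative \<open>x Ai x\<close> vanishes for \<open>x < 0\<close> only at zeros of \<open>Ai\<close>; and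
  all zeros of \<open>Ai'\<close> are negative.
\<close>

lemma airy_zero_between:
  assumes "deriv airy (- x) = 0" "deriv airy (- y) = 0" "x < y"
  obtains t where "x < t" "t < y" "airy (- t) = 0"
proof -
  have "continuous_on {- y..- x} (deriv airy)"
    by (rule continuous_airy)
  moreover have "deriv airy differentiable (at t)" for t
    using airy_deriv(2) by (auto simp: real_differentiable_def)
  ultimately obtain z where z: "- y < z" "z < - x" "DERIV (deriv airy) z :> 0"
    using Rolle[of "- y" "- x" "deriv airy"] assms by auto
  have "z * airy z = 0" using DERIV_unique[OF airy_deriv(2) z(3)] .
  moreover have "- x < 0" using assms(1) airy_nonzero_of_nonneg(2)[of "- x"] by linarith
  ultimately have "airy z = 0" using z by auto
  then show ?thesis using z by (intro that[of "- z"]) auto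
qed

text \<open>
  Since \<open>Ai 0 > 0\<close>, the slope is positive somewhere between a zero and \<open>0\<close>, but it is negative at \<open>0\<close>.
\<close>

lemma deriv_airy_zero_before:
  assumes "airy (- x) = 0"
  obtains t where "t < x" "deriv airy (- t) = 0"
proof -
  have x: "- x < 0" using assms airy_nonzero_of_nonneg(1)[of "- x"] by linarith
  have A0: "airy 0 > 0" using airy_at_0_pos by (simp add: airy_eq subdominant_0)
  obtain z where z: "- x < z" "z < 0" "airy 0 - airy (- x) = (0 - - x) * deriv airy z"
    using MVT2[OF x, of airy "deriv airy"] airy_deriv(1) by auto
  have "deriv airy z > 0" using z x A0 assms by (simp add: zero_less_mult_iff)
  moreover have "deriv airy 0 < 0"
    using airy_mult_deriv_neg[of 0] A0 by (simp add: mult_less_0_iff)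
  moreover have "continuous_on {z..0} (deriv airy)"
    by (rule continuous_airy)
  ultimately obtain w where "z \<le> w" "deriv airy w = 0"
    using IVT2'[of "deriv airy" 0 0 z] z by auto
  then show ?thesis using z by (intro that[of "- w"]) auto
qed

lemma kth_largest_enum:
  fixes e :: "nat \<Rightarrow> real"
  assumes mono: "strict_mono_on {1..} e" and k: "k \<ge> (1::nat)"
    and Z: "Z = (\<lambda>j. - e j) ` {1..}"
  shows "kth_largest Z k = - e k"
proof -
  have card: "card {y \<in> Z. - e j \<le> y} = j" if "j \<ge> 1" for j
  proof -
    have "{y \<in> Z. - e j \<le> y} = (\<lambda>j. - e j) ` {1..j}"
      unfolding Z using strict_mono_on_leD[OF mono] strict_mono_on_less_eq[OF mono] that by force
    moreover have "inj_on (\<lambda>j. - e j) {1..j}"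
      using strict_mono_on_eqD[OF mono] by (auto simp: inj_on_def)
    ultimately show ?thesis by (simp add: card_image)
  qed
  show ?thesis
    unfolding kth_largest_def
  proof (rule the_equality)
    show "- e k \<in> Z \<and> card {y \<in> Z. - e k \<le> y} = k" using k card Z by auto
    fix x assume "x \<in> Z \<and> card {y \<in> Z. x \<le> y} = k"
    then show "x = - e k" using card unfolding Z by auto
  qed
qed

text \<open>
  Consecutive eigenvalues have no further eigenvalue between them, so by interlacing they cannot be
  of the same kind; and the smallest one cannot come from a zero of \<open>Ai\<close>, because a zero of \<open>Ai'\<close> lies
  to the right of every zero of \<open>Ai\<close>.
\<close>

lemma eigenvalue_pattern:
  fixes ev :: "nat \<Rightarrow> real"
  assumes mono: "strict_mono_on {1..} ev"
    and all: "ev ` {1..} = {\<mu>. airy (- \<mu>) = 0 \<or> deriv airy (- \<mu>) = 0}"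
    and n: "n \<ge> (1::nat)"
  shows "if odd n then deriv airy (- ev n) = 0 else airy (- ev n) = 0"
  using n
proof (induction n rule: nat_induct_at_least)
  have E: "airy (- ev m) = 0 \<or> deriv airy (- ev m) = 0" if "m \<ge> 1" for m
    using all that by auto
  have enum: "\<exists>m\<ge>1. t = ev m" if "airy (- t) = 0 \<or> deriv airy (- t) = 0" for t
  proof -
    have "t \<in> ev ` {1..}" unfolding all using that by simp
    then show ?thesis by auto
  qed
  {
    case base
    show ?case
    proof (rule ccontr)
      assume "\<not> ?thesis"
      then have "airy (- ev 1) = 0" using E[of 1] by auto
      then obtain t where t: "t < ev 1" "deriv airy (- t) = 0" by (rule deriv_airy_zero_before)
      then obtain m where "m \<ge> 1" "t = ev m" using enum[OF disjI2[OF t(2)]] by blast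
      then show False using t strict_mono_on_leD[OF mono, of 1 m] by auto
    qed
  next
    case (Suc n)
    have gap: False if t: "ev n < t" "t < ev (Suc n)" "airy (- t) = 0 \<or> deriv airy (- t) = 0" for t
    proof -
      obtain m where m: "m \<ge> 1" "t = ev m" using enum[OF t(3)] by blast
      have n: "n \<ge> 1" by (rule Suc.hyps)
      show False
      proof (cases "m \<le> n")
        case True
        then have "ev m \<le> ev n" using m n by (intro strict_mono_on_leD[OF mono]) auto
        then show False using t(1) m by simp
      next
        case False
        then have "ev (Suc n) \<le> ev m" using m n by (intro strict_mono_on_leD[OF mono]) auto
        then show False using t(2) m by simp
      qed
    qed
    have less: "ev n < ev (Suc n)" using mono Suc.hyps by (auto simp: strict_mono_on_def)
    show ?case
    proof (rule ccontr)
      assume no: "\<not> ?case"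
      show False
      proof (cases "odd n")
        case True
        then have "deriv airy (- ev n) = 0" "deriv airy (- ev (Suc n)) = 0"
          using Suc.IH no E[of "Suc n"] by auto
        then show False using airy_zero_between less gap by metis
      next
        case False
        then have "airy (- ev n) = 0" "airy (- ev (Suc n)) = 0"
          using Suc.IH no E[of "Suc n"] by auto
        then show False using deriv_airy_zero_between less gap by metis
      qed
    qed
  }
qed

section \<open>Asymptotic expansion\<close>

lemma i_over_power:
  "(\<i> / complex_of_real z) ^ (2 * j) = complex_of_real ((- 1) ^ j / z ^ (2 * j))"
  by (simp only: power_mult power_divide power2_i of_real_divide of_real_power of_real_minus of_real_1)

text \<open>
  For an even profile only the odd derivatives jump, and \<open>Ai' (- \<mu>) = 0\<close> removes the \<open>q\<close>-part of
  \<open>Ai\<^bsup>(m)\<^esup> (- \<mu>)\<close>. The sum on the right starts at \<open>j = 2\<close> because the term for \<open>j = 1\<close> is zero.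
\<close>

lemma even_expansion_sum:
  assumes crit: "deriv airy (- \<mu>) = 0" and N: "N \<ge> (1::nat)"
  shows "(\<Sum>m<2 * N + 1. (\<i> / complex_of_real z) ^ Suc m * airy_boundary \<mu> 1 m) =
    complex_of_real (2 * airy (- \<mu>) * (\<Sum>j=2..N. (- 1) ^ j * poly (airy_p (2 * j - 1)) (- \<mu>) / z ^ (2 * j)))"
  using N
proof (induction N rule: nat_induct_at_least)
  case base
  have "airy_parity \<mu> 1" using crit by (simp add: airy_parity_def)
  then show ?case using airy_boundary_vanishes[of \<mu> 1] by (simp add: eval_nat_numeral)
next
  case (Suc N)
  have odd: "airy_boundary \<mu> 1 (2 * N + 1) = complex_of_real (2 * airy (- \<mu>) * poly (airy_p (2 * Suc N - 1)) (- \<mu>))"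
    by (simp add: airy_boundary_def airy_nth_def crit)
  have even: "airy_boundary \<mu> 1 (2 * N + 2) = 0" by (simp add: airy_boundary_def)
  have "2 * Suc N + 1 = Suc (Suc (2 * N + 1))" by simp
  then have "(\<Sum>m<2 * Suc N + 1. (\<i> / complex_of_real z) ^ Suc m * airy_boundary \<mu> 1 m) =
      (\<Sum>m<2 * N + 1. (\<i> / complex_of_real z) ^ Suc m * airy_boundary \<mu> 1 m)
      + (\<i> / complex_of_real z) ^ (2 * Suc N) * airy_boundary \<mu> 1 (2 * N + 1)"
    using even by (simp del: power_Suc)
  also have "(\<i> / complex_of_real z) ^ (2 * Suc N) * airy_boundary \<mu> 1 (2 * N + 1) =
      complex_of_real (2 * airy (- \<mu>) * ((- 1) ^ Suc N * poly (airy_p (2 * Suc N - 1)) (- \<mu>) / z ^ (2 * Suc N)))"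
    unfolding odd i_over_power of_real_mult[symmetric] by simp
  finally show ?case
    using Suc unfolding of_real_add[symmetric]
    by (subst sum.cl_ivl_Suc) (simp add: distrib_left del: power_Suc airy_p.simps)
qed

text \<open>
  For an odd profile only the even derivatives jump, and \<open>Ai (- \<mu>) = 0\<close> removes the \<open>p\<close>-part.
\<close>

lemma odd_expansion_sum:
  assumes zero: "airy (- \<mu>) = 0" and N: "N \<ge> (1::nat)"
  shows "(\<Sum>m<2 * N + 2. (\<i> / complex_of_real z) ^ Suc m * airy_boundary \<mu> (- 1) m) =
    \<i> * complex_of_real (2 * deriv airy (- \<mu>) * (\<Sum>j=2..N. (- 1) ^ j * poly (airy_q (2 * j)) (- \<mu>) / z ^ (2 * j + 1)))"
  using N
proof (induction N rule: nat_induct_at_least)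
  case base
  have "airy_parity \<mu> (- 1)" using zero by (simp add: airy_parity_def)
  moreover have "airy_boundary \<mu> (- 1) 3 = 0" by (simp add: airy_boundary_def)
  ultimately show ?case using airy_boundary_vanishes[of \<mu> "- 1"] by (simp add: eval_nat_numeral)
next
  case (Suc N)
  have even: "airy_boundary \<mu> (- 1) (2 * N + 2) = complex_of_real (2 * deriv airy (- \<mu>) * poly (airy_q (2 * Suc N)) (- \<mu>))"
    by (simp add: airy_boundary_def airy_nth_def zero)
  have odd: "airy_boundary \<mu> (- 1) (Suc (2 * N + 2)) = 0" by (simp add: airy_boundary_def)
  have len: "2 * Suc N + 2 = Suc (Suc (2 * N + 2))" and exponent: "2 * N + 2 = 2 * Suc N" by simp_all
  have "(\<Sum>m<2 * Suc N + 2. (\<i> / complex_of_real z) ^ Suc m * airy_boundary \<mu> (- 1) m) =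
      (\<Sum>m<2 * N + 2. (\<i> / complex_of_real z) ^ Suc m * airy_boundary \<mu> (- 1) m)
      + (\<i> / complex_of_real z) ^ Suc (2 * N + 2) * airy_boundary \<mu> (- 1) (2 * N + 2)"
    unfolding len sum.lessThan_Suc[of _ "Suc (2 * N + 2)"] sum.lessThan_Suc[of _ "2 * N + 2"] odd
    by (simp only: mult_zero_right add_0_right)
  also have "(\<i> / complex_of_real z) ^ Suc (2 * N + 2) * airy_boundary \<mu> (- 1) (2 * N + 2) =
      \<i> * complex_of_real (2 * deriv airy (- \<mu>) * ((- 1) ^ Suc N * poly (airy_q (2 * Suc N)) (- \<mu>) / z ^ (2 * Suc N + 1)))"
    unfolding even power_Suc[of _ "2 * N + 2"] unfolding exponent i_over_power by simp
  finally show ?case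
    using Suc by (subst sum.cl_ivl_Suc) (simp add: distrib_left del: power_Suc airy_q.simps)
qed

lemma bigo_of_bound:
  fixes f :: "real \<Rightarrow> complex"
  assumes "\<And>z. z \<noteq> 0 \<Longrightarrow> cmod (f z) \<le> C / \<bar>z\<bar> ^ n"
  shows "f \<in> O[at_infinity](\<lambda>z. complex_of_real (1 / z ^ n))"
proof (rule bigoI[of _ C])
  show "\<forall>\<^sub>F z in at_infinity. norm (f z) \<le> C * norm (complex_of_real (1 / z ^ n))"
    unfolding eventually_at_infinity using assms
    by (intro exI[of _ 1] allI impI) (auto simp: norm_divide norm_power power_abs)
qed

text \<open>
  The jumps carry the factor \<open>2 Ai (- \<mu>)\<close>; with the normalizing constant \<open>a\<close> its modulus is
  \<open>(2 \<pi>)\<^bsup>-1/2\<^esup> (2 / \<mu>)\<^bsup>1/2\<^esup>\<close>, so what remains is the phase \<open>c\<close>. Expanding up to the derivative of order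
  \<open>2 N\<close>, whose jump is zero, gives the error \<open>O (z\<^bsup>-2N-2\<^esup>)\<close>.
\<close>

lemma even_eigenfunction_asymptotics:
  assumes eig: "H_eigenfunction \<mu> \<phi>" and norm: "L2_normalized \<phi>" and cont: "continuous_on UNIV \<phi>"
    and crit: "deriv airy (- \<mu>) = 0"
  shows "\<exists>c. cmod c = 1 \<and> (\<forall>N\<ge>2.
     (\<lambda>z::real. \<phi> z - c * complex_of_real (1 / sqrt (2 * pi) * (sqrt (2 / \<mu>) *
        (\<Sum>j=2..N. (- 1) ^ j * poly (airy_p (2 * j - 1)) (- \<mu>) / z ^ (2 * j)))))
     \<in> O[at_infinity](\<lambda>z. complex_of_real (1 / z ^ (2 * N + 2))))"
proof -
  obtain a s where par: "airy_parity \<mu> s" and \<phi>: "\<And>z. \<phi> z = a * ft (airy_profile \<mu> s) z"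
    and a: "(cmod a)\<^sup>2 * (4 * pi * (\<mu> * (airy (- \<mu>))\<^sup>2 + (deriv airy (- \<mu>))\<^sup>2)) = 1"
    using normalized_eigenfunction[OF eig norm cont] by metis
  have s: "s = 1" using par crit airy_no_double_zero[of "- \<mu>"] by (auto simp: airy_parity_def)
  have \<mu>: "\<mu> > 0" using crit airy_nonzero_of_nonneg(2)[of "- \<mu>"] by linarith
  define K where "K = 1 / sqrt (2 * pi) * sqrt (2 / \<mu>)"
  have K: "K > 0" using \<mu> by (simp add: K_def)
  have K2: "K\<^sup>2 = 1 / (pi * \<mu>)" using \<mu> by (simp add: K_def power_mult_distrib power_divide)
  define c where "c = a * complex_of_real (2 * airy (- \<mu>) / K)"
  have "(cmod c)\<^sup>2 = (cmod a)\<^sup>2 * (4 * (airy (- \<mu>))\<^sup>2 / K\<^sup>2)"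
    by (simp add: c_def norm_mult norm_divide power_mult_distrib power_divide)
  also have "\<dots> = 1" using a \<mu> unfolding K2 crit by (simp add: mult_ac)
  finally have c: "cmod c = 1" using norm_ge_zero[of c] by (auto simp: power2_eq_1_iff) 
  show ?thesis
  proof (intro exI[of _ c] conjI c allI impI)
    fix N :: nat assume N: "N \<ge> 2"
    let ?S = "\<lambda>z. \<Sum>j=2..N. (- 1) ^ j * poly (airy_p (2 * j - 1)) (- \<mu>) / z ^ (2 * j)"
    obtain C where C: "\<And>z. z \<noteq> 0 \<Longrightarrow>
        cmod (ft (airy_profile \<mu> s) z - (\<Sum>m<2 * N + 1. (\<i> / z) ^ Suc m * airy_boundary \<mu> s m)) \<le> C / \<bar>z\<bar> ^ Suc (2 * N + 1)"
      using ft_profile_remainder[OF par] by metis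
    have eq: "\<phi> z - c * complex_of_real (1 / sqrt (2 * pi) * (sqrt (2 / \<mu>) * ?S z)) =
        a * (ft (airy_profile \<mu> s) z - (\<Sum>m<2 * N + 1. (\<i> / z) ^ Suc m * airy_boundary \<mu> s m))" for z
    proof -
      have "c * complex_of_real (1 / sqrt (2 * pi) * (sqrt (2 / \<mu>) * ?S z)) = c * complex_of_real (K * ?S z)"
        by (simp add: K_def)
      also have "\<dots> = a * complex_of_real (2 * airy (- \<mu>) * ?S z)"
        using K by (simp add: c_def)
      also have "complex_of_real (2 * airy (- \<mu>) * ?S z) = (\<Sum>m<2 * N + 1. (\<i> / z) ^ Suc m * airy_boundary \<mu> s m)"
        unfolding s by (rule even_expansion_sum[OF crit, symmetric]) (use N in simp)
      finally show ?thesis by (simp add: \<phi> right_diff_distrib)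
    qed
    show "(\<lambda>z::real. \<phi> z - c * complex_of_real (1 / sqrt (2 * pi) * (sqrt (2 / \<mu>) * ?S z)))
       \<in> O[at_infinity](\<lambda>z. complex_of_real (1 / z ^ (2 * N + 2)))"
    proof (rule bigo_of_bound[where C = "cmod a * C"])
      fix z :: real assume "z \<noteq> 0"
      then have "cmod a * cmod (ft (airy_profile \<mu> s) z - (\<Sum>m<2 * N + 1. (\<i> / z) ^ Suc m * airy_boundary \<mu> s m))
          \<le> cmod a * (C / \<bar>z\<bar> ^ Suc (2 * N + 1))" by (intro mult_left_mono C) auto
      then show "cmod (\<phi> z - c * complex_of_real (1 / sqrt (2 * pi) * (sqrt (2 / \<mu>) * ?S z))) \<le> cmod a * C / \<bar>z\<bar> ^ (2 * N + 2)"
        unfolding eq norm_mult by simp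
    qed
  qed
qed

text \<open>
  As in the even case, with the factor \<open>2 \<i> Ai' (- \<mu>)\<close> and modulus \<open>(2 \<pi>)\<^bsup>-1/2\<^esup> 2\<^bsup>1/2\<^esup>\<close>.
\<close>

lemma odd_eigenfunction_asymptotics:
  assumes eig: "H_eigenfunction \<mu> \<phi>" and norm: "L2_normalized \<phi>" and cont: "continuous_on UNIV \<phi>"
    and zero: "airy (- \<mu>) = 0"
  shows "\<exists>c. cmod c = 1 \<and> (\<forall>N\<ge>2.
     (\<lambda>z::real. \<phi> z - c * complex_of_real (1 / sqrt (2 * pi) * (sqrt 2 *
        (\<Sum>j=2..N. (- 1) ^ j * poly (airy_q (2 * j)) (- \<mu>) / z ^ (2 * j + 1)))))
     \<in> O[at_infinity](\<lambda>z. complex_of_real (1 / z ^ (2 * N + 3))))"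
proof -
  obtain a s where par: "airy_parity \<mu> s" and \<phi>: "\<And>z. \<phi> z = a * ft (airy_profile \<mu> s) z"
    and a: "(cmod a)\<^sup>2 * (4 * pi * (\<mu> * (airy (- \<mu>))\<^sup>2 + (deriv airy (- \<mu>))\<^sup>2)) = 1"
    using normalized_eigenfunction[OF eig norm cont] by metis
  have s: "s = - 1" using par zero airy_no_double_zero[of "- \<mu>"] by (auto simp: airy_parity_def)
  define K where "K = 1 / sqrt (2 * pi) * sqrt 2"
  have K: "K > 0" by (simp add: K_def)
  have K2: "K\<^sup>2 = 1 / pi" by (simp add: K_def power_mult_distrib power_divide)
  define c where "c = a * \<i> * complex_of_real (2 * deriv airy (- \<mu>) / K)"
  have "(cmod c)\<^sup>2 = (cmod a)\<^sup>2 * (4 * (deriv airy (- \<mu>))\<^sup>2 / K\<^sup>2)"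
    by (simp add: c_def norm_mult norm_divide power_mult_distrib power_divide)
  also have "\<dots> = 1" using a unfolding K2 zero by (simp add: mult_ac)
  finally have c: "cmod c = 1" using norm_ge_zero[of c] by (auto simp: power2_eq_1_iff)
  show ?thesis
  proof (intro exI[of _ c] conjI c allI impI)
    fix N :: nat assume N: "N \<ge> 2"
    let ?S = "\<lambda>z. \<Sum>j=2..N. (- 1) ^ j * poly (airy_q (2 * j)) (- \<mu>) / z ^ (2 * j + 1)"
    obtain C where C: "\<And>z. z \<noteq> 0 \<Longrightarrow>
        cmod (ft (airy_profile \<mu> s) z - (\<Sum>m<2 * N + 2. (\<i> / z) ^ Suc m * airy_boundary \<mu> s m)) \<le> C / \<bar>z\<bar> ^ Suc (2 * N + 2)"
      using ft_profile_remainder[OF par] by metis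
    have eq: "\<phi> z - c * complex_of_real (1 / sqrt (2 * pi) * (sqrt 2 * ?S z)) =
        a * (ft (airy_profile \<mu> s) z - (\<Sum>m<2 * N + 2. (\<i> / z) ^ Suc m * airy_boundary \<mu> s m))" for z
    proof -
      have "c * complex_of_real (1 / sqrt (2 * pi) * (sqrt 2 * ?S z)) = c * complex_of_real (K * ?S z)"
        by (simp add: K_def)
      also have "\<dots> = a * (\<i> * complex_of_real (2 * deriv airy (- \<mu>) * ?S z))"
        using K by (simp add: c_def)
      also have "\<i> * complex_of_real (2 * deriv airy (- \<mu>) * ?S z) = (\<Sum>m<2 * N + 2. (\<i> / z) ^ Suc m * airy_boundary \<mu> s m)"
        unfolding s by (rule odd_expansion_sum[OF zero, symmetric]) (use N in simp)
      finally show ?thesis by (simp add: \<phi> right_diff_distrib)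
    qed
    show "(\<lambda>z::real. \<phi> z - c * complex_of_real (1 / sqrt (2 * pi) * (sqrt 2 * ?S z)))
       \<in> O[at_infinity](\<lambda>z. complex_of_real (1 / z ^ (2 * N + 3)))"
    proof (rule bigo_of_bound[where C = "cmod a * C"])
      fix z :: real assume "z \<noteq> 0"
      then have "cmod a * cmod (ft (airy_profile \<mu> s) z - (\<Sum>m<2 * N + 2. (\<i> / z) ^ Suc m * airy_boundary \<mu> s m))
          \<le> cmod a * (C / \<bar>z\<bar> ^ Suc (2 * N + 2))" by (intro mult_left_mono C) auto
      moreover have "Suc (2 * N + 2) = 2 * N + 3" by simp
      ultimately show "cmod (\<phi> z - c * complex_of_real (1 / sqrt (2 * pi) * (sqrt 2 * ?S z))) \<le> cmod a * C / \<bar>z\<bar> ^ (2 * N + 3)"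
        unfolding eq norm_mult by (simp only: times_divide_eq_right)
    qed
  qed
qed

text \<open>
  The alternating pattern splits the enumeration into the odd and the even places, which enumerate
  all zeros of \<open>Ai'\<close> and of \<open>Ai\<close> in decreasing order after negation. That the sets have a \<open>k\<close>-th
  largest element at all comes from the enumeration being indexed by the natural numbers.
\<close>

lemma eigenvalues_are_airy_zeros:
  fixes ev :: "nat \<Rightarrow> real"
  assumes mono: "strict_mono_on {1..} ev" and all: "ev ` {1..} = H_eigenvalues" and k: "k \<ge> 1"
  shows "ev (2 * k - 1) = - airy_deriv_zero k" "deriv airy (- ev (2 * k - 1)) = 0"
    "ev (2 * k) = - airy_zero k" "airy (- ev (2 * k)) = 0"
proof -
  note all' = all[unfolded H_eigenvalues_eq]
  note pat = eigenvalue_pattern[OF mono all']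
  have odd: "deriv airy (- ev (2 * j - 1)) = 0" if "j \<ge> 1" for j
    using pat[of "2 * j - 1"] that by simp
  have even: "airy (- ev (2 * j)) = 0" if "j \<ge> 1" for j
    using pat[of "2 * j"] that by simp
  show "deriv airy (- ev (2 * k - 1)) = 0" "airy (- ev (2 * k)) = 0"
    using odd even k by blast+
  have enum: "\<exists>n\<ge>1. x = - ev n" if "airy x = 0 \<or> deriv airy x = 0" for x
  proof -
    have "- x \<in> ev ` {1..}" unfolding all' using that by simp
    then show ?thesis by (metis atLeast_iff imageE minus_minus)
  qed
  have Zd: "{x. deriv airy x = 0} = (\<lambda>j. - ev (2 * j - 1)) ` {1..}"
  proof (intro set_eqI iffI)
    fix x assume x: "x \<in> {x. deriv airy x = 0}"
    then obtain n where n: "n \<ge> 1" "x = - ev n" using enum[of x] by auto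
    have "odd n" using pat[of n] n x airy_no_double_zero[of x] by (auto split: if_splits)
    then obtain i where "n = 2 * i + 1" by (rule oddE)
    then have "n = 2 * (i + 1) - 1" by simp
    then show "x \<in> (\<lambda>j. - ev (2 * j - 1)) ` {1..}" using n by (intro image_eqI[of _ _ "i + 1"]) auto
  qed (use odd in auto)
  have Z: "{x. airy x = 0} = (\<lambda>j. - ev (2 * j)) ` {1..}"
  proof (intro set_eqI iffI)
    fix x assume x: "x \<in> {x. airy x = 0}"
    then obtain n where n: "n \<ge> 1" "x = - ev n" using enum[of x] by auto
    have "even n" using pat[of n] n x airy_no_double_zero[of x] by (auto split: if_splits)
    then obtain i where "n = 2 * i" by (rule evenE)
    then show "x \<in> (\<lambda>j. - ev (2 * j)) ` {1..}" using n by (intro image_eqI[of _ _ i]) auto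
  qed (use even in auto)
  have "strict_mono_on {1..} (\<lambda>j. ev (2 * j - 1))" "strict_mono_on {1..} (\<lambda>j. ev (2 * j))"
    by (rule strict_mono_onI, rule strict_mono_onD[OF mono]; simp)+
  then show "ev (2 * k - 1) = - airy_deriv_zero k" "ev (2 * k) = - airy_zero k"
    unfolding airy_deriv_zero_def airy_zero_def
    using kth_largest_enum[OF _ k Zd] kth_largest_enum[OF _ k Z] by simp_all
qed

theorem theorem3p10:
  fixes ev :: "nat \<Rightarrow> real" and \<phi> :: "nat \<Rightarrow> real \<Rightarrow> complex"
  assumes ev_increasing: "strict_mono_on {1..} ev"
    and ev_all: "ev ` {1..} = H_eigenvalues"
    and eigen: "\<And>n. n \<ge> 1 \<Longrightarrow> H_eigenfunction (ev n) (\<phi> n)"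
    and normalized: "\<And>n. n \<ge> 1 \<Longrightarrow> L2_normalized (\<phi> n)"
    and continuous: "\<And>n. n \<ge> 1 \<Longrightarrow> continuous_on UNIV (\<phi> n)"
  shows "(\<forall>k\<ge>1. \<exists>c::complex. cmod c = 1 \<and> (\<forall>N\<ge>2.
           (\<lambda>z::real. \<phi> (2 * k - 1) z - c * complex_of_real (1 / sqrt (2 * pi) *
              (sqrt (2 / - airy_deriv_zero k) *
                (\<Sum>j=2..N. (-1) ^ j * poly (airy_p (2 * j - 1)) (airy_deriv_zero k) / z ^ (2 * j)))))
           \<in> O[at_infinity](\<lambda>z. complex_of_real (1 / z ^ (2 * N + 2)))))
       \<and> (\<forall>k\<ge>1. \<exists>c::complex. cmod c = 1 \<and> (\<forall>N\<ge>2.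
           (\<lambda>z::real. \<phi> (2 * k) z - c * complex_of_real (1 / sqrt (2 * pi) *
              (sqrt 2 *
                (\<Sum>j=2..N. (-1) ^ j * poly (airy_q (2 * j)) (airy_zero k) / z ^ (2 * j + 1)))))
           \<in> O[at_infinity](\<lambda>z. complex_of_real (1 / z ^ (2 * N + 3)))))"
proof (intro conjI allI impI)
  fix k :: nat assume k: "k \<ge> 1"
  note zeros = eigenvalues_are_airy_zeros[OF ev_increasing ev_all k]
  have "2 * k - 1 \<ge> 1" using k by simp
  from even_eigenfunction_asymptotics[OF eigen[OF this] normalized[OF this] continuous[OF this] zeros(2)]
  show "\<exists>c::complex. cmod c = 1 \<and> (\<forall>N\<ge>2.
           (\<lambda>z::real. \<phi> (2 * k - 1) z - c * complex_of_real (1 / sqrt (2 * pi) *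
              (sqrt (2 / - airy_deriv_zero k) *
                (\<Sum>j=2..N. (-1) ^ j * poly (airy_p (2 * j - 1)) (airy_deriv_zero k) / z ^ (2 * j)))))
           \<in> O[at_infinity](\<lambda>z. complex_of_real (1 / z ^ (2 * N + 2))))"
    unfolding zeros(1) minus_minus .
next
  fix k :: nat assume k: "k \<ge> 1"
  note zeros = eigenvalues_are_airy_zeros[OF ev_increasing ev_all k]
  have "2 * k \<ge> 1" using k by simp
  from odd_eigenfunction_asymptotics[OF eigen[OF this] normalized[OF this] continuous[OF this] zeros(4)]
  show "\<exists>c::complex. cmod c = 1 \<and> (\<forall>N\<ge>2.
           (\<lambda>z::real. \<phi> (2 * k) z - c * complex_of_real (1 / sqrt (2 * pi) *
              (sqrt 2 *
                (\<Sum>j=2..N. (-1) ^ j * poly (airy_q (2 * j)) (airy_zero k) / z ^ (2 * j + 1)))))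
           \<in> O[at_infinity](\<lambda>z. complex_of_real (1 / z ^ (2 * N + 3))))"
    unfolding zeros(3) minus_minus .
qed

end
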